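(* Let $\beta\in(0,1)$, $A<0$, $\alpha\in(1,2)$ with $\beta+1>\alpha$, $\gamma\in(0,1)$ with $\alpha+\gamma>2$, $\tau$ with $\tau+\gamma>1$, $p>\frac{1}{\alpha-1}$, and let $h:\mathbb{R}\to\mathbb{R}$ be measurable. Let $\mathcal{E}$ be the class of initial conditions $\xi=\xi^{(1)}+\xi^{(2)}+\xi^{(3)}$, $\xi^{(i)}\in\mathcal{E}^i$, with norm $\|\cdot\|_{\mathcal{X}}$, defined in the context. For $\xi\in\mathcal{E}$ and admissible $(f,\theta)$ (see context) with $f\in C^1((0,\infty))$, $\dot f\theta\in L^1([0,\infty))$ and $f\theta\in L^1([0,\infty))\cap L^p([0,\infty))$, consider $$X(t)=\xi_t+\frac{1}{\Gamma(\beta)}\int_0^t (t-s)^{\beta-1}[A X(s)+h(X(s))]\,ds+\frac{1}{\Gamma(\alpha)}\int_0^t(t-s)^{\alpha-1}f(s)\,d\theta_s,\qquad t\ge0.\qquad ( * )$$ (a) If there are $\delta_0>0$ and $C>0$ such that $A+C<0$ and $|h(x)|\le C|x|$ for all $|x|<\delta_0$, then any continuous solution of $( * )$ is asymptotically $(\mathcal{E},p)$-stable. (b) If there is $C>0$ such that $A+C<0$ and $|h(x)|\le C|x|$ for all $x\in\mathbb{R}$, then any continuous solution of $( * )$ is globally $\mathcal{E}$-stable in the large.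
   Context: $\Gamma$ is the Gamma function and $E_{a,b}(z)=\sum_{k\ge0} z^k/\Gamma(ka+b)$ is the Mittag-Leffler function. A pair $(f,\theta)$ is admissible if $\theta:[0,\infty)\to\mathbb{R}$ is $\gamma$-Hölder continuous (on each compact interval $[0,T]$) with $\theta_0=0$, and $f\in C^1(\mathbb{R}_+)$ is $\tau$-Hölder continuous (on each compact interval $[0,T]$); $\dot f$ is the derivative of $f$. Integrals $\int\cdot\,d\theta_s$ are Young integrals, i.e. limits of Riemann sums $\sum_i \phi_{t_i}(\theta_{t_{i+1}}-\theta_{t_i})$ as the mesh of the partition tends to $0$. Fix $\upsilon\in(0,\beta)$, $\eta\in(0,\beta+1)$ and $p_0>\max(1/\eta,1)$ (arbitrary). The classes are: - $\mathcal{E}^1$: continuous functions $\xi:[0,\infty)\to\mathbb{R}$ having a finite limit $\xi_\infty$ as $t\to\infty$; norm $\|\xi\|_{\mathcal{X}^1}=\sup_{t\ge0}|\xi_t|$. - $\mathcal{E}^2$: functions $\xi\in C^1([0,\infty))$ with $\lim_{t\to\infty}|\xi_t|/t^\beta=0$ and $|\xi_t'|\le \tilde C\, t^{\upsilon-1}$ for all $t>0$ and some $\tilde C\in\mathbb{R}$; norm $\|\xi\|_{\mathcal{X}^2}=\sup_{t\ge0}|\xi_tE_{\beta,1}(At^\beta)|+\sup_{t>0}t^{1-\upsilon}|\xi'_t|$. - $\mathcal{E}^3$: continuous functions of the form $\xi_t=\frac{1}{\Gamma(\eta)}\int_0^t(t-s)^{\eta-1}g(s)\,ds$ with $g\in L^1([0,\infty))\cap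 L^{p_0}([0,\infty))$; norm $\|\xi\|_{\mathcal{X}^3}=\|g\|_{L^1([0,\infty))}+\|g\|_{L^{p_0}([0,\infty))}$. $\mathcal{E}=\{\xi\in C([0,\infty)):\ \xi=\xi^{(1)}+\xi^{(2)}+\xi^{(3)},\ \xi^{(i)}\in\mathcal{E}^i\}$, with $\|\xi\|_{\mathcal{X}}=\sum_{i=1}^3\|\xi^{(i)}\|_{\mathcal{X}^i}$; smallness of $\|\xi\|_{\mathcal{X}}$ means that $\xi$ has a decomposition of this form for which this sum is correspondingly small. Any continuous solution of $( * )$ is said to be: - $(\mathcal{E},p)$-stable if for every $\varepsilon>0$ there is $\delta>0$ such that for all $\xi\in\mathcal{E}$ and admissible $(f,\theta)$ with $$\|\xi\|_{\mathcal{X}}+\|f\theta\|_{L^1([0,\infty))}+\|f\theta\|_{L^p([0,\infty))}+\|\dot f\theta\|_{L^1([0,\infty))}<\delta,\qquad (3)$$ every continuous solution $X:[0,\infty)\to\mathbb{R}$ satisfies $\sup_{t\ge0}|X(t)|<\varepsilon$; - asymptotically $(\mathcal{E},p)$-stable if it is $(\mathcal{E},p)$-stable and there is $\delta>0$ such that every continuous solution tends to $0$ as $t\to\infty$ for all $(\xi,f,\theta)$ satisfying (3); - globally $\mathcal{E}$-stable in the large (for given $(f,\theta)$ as in the claim) if for every $\xi\in\mathcal{E}$ every continuous solution tends to $0$ as $t\to\infty$. *)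

theory Defs
  imports "HOL-Analysis.Analysis"
begin

text \<open>Functions on \<open>[0, \<infinity>)\<close> are total functions on the reals of which only the
  values on \<open>{0..}\<close> are ever used.\<close>

definition mittag_leffler :: "real \<Rightarrow> real \<Rightarrow> real \<Rightarrow> real" where
  "mittag_leffler a b z = (\<Sum>k. z ^ k / Gamma (real k * a + b))"

definition locally_hoelder :: "real \<Rightarrow> (real \<Rightarrow> real) \<Rightarrow> bool" where
  "locally_hoelder \<gamma> u \<longleftrightarrow>
     (\<forall>T\<ge>0. \<exists>K. \<forall>s\<in>{0..T}. \<forall>t\<in>{0..T}. \<bar>u s - u t\<bar> \<le> K * \<bar>s - t\<bar> powr \<gamma>)"

definition has_young_integral ::
    "(real \<Rightarrow> real) \<Rightarrow> (real \<Rightarrow> real) \<Rightarrow> real \<Rightarrow> real \<Rightarrow> real \<Rightarrow> bool" where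
  "has_young_integral \<phi> \<theta> a b J \<longleftrightarrow>
     (\<forall>\<epsilon>>0. \<exists>\<delta>>0. \<forall>(n::nat) (\<sigma>::nat \<Rightarrow> real).
        \<sigma> 0 = a \<and> \<sigma> n = b \<and> (\<forall>i<n. \<sigma> i < \<sigma> (Suc i) \<and> \<sigma> (Suc i) - \<sigma> i < \<delta>) \<longrightarrow>
        \<bar>(\<Sum>i<n. \<phi> (\<sigma> i) * (\<theta> (\<sigma> (Suc i)) - \<theta> (\<sigma> i))) - J\<bar> < \<epsilon>)"

definition Lp_fun :: "real \<Rightarrow> (real \<Rightarrow> real) \<Rightarrow> bool" where
  "Lp_fun p g \<longleftrightarrow>
     set_borel_measurable lborel {0..} g \<and> set_integrable lborel {0..} (\<lambda>s. \<bar>g s\<bar> powr p)"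

definition Lp_norm :: "real \<Rightarrow> (real \<Rightarrow> real) \<Rightarrow> real" where
  "Lp_norm p g = (LBINT s:{0..}. \<bar>g s\<bar> powr p) powr (1 / p)"

text \<open>The suprema below are taken in \<^typ>\<open>ennreal\<close>, so that an unbounded family gives
  \<open>\<infinity>\<close>.\<close>

definition in_E1 :: "(real \<Rightarrow> real) \<Rightarrow> bool" where
  "in_E1 \<xi> \<longleftrightarrow> continuous_on {0..} \<xi> \<and> (\<exists>L. (\<xi> \<longlongrightarrow> L) at_top)"

definition norm_X1 :: "(real \<Rightarrow> real) \<Rightarrow> ennreal" where
  "norm_X1 \<xi> = (SUP t\<in>{0..}. ennreal \<bar>\<xi> t\<bar>)"

text \<open>At \<open>0\<close> the derivative is one-sided, which is why the library's
  \<open>C1_differentiable_on\<close> (two-sided derivatives) is not used here.\<close>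

definition in_E2 :: "real \<Rightarrow> real \<Rightarrow> (real \<Rightarrow> real) \<Rightarrow> bool" where
  "in_E2 \<beta> \<upsilon> \<xi> \<longleftrightarrow>
     (\<exists>\<xi>'. continuous_on {0..} \<xi>' \<and>
        (\<forall>t\<ge>0. (\<xi> has_real_derivative \<xi>' t) (at t within {0..})) \<and>
        (\<exists>C. \<forall>t>0. \<bar>\<xi>' t\<bar> \<le> C * t powr (\<upsilon> - 1))) \<and>
     ((\<lambda>t. \<bar>\<xi> t\<bar> / t powr \<beta>) \<longlongrightarrow> 0) at_top"

definition norm_X2 :: "real \<Rightarrow> real \<Rightarrow> real \<Rightarrow> (real \<Rightarrow> real) \<Rightarrow> ennreal" where
  "norm_X2 \<beta> A \<upsilon> \<xi> =
     (SUP t\<in>{0..}. ennreal \<bar>\<xi> t * mittag_leffler \<beta> 1 (A * t powr \<beta>)\<bar>) +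
     (SUP t\<in>{0<..}. ennreal (t powr (1 - \<upsilon>) * \<bar>deriv \<xi> t\<bar>))"

text \<open>Membership in the third class is kept relative to the density \<open>g\<close>, which \<open>\<xi>\<close>
  determines up to null sets and in terms of which the norm is defined.\<close>

definition E3_density :: "real \<Rightarrow> real \<Rightarrow> (real \<Rightarrow> real) \<Rightarrow> (real \<Rightarrow> real) \<Rightarrow> bool" where
  "E3_density \<eta> p0 \<xi> g \<longleftrightarrow>
     continuous_on {0..} \<xi> \<and> Lp_fun 1 g \<and> Lp_fun p0 g \<and>
     (\<forall>t\<ge>0. \<xi> t = 1 / Gamma \<eta> * (LBINT s:{0..t}. (t - s) powr (\<eta> - 1) * g s))"

definition norm_X3 :: "real \<Rightarrow> (real \<Rightarrow> real) \<Rightarrow> ennreal" where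
  "norm_X3 p0 g = ennreal (Lp_norm 1 g + Lp_norm p0 g)"

definition E_decomposition ::
    "real \<Rightarrow> real \<Rightarrow> real \<Rightarrow> real \<Rightarrow> (real \<Rightarrow> real) \<Rightarrow>
     (real \<Rightarrow> real) \<Rightarrow> (real \<Rightarrow> real) \<Rightarrow> (real \<Rightarrow> real) \<Rightarrow> (real \<Rightarrow> real) \<Rightarrow> bool" where
  "E_decomposition \<beta> \<upsilon> \<eta> p0 \<xi> \<xi>1 \<xi>2 \<xi>3 g \<longleftrightarrow>
     continuous_on {0..} \<xi> \<and> in_E1 \<xi>1 \<and> in_E2 \<beta> \<upsilon> \<xi>2 \<and> E3_density \<eta> p0 \<xi>3 g \<and>
     (\<forall>t\<ge>0. \<xi> t = \<xi>1 t + \<xi>2 t + \<xi>3 t)"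

definition in_E :: "real \<Rightarrow> real \<Rightarrow> real \<Rightarrow> real \<Rightarrow> (real \<Rightarrow> real) \<Rightarrow> bool" where
  "in_E \<beta> \<upsilon> \<eta> p0 \<xi> \<longleftrightarrow> (\<exists>\<xi>1 \<xi>2 \<xi>3 g. E_decomposition \<beta> \<upsilon> \<eta> p0 \<xi> \<xi>1 \<xi>2 \<xi>3 g)"

definition admissible :: "real \<Rightarrow> real \<Rightarrow> (real \<Rightarrow> real) \<Rightarrow> (real \<Rightarrow> real) \<Rightarrow> bool" where
  "admissible \<gamma> \<tau> f \<theta> \<longleftrightarrow>
     locally_hoelder \<gamma> \<theta> \<and> \<theta> 0 = 0 \<and> f C1_differentiable_on {0<..} \<and> locally_hoelder \<tau> f"

definition integrable_forcing :: "real \<Rightarrow> (real \<Rightarrow> real) \<Rightarrow> (real \<Rightarrow> real) \<Rightarrow> bool" where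
  "integrable_forcing p f \<theta> \<longleftrightarrow>
     Lp_fun 1 (\<lambda>s. deriv f s * \<theta> s) \<and> Lp_fun 1 (\<lambda>s. f s * \<theta> s) \<and> Lp_fun p (\<lambda>s. f s * \<theta> s)"

text \<open>Being a solution includes the existence of both integrals in the equation.\<close>

definition is_solution ::
    "real \<Rightarrow> real \<Rightarrow> real \<Rightarrow> (real \<Rightarrow> real) \<Rightarrow> (real \<Rightarrow> real) \<Rightarrow> (real \<Rightarrow> real) \<Rightarrow> (real \<Rightarrow> real) \<Rightarrow>
     (real \<Rightarrow> real) \<Rightarrow> bool" where
  "is_solution \<beta> A \<alpha> h \<xi> f \<theta> X \<longleftrightarrow>
     continuous_on {0..} X \<and>
     (\<forall>t\<ge>0.
        set_integrable lborel {0..t} (\<lambda>s. (t - s) powr (\<beta> - 1) * (A * X s + h (X s))) \<and>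
        (\<exists>J. has_young_integral (\<lambda>s. (t - s) powr (\<alpha> - 1) * f s) \<theta> 0 t J \<and>
           X t = \<xi> t
             + 1 / Gamma \<beta> * (LBINT s:{0..t}. (t - s) powr (\<beta> - 1) * (A * X s + h (X s)))
             + 1 / Gamma \<alpha> * J))"

text \<open>The norm of \<open>\<xi>\<close> depends on the decomposition; it is small if some decomposition makes
  it small.\<close>

definition small_data ::
    "real \<Rightarrow> real \<Rightarrow> real \<Rightarrow> real \<Rightarrow> real \<Rightarrow> real \<Rightarrow> real \<Rightarrow>
     (real \<Rightarrow> real) \<Rightarrow> (real \<Rightarrow> real) \<Rightarrow> (real \<Rightarrow> real) \<Rightarrow> bool" where
  "small_data \<beta> A \<upsilon> \<eta> p0 p \<delta> \<xi> f \<theta> \<longleftrightarrow>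
     integrable_forcing p f \<theta> \<and>
     (\<exists>\<xi>1 \<xi>2 \<xi>3 g. E_decomposition \<beta> \<upsilon> \<eta> p0 \<xi> \<xi>1 \<xi>2 \<xi>3 g \<and>
        (norm_X1 \<xi>1 + norm_X2 \<beta> A \<upsilon> \<xi>2 + norm_X3 p0 g)
          + ennreal (Lp_norm 1 (\<lambda>s. f s * \<theta> s) + Lp_norm p (\<lambda>s. f s * \<theta> s)
              + Lp_norm 1 (\<lambda>s. deriv f s * \<theta> s))
        < ennreal \<delta>)"

definition E_p_stable ::
    "real \<Rightarrow> real \<Rightarrow> real \<Rightarrow> real \<Rightarrow> real \<Rightarrow> real \<Rightarrow> real \<Rightarrow> real \<Rightarrow> real \<Rightarrow> (real \<Rightarrow> real) \<Rightarrow> bool" where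
  "E_p_stable \<beta> A \<alpha> \<gamma> \<tau> \<upsilon> \<eta> p0 p h \<longleftrightarrow>
     (\<forall>\<epsilon>>0. \<exists>\<delta>>0. \<forall>\<xi> f \<theta>.
        in_E \<beta> \<upsilon> \<eta> p0 \<xi> \<and> admissible \<gamma> \<tau> f \<theta> \<and> small_data \<beta> A \<upsilon> \<eta> p0 p \<delta> \<xi> f \<theta> \<longrightarrow>
        (\<forall>X. is_solution \<beta> A \<alpha> h \<xi> f \<theta> X \<longrightarrow> (SUP t\<in>{0..}. ennreal \<bar>X t\<bar>) < ennreal \<epsilon>))"

definition asymptotically_E_p_stable ::
    "real \<Rightarrow> real \<Rightarrow> real \<Rightarrow> real \<Rightarrow> real \<Rightarrow> real \<Rightarrow> real \<Rightarrow> real \<Rightarrow> real \<Rightarrow> (real \<Rightarrow> real) \<Rightarrow> bool" where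
  "asymptotically_E_p_stable \<beta> A \<alpha> \<gamma> \<tau> \<upsilon> \<eta> p0 p h \<longleftrightarrow>
     E_p_stable \<beta> A \<alpha> \<gamma> \<tau> \<upsilon> \<eta> p0 p h \<and>
     (\<exists>\<delta>>0. \<forall>\<xi> f \<theta>.
        in_E \<beta> \<upsilon> \<eta> p0 \<xi> \<and> admissible \<gamma> \<tau> f \<theta> \<and> small_data \<beta> A \<upsilon> \<eta> p0 p \<delta> \<xi> f \<theta> \<longrightarrow>
        (\<forall>X. is_solution \<beta> A \<alpha> h \<xi> f \<theta> X \<longrightarrow> (X \<longlongrightarrow> 0) at_top))"

definition globally_E_stable ::
    "real \<Rightarrow> real \<Rightarrow> real \<Rightarrow> real \<Rightarrow> real \<Rightarrow> real \<Rightarrow> (real \<Rightarrow> real) \<Rightarrow>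
     (real \<Rightarrow> real) \<Rightarrow> (real \<Rightarrow> real) \<Rightarrow> bool" where
  "globally_E_stable \<beta> A \<alpha> \<upsilon> \<eta> p0 h f \<theta> \<longleftrightarrow>
     (\<forall>\<xi>. in_E \<beta> \<upsilon> \<eta> p0 \<xi> \<longrightarrow>
        (\<forall>X. is_solution \<beta> A \<alpha> h \<xi> f \<theta> X \<longrightarrow> (X \<longlongrightarrow> 0) at_top))"

end

theory Submission
  imports Defs "HOL-Real_Asymp.Real_Asymp"
begin

text \<open>
  Write \<open>\<mu> = -A\<close> and \<open>k\<^sub>a(t) = t\<^bsup>a-1\<^esup> / \<Gamma>(a)\<close>, so that \<open>k\<^sub>a * k\<^sub>b = k\<^sub>a\<^sub>+\<^sub>b\<close>. The functions
  \<open>\<kappa>\<^sub>\<eta>(t) = t\<^bsup>\<eta>-1\<^esup> E\<^sub>\<beta>\<^sub>,\<^sub>\<eta>(-\<mu> t\<^bsup>\<beta>\<^esup>) = \<Sum>\<^sub>n (-\<mu>)\<^bsup>n\<^esup> k\<^bsub>\<eta>+n\<beta>\<^esub>(t)\<close> satisfy \<open>\<kappa>\<^sub>\<eta> * k\<^sub>a = \<kappa>\<^sub>\<eta>\<^sub>+\<^sub>a\<close> and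
  \<open>\<kappa>\<^sub>\<eta> = k\<^sub>\<eta> - \<mu> \<kappa>\<^sub>\<eta>\<^sub>+\<^sub>\<beta>\<close>, so \<open>R = \<mu> \<kappa>\<^sub>\<beta>\<close> is the resolvent of \<open>\<mu> k\<^sub>\<beta>\<close>. Log-convexity of \<open>k\<^sub>\<beta>\<close> makes \<open>R\<close>
  positive, whence its integral is at most \<open>1\<close> and \<open>\<kappa>\<^sub>\<eta> \<rightarrow> 0\<close> at infinity for every \<open>\<eta> < 1 + \<beta>\<close>.

  Convolving the equation with \<open>R\<close> turns it into \<open>X = Y + \<kappa>\<^sub>\<beta> * h(X)\<close> with \<open>Y = u - R * u\<close>, where \<open>u\<close> is
  the sum of \<open>\<xi>\<close> and the Young integral. Integration by parts gives \<open>k\<^bsub>\<alpha>-1\<^esub> * (f \<theta>) - k\<^sub>\<alpha> * (f' \<theta>)\<close> for the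
  latter, and \<open>k\<^sub>\<eta> * g - R * k\<^sub>\<eta> * g = \<kappa>\<^sub>\<eta> * g\<close>, so \<open>Y\<close> is bounded by the norms of the data and tends to \<open>0\<close>.
  Since \<open>\<bar>\<kappa>\<^sub>\<beta> * h(X)\<bar> \<le> (C / \<mu>) sup \<bar>X\<bar>\<close> with \<open>C / \<mu> < 1\<close>, the same holds for \<open>X\<close>.
\<close>

subsection \<open>Convolution with Riemann--Liouville kernels\<close>

text \<open>Positivity of R is what makes A + C < 0 sufficient: a resolvent of changing sign could
  have L^1 norm above 1, and C / \<mu> < 1 would then give no contraction. With positivity, R is a
  sub-probability density of total mass 1 in the limit, so R * \<phi> averages the past of \<phi>,
  and the weight of any fixed initial stretch tends to 0. The threshold 1 + \<beta> for decay comes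
  from comparing the kernel of order \<eta> with k of order \<eta> - \<beta>, which vanishes at
  infinity exactly when \<eta> - \<beta> < 1. This is where \<alpha> < 1 + \<beta>, \<eta> < 1 +
  \<beta> and \<upsilon> < \<beta> enter, the last one through a kernel of order 1 + \<upsilon>.
  Kernels of order below 1 are singular at 0, so an L^1 density alone does not give a bounded
  convolution; an additional L^p bound with p above the reciprocal of the order does, whence p > 1 /
  (\<alpha> - 1) and p0 > 1 / \<eta>. Integration by parts has to cope with an integrand whose
  derivative may be singular at both ends: (t - s) to the power \<alpha> - 2 at s = t, and f'
  without a limit at s = 0.\<close>

definition rl_ker :: "real \<Rightarrow> real \<Rightarrow> real" where
  "rl_ker a t = t powr (a - 1) / Gamma a"

definition conv :: "(real \<Rightarrow> real) \<Rightarrow> (real \<Rightarrow> real) \<Rightarrow> real \<Rightarrow> real" where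
  "conv a g t = (LBINT s:{0..t}. a (t - s) * g s)"

text \<open>The integral of a non-integrable function is \<open>0\<close> by default, so existence
  has to be carried separately from the value of \<open>conv\<close>.\<close>

definition conv_exists :: "(real \<Rightarrow> real) \<Rightarrow> (real \<Rightarrow> real) \<Rightarrow> real \<Rightarrow> bool" where
  "conv_exists a g t \<longleftrightarrow> set_integrable lborel {0..t} (\<lambda>s. a (t - s) * g s)"

lemma set_integral_reflect:
  fixes F :: "real \<Rightarrow> real"
  shows "(LBINT s:{a..t}. F (t - s)) = (LBINT s:{0..t-a}. F s)"
    and "set_integrable lborel {a..t} (\<lambda>s. F (t - s)) \<longleftrightarrow> set_integrable lborel {0..t-a} F"
proof -
  have *: "(\<lambda>s. indicator {a..t} s *\<^sub>R F (t - s)) = (\<lambda>s. (\<lambda>u. indicator {0..t-a} u *\<^sub>R F u) (t + (-1) * s))"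
    by (auto simp: fun_eq_iff indicator_def)
  show "(LBINT s:{a..t}. F (t - s)) = (LBINT s:{0..t-a}. F s)"
    unfolding set_lebesgue_integral_def *
    by (subst (2) lborel_integral_real_affine[where c="-1" and t=t]) auto
  show "set_integrable lborel {a..t} (\<lambda>s. F (t - s)) \<longleftrightarrow> set_integrable lborel {0..t-a} F"
    unfolding set_integrable_def *
    by (subst lborel_integrable_real_affine_iff) auto
qed

lemma conv_at_0: "a 0 = 0 \<Longrightarrow> conv a g 0 = 0"
proof -
  assume "a 0 = 0"
  then have "(\<lambda>s. indicator {0..0} s *\<^sub>R (a (0 - s) * g s)) = (\<lambda>s. 0)" by (auto simp: fun_eq_iff indicator_def)
  then show "conv a g 0 = 0" by (simp only: conv_def set_lebesgue_integral_def) simp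
qed

lemma conv_commute: "conv a g t = conv g a t"
  using set_integral_reflect(1)[of 0 t "\<lambda>s. g (t - s) * a s"]
  by (simp add: conv_def mult.commute)

lemma conv_exists_commute: "conv_exists a g t \<longleftrightarrow> conv_exists g a t"
  using set_integral_reflect(2)[of 0 t "\<lambda>s. g (t - s) * a s"]
  by (simp add: conv_exists_def mult.commute)

lemma rl_ker_measurable [measurable]: "rl_ker a \<in> borel_measurable borel"
  unfolding rl_ker_def by measurable

lemma rl_ker_nonneg: "0 < a \<Longrightarrow> 0 \<le> rl_ker a t"
  by (simp add: rl_ker_def Gamma_real_nonneg)

lemma rl_ker_pos: "0 < a \<Longrightarrow> 0 < t \<Longrightarrow> 0 < rl_ker a t"
  by (simp add: rl_ker_def Gamma_real_pos)

text \<open>This follows the convention \<open>0 powr x = 0\<close> and holds even for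
  \<open>a = 1\<close>, where the true kernel is constantly 1. Convolution with
  \<open>rl_ker 1\<close> therefore agrees with plain integration only through almost-everywhere
  equality.\<close>

lemma rl_ker_0 [simp]: "rl_ker a 0 = 0"
  by (simp add: rl_ker_def)

text \<open>The substitution s = t v turns the integral into a Beta integral, and B(b, a) =
  \<Gamma>(a) \<Gamma>(b) / \<Gamma>(a + b) supplies the constant.\<close>

lemma has_bochner_integral_rl_ker_conv:
  assumes "0 < a" "0 < b" "0 \<le> t"
  shows "has_bochner_integral lborel
    (\<lambda>s. indicator {0..t} s *\<^sub>R (rl_ker a (t - s) * rl_ker b s)) (rl_ker (a + b) t)"
proof (cases "t = 0")
  case True
  then have "(\<lambda>s. indicator {0..t} s *\<^sub>R (rl_ker a (t - s) * rl_ker b s)) = (\<lambda>s. 0)"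
    by (auto simp: fun_eq_iff indicator_def)
  with True show ?thesis by (simp add: has_bochner_integral_zero)
next
  case False
  with assms have t: "0 < t" by simp
  let ?F = "\<lambda>s. indicator {0..t} s *\<^sub>R (rl_ker a (t - s) * rl_ker b s) :: real"
  let ?f = "\<lambda>v. v powr (b - 1) * (1 - v) powr (a - 1) :: real"
  have "has_bochner_integral lborel (\<lambda>v. indicator {0..1} v *\<^sub>R ?f v) (Beta b a)"
  proof -
    have "(?f has_integral Beta b a) {0..1}"
      by (rule has_integral_Beta_real) (use assms in auto)
    then have hi: "((\<lambda>v. indicator {0..1} v *\<^sub>R ?f v) has_integral Beta b a) UNIV"
      by (subst (asm) has_integral_restrict_UNIV[symmetric], elim has_integral_eq[rotated])
        (auto simp: indicator_def)
    have nn: "0 \<le> indicator {0..1} v *\<^sub>R ?f v" for v :: real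
      by (auto simp: indicator_def)
    show ?thesis
    proof (rule has_bochner_integral_nn_integral)
      show "(\<integral>\<^sup>+ v. ennreal (indicator {0..1} v *\<^sub>R ?f v) \<partial>lborel) = ennreal (Beta b a)"
        by (rule nn_integral_has_integral_lborel[OF _ nn hi]) measurable
    qed (use nn assms in \<open>auto simp: Beta_def Gamma_real_nonneg\<close>)
  qed
  then have "has_bochner_integral lborel
      (\<lambda>v. (t powr (a + b - 2) / (Gamma a * Gamma b)) * (indicator {0..1} v *\<^sub>R ?f v))
      ((t powr (a + b - 2) / (Gamma a * Gamma b)) * Beta b a)"
    by (rule has_bochner_integral_mult_right)
  also have "(t powr (a + b - 2) / (Gamma a * Gamma b)) * Beta b a = rl_ker (a + b) t / t"
  proof -
    have "Gamma a > 0" "Gamma b > 0"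
      using assms by (auto intro: Gamma_real_pos)
    moreover have "t powr (a + b - 2) = t powr (a + b - 1) / t"
      using t powr_diff[of t "a + b - 1" 1] by (simp add: algebra_simps)
    ultimately show ?thesis
      by (simp add: Beta_def rl_ker_def add.commute)
  qed
  also have "(\<lambda>v. (t powr (a + b - 2) / (Gamma a * Gamma b)) * (indicator {0..1} v *\<^sub>R ?f v))
      = (\<lambda>v. ?F (0 + t * v))"
  proof
    fix v
    have "(t - t * v) powr (a - 1) = t powr (a - 1) * (1 - v) powr (a - 1)" if "v \<in> {0..1}"
      using t that powr_mult[of t "1 - v" "a - 1"] by (simp add: right_diff_distrib)
    moreover have "0 + t * v \<in> {0..t} \<longleftrightarrow> v \<in> {0..1}"
      using t by (auto simp: zero_le_mult_iff)
    ultimately show "(t powr (a + b - 2) / (Gamma a * Gamma b)) * (indicator {0..1} v *\<^sub>R ?f v) = ?F (0 + t * v)"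
      using t powr_add[of t "a - 1" "b - 1"]
      by (auto simp: indicator_def rl_ker_def powr_mult add_ac mult_ac)
  qed
  finally show ?thesis
    using t by (subst lborel_has_bochner_integral_real_affine_iff[where c=t and t=0]) (auto simp: field_simps)
qed

lemma conv_rl_ker:
  assumes "0 < a" "0 < b" "0 \<le> t"
  shows "conv (rl_ker a) (rl_ker b) t = rl_ker (a + b) t"
    and "conv_exists (rl_ker a) (rl_ker b) t"
  using has_bochner_integral_rl_ker_conv[OF assms]
  by (auto simp: conv_def conv_exists_def set_lebesgue_integral_def set_integrable_def has_bochner_integral_iff)

text \<open>The semigroup law with a first factor of order 1, which is 1 off a null set.\<close>

lemma set_integrable_rl_ker:
  assumes "0 < a"
  shows "set_integrable lborel {0..t} (rl_ker a)"
proof (cases "0 \<le> t")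
  case True
  have "conv_exists (rl_ker 1) (rl_ker a) t"
    using conv_rl_ker(2)[of 1 a t] True assms by simp
  then have "set_integrable lborel {0..t} (\<lambda>s. rl_ker 1 (t - s) * rl_ker a s)"
    by (simp add: conv_exists_def)
  moreover have "AE s\<in>{0..t} in lborel. rl_ker 1 (t - s) * rl_ker a s = rl_ker a s"
    using AE_lborel_singleton[of t] by eventually_elim (auto simp: rl_ker_def)
  ultimately show ?thesis
    by (subst (asm) set_integrable_cong_AE[where g="rl_ker a"]) (auto simp: set_borel_measurable_def)
qed auto

lemma set_integral_rl_ker:
  assumes "0 < a" "0 \<le> t"
  shows "(LBINT s:{0..t}. rl_ker a s) = rl_ker (a + 1) t"
proof -
  have "AE s\<in>{0..t} in lborel. rl_ker 1 (t - s) * rl_ker a s = rl_ker a s"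
    using AE_lborel_singleton[of t] by eventually_elim (auto simp: rl_ker_def)
  then have "(LBINT s:{0..t}. rl_ker 1 (t - s) * rl_ker a s) = (LBINT s:{0..t}. rl_ker a s)"
    by (intro set_lebesgue_integral_cong_AE) (auto)
  then show ?thesis
    using conv_rl_ker(1)[of 1 a t] assms by (simp add: conv_def add.commute)
qed

lemma conv_exists_bounded:
  assumes "set_integrable lborel {0..t} a"
    and "set_borel_measurable borel {0..t} g"
    and "\<And>s. 0 \<le> s \<Longrightarrow> s \<le> t \<Longrightarrow> \<bar>g s\<bar> \<le> B"
  shows "conv_exists a g t"
proof -
  have a: "set_integrable lborel {0..t} (\<lambda>s. a (t - s))"
    using assms(1) set_integral_reflect(2)[of 0 t a] by simp
  have Ba: "set_integrable lborel {0..t} (\<lambda>s. B * a (t - s))"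
    using a by simp
  have "(\<lambda>s. (indicator {0..t} s *\<^sub>R a (t - s)) * (indicator {0..t} s *\<^sub>R g s)) \<in> borel_measurable borel"
    using a assms(2) by (intro borel_measurable_times) (auto simp: set_integrable_def set_borel_measurable_def)
  moreover have "(\<lambda>s. (indicator {0..t} s *\<^sub>R a (t - s)) * (indicator {0..t} s *\<^sub>R g s)) =
      (\<lambda>s. indicator {0..t} s *\<^sub>R (a (t - s) * g s))"
    by (auto simp: fun_eq_iff indicator_def)
  ultimately have "set_borel_measurable lborel {0..t} (\<lambda>s. a (t - s) * g s)"
    by (simp add: set_borel_measurable_def)
  with Ba show ?thesis
    unfolding conv_exists_def
  proof (rule set_integrable_bound)
    have "\<bar>a (t - s) * g s\<bar> \<le> \<bar>B * a (t - s)\<bar>" if "s \<in> {0..t}" for s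
    proof -
      have "\<bar>g s\<bar> \<le> \<bar>B\<bar>" using assms(3)[of s] that by auto
      then show ?thesis by (simp add: abs_mult mult_right_mono mult.commute)
    qed
    then show "AE s in lborel. s \<in> {0..t} \<longrightarrow> norm (a (t - s) * g s) \<le> norm (B * a (t - s))"
      by auto
  qed
qed

text \<open>Fubini on the triangle 0 < r < s < t. Since \<open>a\<close> and \<open>b\<close> are
  nonnegative, integrating \<bar>F\<bar> over s gives exactly c(t - r) \<bar>g(r)\<bar>, so absolute
  integrability reduces to \<open>conv_exists c g t\<close>. A separate name \<open>c\<close> for
  the convolution of \<open>a\<close> and \<open>b\<close> lets a closed form be plugged in.\<close>

lemma conv_assoc:
  assumes a: "a \<in> borel_measurable borel" "\<And>s. 0 < s \<Longrightarrow> 0 \<le> a s"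
    and b: "b \<in> borel_measurable borel" "\<And>s. 0 < s \<Longrightarrow> 0 \<le> b s"
    and g: "set_borel_measurable borel {0..t} g"
    and c: "\<And>u. 0 \<le> u \<Longrightarrow> u \<le> t \<Longrightarrow> conv_exists a b u"
           "\<And>u. 0 \<le> u \<Longrightarrow> u \<le> t \<Longrightarrow> conv a b u = c u"
    and cg: "conv_exists c g t"
  shows "conv_exists a (conv b g) t" and "conv a (conv b g) t = conv c g t"
proof -
  define G where "G s = indicator {0..t} s * g s" for s
  have G [measurable]: "G \<in> borel_measurable borel"
    using g by (simp add: G_def[abs_def] set_borel_measurable_def)
  note a(1)[measurable] b(1)[measurable]
  \<comment> \<open>The strict inequalities discard the null sets where the arguments of
    \<open>a\<close> or \<open>b\<close> vanish, because the sign hypotheses speak only of positive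
    arguments.\<close>
  define F where "F = (\<lambda>(r, s). if 0 < r \<and> r < s \<and> s < t then a (t - s) * b (s - r) * G r else 0)"
  have F_meas [measurable]: "F \<in> borel_measurable (lborel \<Otimes>\<^sub>M lborel)"
    unfolding F_def by measurable
  have hb: "has_bochner_integral lborel (\<lambda>s. if r < s \<and> s < t then a (t - s) * b (s - r) else 0) (c (t - r))"
    if "0 \<le> r" "r \<le> t" for r
  proof -
    have "has_bochner_integral lborel (\<lambda>v. indicator {0..t-r} v *\<^sub>R (a (t - r - v) * b v)) (c (t - r))"
      using c[of "t - r"] that
      by (simp add: conv_exists_def conv_def has_bochner_integral_iff set_integrable_def set_lebesgue_integral_def)
    moreover have "AE v in lborel. indicator {0..t-r} v *\<^sub>R (a (t - r - v) * b v) =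
       (if r < r + v \<and> r + v < t then a (t - (r + v)) * b ((r + v) - r) else 0)"
      using AE_lborel_singleton[of 0] AE_lborel_singleton[of "t-r"]
      by eventually_elim (auto simp: indicator_def algebra_simps)
    ultimately have "has_bochner_integral lborel
       (\<lambda>v. (if r < r + v \<and> r + v < t then a (t - (r + v)) * b ((r + v) - r) else 0)) (c (t - r))"
      by (subst (asm) has_bochner_integral_cong_AE) (auto simp del: less_add_same_cancel1)
    then show ?thesis
      by (subst lborel_has_bochner_integral_real_affine_iff[where c=1 and t=r]) (simp_all only: mult_1 scaleR_one div_by_1 abs_one, simp_all)
  qed
  have hbx: "has_bochner_integral lborel (\<lambda>s. if 0 < r \<and> r < s \<and> s < t then a (t - s) * b (s - r) * x else 0)
      (if 0 < r \<and> r < t then c (t - r) * x else 0)" for r x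
  proof (cases "0 < r \<and> r < t")
    case True
    then have "has_bochner_integral lborel (\<lambda>s. (if r < s \<and> s < t then a (t - s) * b (s - r) else 0) * x) (c (t - r) * x)"
      by (intro has_bochner_integral_mult_left hb) auto
    also have "(\<lambda>s. (if r < s \<and> s < t then a (t - s) * b (s - r) else 0) * x) =
        (\<lambda>s. if 0 < r \<and> r < s \<and> s < t then a (t - s) * b (s - r) * x else 0)"
      using True by (auto simp: fun_eq_iff)
    finally show ?thesis using True by simp
  next
    case False
    then have "(\<lambda>s. if 0 < r \<and> r < s \<and> s < t then a (t - s) * b (s - r) * x else 0) = (\<lambda>s. 0)"
      by (auto simp: fun_eq_iff)
    with False show ?thesis by (auto simp: has_bochner_integral_zero)
  qed
  have hbF: "has_bochner_integral lborel (\<lambda>s. F (r, s)) (if 0 < r \<and> r < t then c (t - r) * G r else 0)" for r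
    using hbx[of r "G r"] by (simp add: F_def)
  have normF: "norm (F (r, s)) = (if 0 < r \<and> r < s \<and> s < t then a (t - s) * b (s - r) * \<bar>G r\<bar> else 0)" for r s
    using a(2) b(2) by (auto simp: F_def abs_mult)
  have hbFn: "has_bochner_integral lborel (\<lambda>s. norm (F (r, s))) (if 0 < r \<and> r < t then c (t - r) * \<bar>G r\<bar> else 0)" for r
    unfolding normF by (rule hbx)
  have cG: "integrable lborel (\<lambda>r. if 0 < r \<and> r < t then c (t - r) * G r else 0)"
  proof -
    have "integrable lborel (\<lambda>r. indicator {0<..<t} r *\<^sub>R (indicator {0..t} r *\<^sub>R (c (t - r) * g r)))"
      using cg by (rule_tac integrable_mult_indicator) (auto simp: conv_exists_def set_integrable_def)
    also have "(\<lambda>r. indicator {0<..<t} r *\<^sub>R (indicator {0..t} r *\<^sub>R (c (t - r) * g r))) =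
        (\<lambda>r. if 0 < r \<and> r < t then c (t - r) * G r else 0)"
      by (auto simp: G_def fun_eq_iff indicator_def)
    finally show ?thesis .
  qed
  have cGn: "integrable lborel (\<lambda>r. if 0 < r \<and> r < t then c (t - r) * \<bar>G r\<bar> else 0)"
  proof -
    have c0: "0 \<le> c u" if "0 \<le> u" "u \<le> t" for u
    proof -
      have "0 \<le> conv a b u"
        unfolding conv_def set_lebesgue_integral_def
        using AE_lborel_singleton[of 0] AE_lborel_singleton[of u]
        by (intro integral_nonneg_AE, eventually_elim) (auto simp: indicator_def intro!: mult_nonneg_nonneg a b)
      then show ?thesis using c(2) that by simp
    qed
    have "(\<lambda>r. if 0 < r \<and> r < t then c (t - r) * \<bar>G r\<bar> else 0) = (\<lambda>r. \<bar>if 0 < r \<and> r < t then c (t - r) * G r else 0\<bar>)"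
      using c0 by (auto simp: fun_eq_iff abs_mult)
    then show ?thesis using cG by (metis integrable_abs)
  qed
  have FI: "integrable (lborel \<Otimes>\<^sub>M lborel) F"
  proof (rule lborel_pair.Fubini_integrable[OF F_meas])
    show "integrable lborel (\<lambda>x. \<integral>y. norm (F (x, y)) \<partial>lborel)"
      using cGn hbFn by (simp add: has_bochner_integral_iff)
    show "AE x in lborel. integrable lborel (\<lambda>y. F (x, y))"
      using hbF by (simp add: has_bochner_integral_iff)
  qed
  have inner: "AE s in lborel. (\<integral>r. F (r, s) \<partial>lborel) = indicator {0..t} s *\<^sub>R (a (t - s) * conv b g s)"
    using AE_lborel_singleton[of 0] AE_lborel_singleton[of t]
  proof eventually_elim
    fix s :: real assume s: "s \<noteq> 0" "s \<noteq> t"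
    show "(\<integral>r. F (r, s) \<partial>lborel) = indicator {0..t} s *\<^sub>R (a (t - s) * conv b g s)"
    proof (cases "0 < s \<and> s < t")
      case True
      have "AE r in lborel. F (r, s) = a (t - s) * (indicator {0..s} r *\<^sub>R (b (s - r) * g r))"
        using AE_lborel_singleton[of 0] AE_lborel_singleton[of s] 
        by eventually_elim (use True in \<open>auto simp: F_def G_def indicator_def\<close>)
      moreover have "(\<lambda>r. indicator {0..s} r *\<^sub>R (b (s - r) * g r)) \<in> borel_measurable lborel"
      proof -
        have "(\<lambda>r. indicator {0..s} r *\<^sub>R (b (s - r) * G r)) \<in> borel_measurable lborel" by measurable
        also have "(\<lambda>r. indicator {0..s} r *\<^sub>R (b (s - r) * G r)) = (\<lambda>r. indicator {0..s} r *\<^sub>R (b (s - r) * g r))"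
          using True by (auto simp: fun_eq_iff G_def indicator_def)
        finally show ?thesis .
      qed
      ultimately have "(\<integral>r. F (r, s) \<partial>lborel) = (\<integral>r. a (t - s) * (indicator {0..s} r *\<^sub>R (b (s - r) * g r)) \<partial>lborel)"
        by (intro integral_cong_AE) auto
      then show ?thesis
        using True by (simp add: conv_def set_lebesgue_integral_def)
    next
      case False
      then have "(\<lambda>r. F (r, s)) = (\<lambda>r. 0)" by (auto simp: F_def fun_eq_iff)
      then show ?thesis using False s by (auto simp: indicator_def)
    qed
  qed
  have meas: "(\<lambda>s. indicator {0..t} s *\<^sub>R (a (t - s) * conv b g s)) \<in> borel_measurable lborel"
  proof -
    have "(\<lambda>s. indicator {0..t} s *\<^sub>R (a (t - s) * (\<integral>r. indicator {0..s} r *\<^sub>R (b (s - r) * G r) \<partial>lborel))) \<in> borel_measurable lborel"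
    proof -
      have [measurable]: "(\<lambda>(s,r). indicator {0..s} r *\<^sub>R (b (s - r) * G r)) \<in> borel_measurable (lborel \<Otimes>\<^sub>M lborel)"
        unfolding atLeastAtMost_def by (auto simp: indicator_def split_beta intro!: measurable_If)  measurable
      show ?thesis by measurable
    qed
    also have "(\<lambda>s. indicator {0..t} s *\<^sub>R (a (t - s) * (\<integral>r. indicator {0..s} r *\<^sub>R (b (s - r) * G r) \<partial>lborel))) =
      (\<lambda>s. indicator {0..t} s *\<^sub>R (a (t - s) * conv b g s))"
      by (auto simp: fun_eq_iff conv_def set_lebesgue_integral_def G_def indicator_def intro!: Bochner_Integration.integral_cong)
    finally show ?thesis .
  qed
  have m2: "(\<lambda>s. \<integral>r. F (r, s) \<partial>lborel) \<in> borel_measurable lborel"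
    by measurable
  have int2: "integrable lborel (\<lambda>s. \<integral>r. F (r, s) \<partial>lborel)"
    using lborel_pair.integrable_snd[of "\<lambda>r s. F (r, s)"] FI by simp
  then show "conv_exists a (conv b g) t"
    unfolding conv_exists_def set_integrable_def
    using integrable_cong_AE[OF m2 meas inner] by simp
  have "conv a (conv b g) t = (\<integral>s. \<integral>r. F (r, s) \<partial>lborel \<partial>lborel)"
    unfolding conv_def set_lebesgue_integral_def 
    using integral_cong_AE[OF m2 meas inner] by (simp add: conv_def set_lebesgue_integral_def)
  also have "\<dots> = (\<integral>r. \<integral>s. F (r, s) \<partial>lborel \<partial>lborel)"
    using lborel_pair.Fubini_integral[of "\<lambda>r s. F (r, s)"] FI by simp
  also have "\<dots> = (\<integral>r. (if 0 < r \<and> r < t then c (t - r) * G r else 0) \<partial>lborel)"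
    using hbF by (simp add: has_bochner_integral_iff)
  also have "\<dots> = conv c g t"
    unfolding conv_def set_lebesgue_integral_def
  proof (rule integral_cong_AE)
    show "AE r in lborel. (if 0 < r \<and> r < t then c (t - r) * G r else 0) = indicator {0..t} r *\<^sub>R (c (t - r) * g r)"
      using AE_lborel_singleton[of 0] AE_lborel_singleton[of t] 
      by eventually_elim (auto simp: G_def indicator_def)
  qed (use cG cg in \<open>auto simp: conv_exists_def set_integrable_def\<close>)
  finally show "conv a (conv b g) t = conv c g t" .
qed

lemma set_integral_split:
  fixes f :: "real \<Rightarrow> real"
  assumes "set_integrable lborel {a..c} f" "a \<le> b" "b \<le> c"
  shows "(LBINT s:{a..c}. f s) = (LBINT s:{a..b}. f s) + (LBINT s:{b..c}. f s)"
proof -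
  have "{a..c} = {a..b} \<union> {b..c}" using assms by auto
  moreover have "(LBINT s:{a..b} \<union> {b..c}. f s) = (LBINT s:{a..b}. f s) + (LBINT s:{b..c}. f s)"
    by (rule set_integral_Un_AE)
       (use assms AE_lborel_singleton[of b] in \<open>auto intro: set_integrable_subset elim!: eventually_mono\<close>)
  ultimately show ?thesis by simp
qed

subsection \<open>The Mittag-Leffler resolvent kernels\<close>

text \<open>Log-convexity of \<^const>\<open>Gamma\<close> on \<open>x + b \<le> x + 1 \<le> x + b + 1\<close>.\<close>

lemma Gamma_ratio_bound:
  fixes b x :: real
  assumes "0 < b" "b < 1" "b \<le> x"
  shows "Gamma x / Gamma (x + b) \<le> 2 * x powr (- b)"
proof -
  have x: "0 < x" using assms by linarith
  have pos: "Gamma x > 0" "Gamma (x + b) > 0" "Gamma (x + 1) > 0" "Gamma (x + b + 1) > 0"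
    using x assms by (auto intro!: Gamma_real_pos)
  \<comment> \<open>The weights b and 1 - b express x + 1 as a convex combination of x + b and x + b
    + 1. With the functional equation this becomes x \<Gamma>(x) \<le> (x + b)^(1 - b) \<Gamma>(x +
    b).\<close>
  have "(ln \<circ> Gamma) ((1 - (1 - b)) *\<^sub>R (x + b) + (1 - b) *\<^sub>R (x + b + 1)) \<le>
      (1 - (1 - b)) * (ln \<circ> Gamma) (x + b) + (1 - b) * (ln \<circ> Gamma) (x + b + 1)"
    by (rule convex_onD[OF log_convex_Gamma_real]) (use assms x in auto)
  moreover have "(1 - (1 - b)) *\<^sub>R (x + b) + (1 - b) *\<^sub>R (x + b + 1) = x + 1"
    by (simp add: algebra_simps)
  moreover have "Gamma (x + 1) = x * Gamma x" "Gamma (x + b + 1) = (x + b) * Gamma (x + b)"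
  proof -
    have "x \<notin> \<int>\<^sub>\<le>\<^sub>0" "x + b \<notin> \<int>\<^sub>\<le>\<^sub>0"
      using x assms by (auto elim!: nonpos_Ints_cases)
    then show "Gamma (x + 1) = x * Gamma x" "Gamma (x + b + 1) = (x + b) * Gamma (x + b)"
      by (simp_all add: Gamma_plus1)
  qed
  ultimately have "ln (x * Gamma x) \<le> b * ln (Gamma (x + b)) + (1 - b) * ln ((x + b) * Gamma (x + b))"
    by simp
  then have "ln x + ln (Gamma x) \<le> ln (Gamma (x + b)) + (1 - b) * ln (x + b)"
  proof -
    have "ln (x * Gamma x) = ln x + ln (Gamma x)" "ln ((x + b) * Gamma (x + b)) = ln (x + b) + ln (Gamma (x + b))"
      using x assms pos by (auto intro!: ln_mult_pos)
    moreover assume "ln (x * Gamma x) \<le> b * ln (Gamma (x + b)) + (1 - b) * ln ((x + b) * Gamma (x + b))"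
    ultimately show ?thesis by (simp add: algebra_simps)
  qed
  \<comment> \<open>Here b \<le> x enters, through x + b \<le> 2 x; the factor 2 of the statement is
    a bound for 2^(1 - b).\<close>
  also have "(1 - b) * ln (x + b) \<le> ln 2 + (1 - b) * ln x"
  proof -
    have "ln (x + b) \<le> ln (2 * x)" using assms x by simp
    then have "(1 - b) * ln (x + b) \<le> (1 - b) * (ln 2 + ln x)"
      using x assms by (intro mult_left_mono) (auto simp: ln_mult)
    also have "\<dots> \<le> ln 2 + (1 - b) * ln x"
      using assms by (simp add: algebra_simps)
    finally show ?thesis .
  qed
  finally have "ln (Gamma x) - ln (Gamma (x + b)) \<le> ln 2 - b * ln x"
    by (simp add: algebra_simps)
  then have "ln (Gamma x / Gamma (x + b)) \<le> ln (2 * x powr (- b))"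
    using x ln_divide_pos[OF pos(1,2)] ln_mult_pos[of 2 "x powr (- b)"] by (simp add: ln_powr)
  then show ?thesis
    using ln_le_cancel_iff[of "Gamma x / Gamma (x + b)" "2 * x powr (- b)"] divide_pos_pos[OF pos(1,2)] x by simp
qed

text \<open>Ratio test: with x = k b + c the quotient of consecutive terms is \<bar>z\<bar>
  \<Gamma>(x) / \<Gamma>(x + b), which \<open>Gamma_ratio_bound\<close> sends to 0.\<close>

lemma summable_mittag_leffler:
  assumes b: "0 < b" "b < 1" and c: "0 < c"
  shows "summable (\<lambda>k. z ^ k / Gamma (real k * b + c) :: real)"
proof -
  have "filterlim (\<lambda>k. real k * b + c) at_top sequentially"
    using b by (intro filterlim_tendsto_add_at_top[OF tendsto_const] filterlim_at_top_mult_tendsto_pos[OF tendsto_const] filterlim_real_sequentially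
      | subst add.commute)+
  then have "(\<lambda>k. \<bar>z\<bar> * (2 * (real k * b + c) powr (- b))) \<longlonglongrightarrow> \<bar>z\<bar> * (2 * 0)"
    using b by (intro tendsto_mult tendsto_const tendsto_neg_powr) auto
  then have "\<forall>\<^sub>F k in sequentially. \<bar>z\<bar> * (2 * (real k * b + c) powr (- b)) < 1 / 2"
    by (rule order_tendstoD(2)) auto
  then obtain N where N: "\<And>k. k \<ge> N \<Longrightarrow> \<bar>z\<bar> * (2 * (real k * b + c) powr (- b)) < 1 / 2"
    by (auto simp: eventually_sequentially)
  show ?thesis
  \<comment> \<open>Starting at k = 1 or later ensures b \<le> x, as
    \<open>Gamma_ratio_bound\<close> demands.\<close>
  proof (rule summable_ratio_test[of "1/2" "max N 1"])
    fix k assume k: "max N 1 \<le> k"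
    define x where "x = real k * b + c"
    have x: "b \<le> x" "0 < x"
      using mult_right_mono[of 1 "real k" b] k b c unfolding x_def by linarith+
    have pos: "Gamma x > 0" "Gamma (x + b) > 0"
      using x b by (auto intro!: Gamma_real_pos)
    have "\<bar>z\<bar> * (Gamma x / Gamma (x + b)) \<le> \<bar>z\<bar> * (2 * x powr (- b))"
      using Gamma_ratio_bound[OF b x(1)] by (rule mult_left_mono) auto
    also have "\<dots> \<le> 1 / 2" using N[of k] k by (simp add: x_def)
    finally have *: "\<bar>z\<bar> * (Gamma x / Gamma (x + b)) \<le> 1 / 2" .
    have "norm (z ^ Suc k / Gamma (real (Suc k) * b + c)) = \<bar>z\<bar> ^ k * (\<bar>z\<bar> / Gamma (x + b))"
      using pos by (simp add: x_def algebra_simps power_abs abs_mult)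
    also have "\<dots> = \<bar>z\<bar> ^ k / Gamma x * (\<bar>z\<bar> * (Gamma x / Gamma (x + b)))"
      using pos by simp
    also have "\<dots> \<le> \<bar>z\<bar> ^ k / Gamma x * (1 / 2)"
      using pos * by (intro mult_left_mono) auto
    also have "\<dots> = 1 / 2 * norm (z ^ k / Gamma (real k * b + c))"
      using pos by (simp add: x_def power_abs)
    finally show "norm (z ^ Suc k / Gamma (real (Suc k) * b + c)) \<le> 1 / 2 * norm (z ^ k / Gamma (real k * b + c))" .
  qed auto
qed

section \<open>The kernels as series of Riemann-Liouville kernels\<close>

locale fractional_resolvent =
  fixes \<beta> \<mu> :: real
  assumes beta: "0 < \<beta>" "\<beta> < 1" and lam: "0 < \<mu>"
begin

definition ker :: "real \<Rightarrow> real \<Rightarrow> real" where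
  "ker \<eta> t = t powr (\<eta> - 1) * mittag_leffler \<beta> \<eta> (- \<mu> * t powr \<beta>)"

lemma ker_0 [simp]: "ker \<eta> 0 = 0"
  by (simp add: ker_def)

lemma ker_measurable [measurable]: "ker \<eta> \<in> borel_measurable borel"
  unfolding ker_def[abs_def] mittag_leffler_def by measurable

text \<open>The factor \<open>c\<close> is left free because both signs occur: - \<mu> gives the
  kernel itself, + \<mu> the majorant that justifies termwise integration.\<close>

lemma summable_rl_ker:
  assumes "0 < \<eta>" "0 \<le> t"
  shows "summable (\<lambda>n. c ^ n * rl_ker (\<eta> + real n * \<beta>) t)"
    and "t powr (\<eta> - 1) * mittag_leffler \<beta> \<eta> (c * t powr \<beta>) = (\<Sum>n. c ^ n * rl_ker (\<eta> + real n * \<beta>) t)"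
proof -
  have eq: "t powr (\<eta> - 1) * ((c * t powr \<beta>) ^ n / Gamma (real n * \<beta> + \<eta>)) = c ^ n * rl_ker (\<eta> + real n * \<beta>) t" for n
  proof (cases "t = 0")
    case False
    have "t powr (\<eta> - 1) * (t powr \<beta>) ^ n = t powr (\<eta> + real n * \<beta> - 1)"
      using False by (simp add: powr_power flip: powr_add) (simp add: algebra_simps)
    then show ?thesis
      by (simp add: rl_ker_def power_mult_distrib add.commute)
  qed auto
  have s: "summable (\<lambda>n. (c * t powr \<beta>) ^ n / Gamma (real n * \<beta> + \<eta>))"
    by (rule summable_mittag_leffler) (use beta assms in auto)
  then show "summable (\<lambda>n. c ^ n * rl_ker (\<eta> + real n * \<beta>) t)"
    using summable_mult[OF s, of "t powr (\<eta> - 1)"] by (simp only: eq)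
  show "t powr (\<eta> - 1) * mittag_leffler \<beta> \<eta> (c * t powr \<beta>) = (\<Sum>n. c ^ n * rl_ker (\<eta> + real n * \<beta>) t)"
    unfolding mittag_leffler_def suminf_mult[OF s, symmetric] by (simp only: eq)
qed

lemma ker_eq_suminf:
  "0 < \<eta> \<Longrightarrow> 0 \<le> t \<Longrightarrow> ker \<eta> t = (\<Sum>n. (- \<mu>) ^ n * rl_ker (\<eta> + real n * \<beta>) t)"
  using summable_rl_ker(2)[of \<eta> t "- \<mu>"] by (simp add: ker_def)

lemma ker_rec:
  assumes "0 < \<eta>" "0 \<le> t"
  shows "ker \<eta> t = rl_ker \<eta> t - \<mu> * ker (\<eta> + \<beta>) t"
proof -
  have "ker \<eta> t = rl_ker \<eta> t + (\<Sum>n. (- \<mu>) ^ Suc n * rl_ker (\<eta> + real (Suc n) * \<beta>) t)"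
    using suminf_split_head[OF summable_rl_ker(1)[OF assms, of "-\<mu>"]] ker_eq_suminf[OF assms] by simp
  also have "(\<Sum>n. (- \<mu>) ^ Suc n * rl_ker (\<eta> + real (Suc n) * \<beta>) t) =
      (\<Sum>n. (- \<mu>) * ((- \<mu>) ^ n * rl_ker (\<eta> + \<beta> + real n * \<beta>) t))"
    by (rule suminf_cong) (simp add: algebra_simps)
  also have "\<dots> = (- \<mu>) * ker (\<eta> + \<beta>) t"
    using assms beta by (subst suminf_mult, intro summable_rl_ker) (auto simp: ker_eq_suminf)
  finally show ?thesis by simp
qed

text \<open>Termwise integration of the series. It is legitimate because the integrals of the
  absolute values form the same kind of series with + \<mu> in place of - \<mu>, which also
  converges.\<close>

lemma conv_ker_rl_ker:
  assumes "0 < \<eta>" "0 < a" "0 \<le> t"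
  shows "conv (ker \<eta>) (rl_ker a) t = ker (\<eta> + a) t"
    and "conv_exists (ker \<eta>) (rl_ker a) t"
proof -
  define f where "f n s = (- \<mu>) ^ n * (indicator {0..t} s *\<^sub>R (rl_ker (\<eta> + real n * \<beta>) (t - s) * rl_ker a s))" for n s
  have eta_n: "0 < \<eta> + real n * \<beta>" for n using assms beta by (simp add: add_pos_nonneg)
  have hb: "has_bochner_integral lborel (f n) ((- \<mu>) ^ n * rl_ker (\<eta> + a + real n * \<beta>) t)" for n
    unfolding f_def[abs_def]
    using has_bochner_integral_mult_right[OF has_bochner_integral_rl_ker_conv[OF eta_n[of n] assms(2,3)], of "(- \<mu>) ^ n"]
    by (simp add: add_ac)
  have hbn: "has_bochner_integral lborel (\<lambda>s. norm (f n s)) (\<mu> ^ n * rl_ker (\<eta> + a + real n * \<beta>) t)" for n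
  proof -
    have "has_bochner_integral lborel (\<lambda>s. \<mu> ^ n * (indicator {0..t} s *\<^sub>R (rl_ker (\<eta> + real n * \<beta>) (t - s) * rl_ker a s)))
        (\<mu> ^ n * rl_ker (\<eta> + real n * \<beta> + a) t)"
      by (intro has_bochner_integral_mult_right has_bochner_integral_rl_ker_conv eta_n assms)
    also have "(\<lambda>s. \<mu> ^ n * (indicator {0..t} s *\<^sub>R (rl_ker (\<eta> + real n * \<beta>) (t - s) * rl_ker a s))) = (\<lambda>s. norm (f n s))"
      using lam rl_ker_nonneg[OF eta_n] rl_ker_nonneg[OF assms(2)]
      by (auto simp: f_def fun_eq_iff abs_mult power_abs)
    finally show ?thesis by (simp add: add_ac)
  qed
  have fs: "f n s = indicator {0..t} s *\<^sub>R (((- \<mu>) ^ n * rl_ker (\<eta> + real n * \<beta>) (t - s)) * rl_ker a s)" for n s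
    by (simp add: f_def)
  have sumf: "(\<Sum>n. f n s) = indicator {0..t} s *\<^sub>R (ker \<eta> (t - s) * rl_ker a s)" for s
  proof (cases "s \<in> {0..t}")
    case True
    then have "(\<Sum>n. f n s) = (\<Sum>n. ((- \<mu>) ^ n * rl_ker (\<eta> + real n * \<beta>) (t - s)) * rl_ker a s)"
      by (simp add: fs)
    also have "\<dots> = ker \<eta> (t - s) * rl_ker a s"
      using True assms summable_rl_ker(1)[of \<eta> "t - s" "-\<mu>"] by (simp add: suminf_mult2 ker_eq_suminf)
    finally show ?thesis using True by simp
  qed (auto simp: f_def)
  have smn: "summable (\<lambda>n. norm (f n s))" for s
  proof (cases "s \<in> {0..t}")
    case True
    then have "norm (f n s) = (\<mu> ^ n * rl_ker (\<eta> + real n * \<beta>) (t - s)) * rl_ker a s" for n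
      using lam rl_ker_nonneg[OF eta_n] rl_ker_nonneg[OF assms(2)]
      by (simp add: f_def abs_mult power_abs)
    then show ?thesis
      using True assms summable_rl_ker(1)[of \<eta> "t - s" "\<mu>"] by (simp add: summable_mult2)
  qed (auto simp: f_def)
  have smi: "summable (\<lambda>n. \<integral>s. norm (f n s) \<partial>lborel)"
    using summable_rl_ker(1)[of "\<eta> + a" t \<mu>] assms hbn by (simp add: has_bochner_integral_iff)
  note A = integrable_suminf[of lborel f, OF _ _ smi] integral_suminf[of lborel f, OF _ _ smi]
  have i: "integrable lborel (\<lambda>s. \<Sum>n. f n s)"
    by (rule A(1)) (use hb smn in \<open>auto simp: has_bochner_integral_iff\<close>)
  then show "conv_exists (ker \<eta>) (rl_ker a) t"
    by (simp add: conv_exists_def set_integrable_def sumf)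
  have "conv (ker \<eta>) (rl_ker a) t = (\<integral>s. (\<Sum>n. f n s) \<partial>lborel)"
    by (simp add: conv_def set_lebesgue_integral_def sumf)
  also have "\<dots> = (\<Sum>n. \<integral>s. f n s \<partial>lborel)"
    by (rule A(2)) (use hb smn in \<open>auto simp: has_bochner_integral_iff\<close>)
  also have "\<dots> = ker (\<eta> + a) t"
    using hb assms by (simp add: ker_eq_suminf has_bochner_integral_iff)
  finally show "conv (ker \<eta>) (rl_ker a) t = ker (\<eta> + a) t" .
qed

lemma isCont_mittag_leffler:
  assumes "0 < \<eta>" shows "isCont (mittag_leffler \<beta> \<eta>) z"
proof -
  have "isCont (\<lambda>x. \<Sum>n. (1 / Gamma (real n * \<beta> + \<eta>)) * x ^ n) z"
    using isCont_powser_converges_everywhere[of "\<lambda>n. 1 / Gamma (real n * \<beta> + \<eta>)" z]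
      summable_mittag_leffler[OF beta assms] by simp
  then show ?thesis by (simp add: mittag_leffler_def[abs_def])
qed

lemma continuous_on_ker:
  assumes "0 < \<eta>" shows "continuous_on {0<..} (ker \<eta>)"
  unfolding ker_def[abs_def]
  by (intro continuous_intros continuous_on_compose2[OF continuous_at_imp_continuous_on[of UNIV "mittag_leffler \<beta> \<eta>"]])
     (auto simp: isCont_mittag_leffler assms)

lemma mittag_leffler_zero: "0 < \<eta> \<Longrightarrow> mittag_leffler \<beta> \<eta> 0 = 1 / Gamma \<eta>"
  using powser_zero[of "\<lambda>n. 1 / Gamma (real n * \<beta> + \<eta>)"] by (simp add: mittag_leffler_def)

text \<open>The Mittag-Leffler factor is continuous with value 1 / \<Gamma>(\<eta>) > 0 at 0. This
  gives the first-zero argument below its starting interval.\<close>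

lemma ker_pos_near_0:
  assumes "0 < \<eta>" shows "\<exists>d>0. \<forall>t. 0 < t \<and> t < d \<longrightarrow> 0 < ker \<eta> t"
proof -
  have "((\<lambda>t. mittag_leffler \<beta> \<eta> (- \<mu> * t powr \<beta>)) \<longlongrightarrow> mittag_leffler \<beta> \<eta> (- \<mu> * 0)) (at_right 0)"
  proof (rule isCont_tendsto_compose[OF isCont_mittag_leffler[OF assms]])
    have "((\<lambda>t. t powr \<beta>) \<longlongrightarrow> 0) (at_right 0)"
      using beta by real_asymp
    then show "((\<lambda>t. - \<mu> * t powr \<beta>) \<longlongrightarrow> - \<mu> * 0) (at_right 0)"
      by (intro tendsto_intros)
  qed
  then have "\<forall>\<^sub>F t in at_right 0. 0 < mittag_leffler \<beta> \<eta> (- \<mu> * t powr \<beta>)"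
    by (rule order_tendstoD(1)) (use assms in \<open>auto simp: mittag_leffler_zero Gamma_real_pos\<close>)
  then show ?thesis
    by (auto simp: eventually_at_right_field ker_def)
qed

lemma ker_beta_eq:
  assumes "0 \<le> t"
  shows "ker \<beta> t = rl_ker \<beta> t - \<mu> * conv (rl_ker \<beta>) (ker \<beta>) t"
    and "conv_exists (rl_ker \<beta>) (ker \<beta>) t"
  using ker_rec[OF beta(1) assms] conv_ker_rl_ker[OF beta(1) beta(1) assms]
  by (auto simp: conv_commute[of "rl_ker \<beta>"] conv_exists_commute[of "rl_ker \<beta>"])

section \<open>Positivity of the resolvent\<close>

text \<open>The log-convexity of \<^term>\<open>rl_ker \<beta>\<close>, in the form that
  \<open>k (t\<^sub>0 - s) / k (t\<^sub>1 - s)\<close> decreases in \<open>s\<close>.\<close>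

lemma rl_ker_ratio:
  assumes "0 \<le> s" "s < t1" "t1 \<le> t0"
  shows "rl_ker \<beta> (t0 - s) \<le> (t0 / t1) powr (\<beta> - 1) * rl_ker \<beta> (t1 - s)"
proof -
  \<comment> \<open>Dilation by t0 / t1 \<ge> 1 carries t1 - s to a point not beyond t0 - s; the
    kernel is decreasing and homogeneous of degree \<beta> - 1.\<close>
  have "s * t1 \<le> s * t0" using assms by (intro mult_left_mono) auto
  then have "t0 / t1 * (t1 - s) \<le> t0 - s"
    using assms by (simp add: field_simps)
  then have "(t0 - s) powr (\<beta> - 1) \<le> (t0 / t1 * (t1 - s)) powr (\<beta> - 1)"
    using assms beta by (intro powr_mono2') auto
  also have "\<dots> = (t0 / t1) powr (\<beta> - 1) * (t1 - s) powr (\<beta> - 1)"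
    by (rule powr_mult)
  finally show ?thesis
    using beta Gamma_real_pos[of \<beta>] by (simp add: rl_ker_def divide_right_mono)
qed

text \<open>Miller's argument for completely monotone kernels. At a first zero \<open>t\<^sub>0\<close>, compare the
  equation with the one at the maximum point \<open>t\<^sub>1\<close> of the kernel on \<open>[t\<^sub>0 - h, t\<^sub>0]\<close>.\<close>

lemma ker_beta_pos:
  assumes "0 < t" shows "0 < ker \<beta> t"
proof (rule ccontr)
  assume "\<not> 0 < ker \<beta> t"
  define S where "S = {t. 0 < t \<and> ker \<beta> t \<le> 0}"
  have S: "t \<in> S" using \<open>\<not> 0 < ker \<beta> t\<close> assms by (auto simp: S_def)
  obtain d where d: "0 < d" "\<And>t. 0 < t \<Longrightarrow> t < d \<Longrightarrow> 0 < ker \<beta> t"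
    using ker_pos_near_0[OF beta(1)] by auto
  have S_ge: "d \<le> s" if "s \<in> S" for s
    using d that by (force simp: S_def)
  define t0 where "t0 = Inf S"
  have bdd: "bdd_below S" using S_ge by (auto intro!: bdd_belowI[of _ d])
  have t0: "d \<le> t0" unfolding t0_def using S S_ge by (intro cInf_greatest) auto
  have before: "0 < ker \<beta> s" if "0 < s" "s < t0" for s
    using that bdd cInf_lower[of s S] by (force simp: S_def t0_def)
  have "closedin (top_of_set {0<..}) ({0<..} \<inter> ker \<beta> -` {..0})"
    using continuous_on_ker[OF beta(1)] by (intro continuous_closedin_preimage) auto
  moreover have "({0<..} \<inter> ker \<beta> -` {..0}) = S" by (auto simp: S_def)
  ultimately obtain T where T: "closed T" "S = {0<..} \<inter> T"
    by (auto simp: closedin_closed)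
  have "S = {d..} \<inter> T" using T S_ge d(1) by force
  then have "closed S" using T by auto
  then have t0S: "t0 \<in> S"
    unfolding t0_def using S bdd by (intro closed_contains_Inf) auto
  have t0_pos: "0 < t0" using d t0 by simp
  \<comment> \<open>The argument will end with \<rho> \<le> \<mu>
    \<open>rl_ker (\<beta> + 1) h\<close>. The width h is chosen to make the right side less than
    1/2, while h < t0 / 2 forces t0 / t1 \<le> 2 and hence \<rho> \<ge> 2^(\<beta> - 1) \<ge>
    1/2.\<close>
  have "((\<lambda>h. \<mu> * rl_ker (\<beta> + 1) h) \<longlongrightarrow> \<mu> * 0) (at_right 0)"
  proof (intro tendsto_mult tendsto_const)
    have "((\<lambda>h. h powr \<beta>) \<longlongrightarrow> 0) (at_right 0)" using beta by real_asymp
    then show "(rl_ker (\<beta> + 1) \<longlongrightarrow> 0) (at_right 0)"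
      by (auto simp: rl_ker_def[abs_def] intro: tendsto_divide_zero)
  qed
  then have "\<forall>\<^sub>F h in at_right 0. \<mu> * rl_ker (\<beta> + 1) h < 1/2"
    by (rule order_tendstoD(2)) auto
  moreover have "\<forall>\<^sub>F h in at_right 0. 0 < h \<and> h < t0 / 2"
    using t0_pos by (intro eventually_conj eventually_at_right_less eventually_at_rightI[of 0 "t0/2"]) auto
  ultimately have "\<forall>\<^sub>F h in at_right 0. \<mu> * rl_ker (\<beta> + 1) h < 1/2 \<and> 0 < h \<and> h < t0 / 2"
    by eventually_elim auto
  then obtain h where h: "\<mu> * rl_ker (\<beta> + 1) h < 1/2" "0 < h" "h < t0 / 2"
    using eventually_happens[of _ "at_right (0::real)"] by auto
  have "continuous_on {t0-h..t0} (ker \<beta>)"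
    using h t0_pos by (intro continuous_on_subset[OF continuous_on_ker[OF beta(1)]]) auto
  then obtain t1 where t1: "t1 \<in> {t0-h..t0}" "\<And>s. s \<in> {t0-h..t0} \<Longrightarrow> ker \<beta> s \<le> ker \<beta> t1"
    using continuous_attains_sup[of "{t0-h..t0}" "ker \<beta>"] h by auto
  define m where "m = ker \<beta> t1"
  have m: "0 < m" using t1(2)[of "t0 - h"] before[of "t0 - h"] h t0_pos by (auto simp: m_def)
  with t0S t1 have t1_less: "t1 < t0" by (cases "t1 = t0") (auto simp: S_def m_def)
  have t1_pos: "0 < t1" using t1 h by auto
  define \<rho> where "\<rho> = (t0 / t1) powr (\<beta> - 1)"
  have "t0 / t1 \<le> 2" using t1 h t1_pos by (simp add: field_simps)
  then have "2 powr (\<beta> - 1) \<le> \<rho>"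
    unfolding \<rho>_def using beta t1_pos t0_pos by (intro powr_mono2') auto
  moreover have "2 powr (-1) \<le> 2 powr (\<beta> - 1)" using beta by (intro powr_mono) auto
  ultimately have rho: "1 / 2 \<le> \<rho>" by (simp add: powr_minus)
  let ?k = "rl_ker \<beta>"
  have int0: "set_integrable lborel {0..t0} (\<lambda>s. ?k (t0 - s) * ker \<beta> s)"
    using ker_beta_eq(2)[of t0] t0_pos by (simp add: conv_exists_def)
  have int1: "set_integrable lborel {0..t1} (\<lambda>s. ?k (t1 - s) * ker \<beta> s)"
    using ker_beta_eq(2)[of t1] t1_pos by (simp add: conv_exists_def)
  have "conv ?k (ker \<beta>) t0 = (LBINT s:{0..t1}. ?k (t0 - s) * ker \<beta> s) + (LBINT s:{t1..t0}. ?k (t0 - s) * ker \<beta> s)"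
    unfolding conv_def using t1_pos t1_less by (intro set_integral_split int0) auto
  \<comment> \<open>Before \<open>t0\<close> the resolvent kernel is positive, so the ratio bound
    can be multiplied by it; this relates the memory at \<open>t0\<close> to that at
    \<open>t1\<close>.\<close>
  also have "(LBINT s:{0..t1}. ?k (t0 - s) * ker \<beta> s) \<le> (LBINT s:{0..t1}. \<rho> * (?k (t1 - s) * ker \<beta> s))"
  proof (rule set_integral_mono_AE)
    show "set_integrable lborel {0..t1} (\<lambda>s. ?k (t0 - s) * ker \<beta> s)"
      by (rule set_integrable_subset[OF int0]) (use t1_less in auto)
    show "set_integrable lborel {0..t1} (\<lambda>s. \<rho> * (?k (t1 - s) * ker \<beta> s))"
      using int1 by simp
    show "AE s\<in>{0..t1} in lborel. ?k (t0 - s) * ker \<beta> s \<le> \<rho> * (?k (t1 - s) * ker \<beta> s)"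
      using AE_lborel_singleton[of 0] AE_lborel_singleton[of t1]
    proof eventually_elim
      case (elim s)
      show ?case
      proof
        assume "s \<in> {0..t1}"
        with elim have s: "0 < s" "s < t1" by auto
        have "?k (t0 - s) * ker \<beta> s \<le> (\<rho> * ?k (t1 - s)) * ker \<beta> s"
          unfolding \<rho>_def using s t1_less before[of s] by (intro mult_right_mono rl_ker_ratio) auto
        then show "?k (t0 - s) * ker \<beta> s \<le> \<rho> * (?k (t1 - s) * ker \<beta> s)" by (simp add: mult_ac)
      qed
    qed
  qed
  also have "(LBINT s:{0..t1}. \<rho> * (?k (t1 - s) * ker \<beta> s)) = \<rho> * conv ?k (ker \<beta>) t1"
    by (simp add: conv_def)
  \<comment> \<open>On the short remaining interval only the maximum \<open>m\<close> is
    used.\<close>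
  also have "(LBINT s:{t1..t0}. ?k (t0 - s) * ker \<beta> s) \<le> (LBINT s:{t1..t0}. m * ?k (t0 - s))"
  proof (rule set_integral_mono)
    show "set_integrable lborel {t1..t0} (\<lambda>s. ?k (t0 - s) * ker \<beta> s)"
      by (rule set_integrable_subset[OF int0]) (use t1_pos in auto)
    have "set_integrable lborel {0..t0} (\<lambda>s. ?k (t0 - s))"
      using set_integral_reflect(2)[of 0 t0 ?k] set_integrable_rl_ker[OF beta(1)] by simp
    then show "set_integrable lborel {t1..t0} (\<lambda>s. m * ?k (t0 - s))"
      by (intro set_integrable_mult_right) (rule set_integrable_subset, use t1_pos in auto)
    show "?k (t0 - s) * ker \<beta> s \<le> m * ?k (t0 - s)" if "s \<in> {t1..t0}" for s
      using mult_right_mono[OF t1(2)[of s] rl_ker_nonneg[OF beta(1), of "t0 - s"]] that t1(1)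
      by (simp add: m_def mult.commute[of "?k (t0 - s)"])
  qed
  also have "(LBINT s:{t1..t0}. m * ?k (t0 - s)) = m * rl_ker (\<beta> + 1) (t0 - t1)"
    using set_integral_reflect(1)[of t1 t0 ?k] set_integral_rl_ker[OF beta(1), of "t0-t1"] t1_less by simp
  finally have 1: "conv ?k (ker \<beta>) t0 \<le> \<rho> * conv ?k (ker \<beta>) t1 + m * rl_ker (\<beta> + 1) (t0 - t1)"
    by simp
  have 2: "?k t0 \<le> \<mu> * conv ?k (ker \<beta>) t0"
    using ker_beta_eq(1)[of t0] t0S t0_pos by (simp add: S_def)
  \<comment> \<open>By homogeneity the free terms of the two equations match exactly under the
    factor \<rho>. They cancel on combination, leaving \<rho> m against the contribution of the
    short interval.\<close>
  have 3: "\<rho> * ?k t1 = ?k t0"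
  proof -
    have "t0 powr (\<beta> - 1) = (t0 / t1 * t1) powr (\<beta> - 1)" using t1_pos by simp
    also have "\<dots> = \<rho> * t1 powr (\<beta> - 1)" unfolding \<rho>_def by (rule powr_mult)
    finally show ?thesis by (simp add: rl_ker_def)
  qed
  have 4: "\<mu> * conv ?k (ker \<beta>) t1 = ?k t1 - m"
    using ker_beta_eq(1)[of t1] t1_pos by (simp add: m_def)
  have "\<mu> * conv ?k (ker \<beta>) t0 \<le> \<mu> * (\<rho> * conv ?k (ker \<beta>) t1 + m * rl_ker (\<beta> + 1) (t0 - t1))"
    using 1 lam by simp
  also have "\<dots> = \<rho> * (\<mu> * conv ?k (ker \<beta>) t1) + m * (\<mu> * rl_ker (\<beta> + 1) (t0 - t1))"
    by (simp add: algebra_simps)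
  also have "\<dots> = ?k t0 - \<rho> * m + m * (\<mu> * rl_ker (\<beta> + 1) (t0 - t1))"
    unfolding 4 using 3 by (simp add: algebra_simps)
  finally have "\<rho> * m \<le> m * (\<mu> * rl_ker (\<beta> + 1) (t0 - t1))" using 2 by linarith
  then have "\<rho> \<le> \<mu> * rl_ker (\<beta> + 1) (t0 - t1)" using m by (simp add: mult.commute)
  also have "\<dots> \<le> \<mu> * rl_ker (\<beta> + 1) h"
    using lam beta t1 t1_less Gamma_real_pos[of "\<beta> + 1"]
    by (auto simp: rl_ker_def intro!: mult_left_mono divide_right_mono powr_mono2)
  finally show False using h rho by simp
qed

text \<open>For \<eta> > \<beta> the kernel is the convolution of the positive
  \<open>ker \<beta>\<close> with a nonnegative Riemann-Liouville kernel.\<close>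

lemma ker_nonneg:
  assumes "\<beta> \<le> \<eta>" "0 \<le> t"
  shows "0 \<le> ker \<eta> t"
proof -
  have nn: "0 \<le> ker \<beta> s" if "0 \<le> s" for s
    using ker_beta_pos[of s] that by (cases "s = 0") auto
  show ?thesis
  proof (cases "\<eta> = \<beta>")
    case False
    then have eta: "0 < \<eta> - \<beta>" using assms by linarith
    have "ker \<eta> t = ker (\<beta> + (\<eta> - \<beta>)) t" by simp
    also have "\<dots> = conv (ker \<beta>) (rl_ker (\<eta> - \<beta>)) t"
      using conv_ker_rl_ker(1)[OF beta(1) eta assms(2)] by (rule sym)
    also have "0 \<le> \<dots>"
      unfolding conv_def set_lebesgue_integral_def
    proof (rule Bochner_Integration.integral_nonneg)
      fix s
      show "0 \<le> indicator {0..t} s *\<^sub>R (ker \<beta> (t - s) * rl_ker (\<eta> - \<beta>) s)"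
        using nn[of "t - s"] rl_ker_nonneg[OF eta, of s] by (cases "s \<in> {0..t}") auto
    qed
    finally show ?thesis .
  qed (use nn assms in auto)
qed

text \<open>The term dropped from \<open>ker_rec\<close> has order \<eta> + \<beta> \<ge> \<beta>,
  so its sign is known even when that of \<open>ker \<eta>\<close> is not.\<close>

lemma ker_le_rl_ker:
  assumes "0 < \<eta>" "0 \<le> t" shows "ker \<eta> t \<le> rl_ker \<eta> t"
  using ker_rec[OF assms] ker_nonneg[of "\<eta> + \<beta>" t] assms lam by simp

section \<open>Monotonicity, total mass and decay of the kernels\<close>

lemma set_integrable_ker:
  assumes "0 < \<eta>"
  shows "set_integrable lborel {0..t} (ker \<eta>)"
proof (cases "0 \<le> t")
  case True
  have "set_integrable lborel {0..t} (\<lambda>s. ker \<eta> (t - s) * rl_ker 1 s)"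
    using conv_ker_rl_ker(2)[OF assms zero_less_one True] by (simp add: conv_exists_def)
  moreover have "AE s\<in>{0..t} in lborel. ker \<eta> (t - s) * rl_ker 1 s = ker \<eta> (t - s)"
    using AE_lborel_singleton[of 0] by eventually_elim (auto simp: rl_ker_def)
  ultimately have "set_integrable lborel {0..t} (\<lambda>s. ker \<eta> (t - s))"
    by (subst (asm) set_integrable_cong_AE[where g="\<lambda>s. ker \<eta> (t - s)"]) auto
  then show ?thesis using set_integral_reflect(2)[of 0 t "ker \<eta>"] by simp
qed auto

lemma set_integral_ker:
  assumes "0 < \<eta>" "0 \<le> t"
  shows "(LBINT s:{0..t}. ker \<eta> s) = ker (\<eta> + 1) t"
    and "(LBINT s:{0..t}. ker \<eta> (t - s)) = ker (\<eta> + 1) t"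
proof -
  have "AE s\<in>{0..t} in lborel. ker \<eta> (t - s) * rl_ker 1 s = ker \<eta> (t - s)"
    using AE_lborel_singleton[of 0] by eventually_elim (auto simp: rl_ker_def)
  then have "(LBINT s:{0..t}. ker \<eta> (t - s) * rl_ker 1 s) = (LBINT s:{0..t}. ker \<eta> (t - s))"
    by (intro set_lebesgue_integral_cong_AE) auto
  then show "(LBINT s:{0..t}. ker \<eta> (t - s)) = ker (\<eta> + 1) t"
    using conv_ker_rl_ker(1)[OF assms(1) zero_less_one assms(2)] by (simp add: conv_def)
  then show "(LBINT s:{0..t}. ker \<eta> s) = ker (\<eta> + 1) t"
    using set_integral_reflect(1)[of 0 t "ker \<eta>"] by simp
qed

text \<open>\<open>ker (\<eta> + 1)\<close> is the antiderivative of the nonnegative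
  \<open>ker \<eta>\<close>.\<close>

lemma ker_mono:
  assumes "\<beta> \<le> \<eta>" "0 \<le> s" "s \<le> t"
  shows "ker (\<eta> + 1) s \<le> ker (\<eta> + 1) t"
proof -
  have eta: "0 < \<eta>" using assms beta by simp
  have "ker (\<eta> + 1) s = (LBINT u:{0..s}. ker \<eta> u)"
    using eta assms by (simp add: set_integral_ker)
  also have "\<dots> \<le> (LBINT u:{0..s}. ker \<eta> u) + (LBINT u:{s..t}. ker \<eta> u)"
    unfolding set_lebesgue_integral_def[of lborel "{s..t}"]
    using assms ker_nonneg by (simp add: indicator_def)
  also have "\<dots> = (LBINT u:{0..t}. ker \<eta> u)"
    by (rule set_integral_split[symmetric]) (use assms set_integrable_ker[OF eta] in auto)
  also have "\<dots> = ker (\<eta> + 1) t"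
    using eta assms by (simp add: set_integral_ker)
  finally show ?thesis .
qed

text \<open>The survival function \<open>E\<^sub>\<beta>\<^sub>,\<^sub>1 (- \<mu> t\<^sup>\<beta>)\<close>, with the right value \<open>1\<close> at \<open>t = 0\<close>.\<close>

definition surv :: "real \<Rightarrow> real" where
  "surv t = 1 - \<mu> * ker (\<beta> + 1) t"

lemma surv_eq: "0 < t \<Longrightarrow> surv t = ker 1 t"
  using ker_rec[of 1 t] by (simp add: surv_def rl_ker_def add.commute)

lemma surv_antimono: "0 \<le> s \<Longrightarrow> s \<le> t \<Longrightarrow> surv t \<le> surv s"
  using ker_mono[of \<beta> s t] lam by (simp add: surv_def)

lemma surv_nonneg: "0 \<le> t \<Longrightarrow> 0 \<le> surv t"
  using ker_nonneg[of 1 t] surv_eq[of t] beta by (cases "t = 0") (auto simp: surv_def)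

lemma surv_le_1: "0 \<le> t \<Longrightarrow> surv t \<le> 1"
  using ker_nonneg[of "\<beta> + 1" t] lam beta by (simp add: surv_def)

text \<open>Since \<open>ker 1\<close> decreases on the positive half line, its value at t times the
  mass of \<open>rl_ker \<beta>\<close> on [0, t] is at most their convolution
  \<open>ker (\<beta> + 1) t\<close>, which is at most 1 / \<mu>. The Gamma factors rewrite the
  resulting power t^(-\<beta>) as a Riemann-Liouville kernel, ready for further convolution.\<close>

lemma ker_1_bound:
  assumes "0 < t"
  shows "ker 1 t \<le> Gamma (\<beta> + 1) * Gamma (1 - \<beta>) / \<mu> * rl_ker (1 - \<beta>) t"
proof -
  have int: "set_integrable lborel {0..t} (\<lambda>s. rl_ker \<beta> s)"
    using set_integrable_rl_ker beta by auto
  have "ker 1 t * rl_ker (\<beta> + 1) t = (LBINT s:{0..t}. ker 1 t * rl_ker \<beta> s)"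
    using set_integral_rl_ker[of \<beta> t] beta assms by simp
  also have "\<dots> \<le> (LBINT s:{0..t}. ker 1 (t - s) * rl_ker \<beta> s)"
  proof (rule set_integral_mono_AE)
    show "set_integrable lborel {0..t} (\<lambda>s. ker 1 (t - s) * rl_ker \<beta> s)"
      using conv_ker_rl_ker(2)[of 1 \<beta> t] beta assms by (simp add: conv_exists_def)
    show "AE s\<in>{0..t} in lborel. ker 1 t * rl_ker \<beta> s \<le> ker 1 (t - s) * rl_ker \<beta> s"
      using AE_lborel_singleton[of t]
    proof eventually_elim
      case (elim s)
      then show ?case
        using surv_antimono[of "t - s" t] surv_eq[of t] surv_eq[of "t - s"] assms rl_ker_nonneg[OF beta(1), of s]
        by (auto intro!: mult_right_mono)
    qed
  qed (use int in auto)
  also have "\<dots> = ker (\<beta> + 1) t"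
    using conv_ker_rl_ker(1)[of 1 \<beta> t] beta assms by (simp add: conv_def add.commute)
  finally have "\<mu> * (ker 1 t * rl_ker (\<beta> + 1) t) \<le> \<mu> * ker (\<beta> + 1) t"
    using lam by simp
  also have "\<dots> \<le> 1" using surv_nonneg[of t] assms by (simp add: surv_def)
  finally have "ker 1 t * (\<mu> * rl_ker (\<beta> + 1) t) \<le> 1" by (simp add: mult_ac)
  then have "ker 1 t \<le> 1 / (\<mu> * rl_ker (\<beta> + 1) t)"
    using lam rl_ker_pos[of "\<beta> + 1" t] beta assms by (simp add: field_simps)
  also have "\<dots> = Gamma (\<beta> + 1) * Gamma (1 - \<beta>) / \<mu> * rl_ker (1 - \<beta>) t"
  proof -
    have "Gamma (1 - \<beta>) > 0" using beta by (auto intro: Gamma_real_pos)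
    then show ?thesis using assms by (simp add: rl_ker_def powr_minus divide_inverse)
  qed
  finally show ?thesis .
qed

lemma rl_ker_tendsto_0:
  assumes "a < 1" shows "(rl_ker a \<longlongrightarrow> 0) at_top"
proof -
  have "((\<lambda>t. t powr (a - 1)) \<longlongrightarrow> 0) at_top" using assms by real_asymp
  then show ?thesis by (auto simp: rl_ker_def[abs_def] intro: tendsto_divide_zero)
qed

text \<open>Convolving \<open>ker_1_bound\<close> with the kernel of order \<eta> - 1 bounds
  \<open>ker \<eta>\<close> by a multiple of \<open>rl_ker (\<eta> - \<beta>)\<close>, whose
  exponent is negative because \<eta> < 1 + \<beta>.\<close>

lemma ker_tendsto_0_ge_1:
  assumes "1 \<le> \<eta>" "\<eta> < 1 + \<beta>"
  shows "(ker \<eta> \<longlongrightarrow> 0) at_top"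
proof -
  define C where "C = Gamma (\<beta> + 1) * Gamma (1 - \<beta>) / \<mu>"
  have le: "ker \<eta> t \<le> C * rl_ker (\<eta> - \<beta>) t" if "0 < t" for t
  proof (cases "\<eta> = 1")
    case True
    then show ?thesis using ker_1_bound[OF that] by (simp add: C_def)
  next
    case False
    then have eta: "0 < \<eta> - 1" using assms by simp
    have "ker \<eta> t = (LBINT s:{0..t}. ker 1 (t - s) * rl_ker (\<eta> - 1) s)"
      using conv_ker_rl_ker(1)[of 1 "\<eta> - 1" t] eta that by (simp add: conv_def)
    also have "\<dots> \<le> (LBINT s:{0..t}. C * (rl_ker (1 - \<beta>) (t - s) * rl_ker (\<eta> - 1) s))"
    proof (rule set_integral_mono)
      show "set_integrable lborel {0..t} (\<lambda>s. ker 1 (t - s) * rl_ker (\<eta> - 1) s)"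
        using conv_ker_rl_ker(2)[of 1 "\<eta> - 1" t] eta that by (simp add: conv_exists_def)
      show "set_integrable lborel {0..t} (\<lambda>s. C * (rl_ker (1 - \<beta>) (t - s) * rl_ker (\<eta> - 1) s))"
        using conv_rl_ker(2)[of "1 - \<beta>" "\<eta> - 1" t] eta that beta by (simp add: conv_exists_def)
      show "ker 1 (t - s) * rl_ker (\<eta> - 1) s \<le> C * (rl_ker (1 - \<beta>) (t - s) * rl_ker (\<eta> - 1) s)"
        if s: "s \<in> {0..t}" for s
      proof (cases "s = t")
        case False
        then have *: "ker 1 (t - s) \<le> C * rl_ker (1 - \<beta>) (t - s)"
          using ker_1_bound[of "t - s"] s by (simp add: C_def)
        show ?thesis
          using mult_right_mono[OF * rl_ker_nonneg[OF eta, of s]] by (simp add: mult.assoc)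
      qed auto
    qed
    also have "\<dots> = C * rl_ker (\<eta> - \<beta>) t"
      using conv_rl_ker(1)[of "1 - \<beta>" "\<eta> - 1" t] eta that beta by (simp add: conv_def)
    finally show ?thesis .
  qed
  show ?thesis
  proof (rule tendsto_sandwich[where f="\<lambda>_. 0" and h="\<lambda>t. C * rl_ker (\<eta> - \<beta>) t"])
    show "((\<lambda>t. C * rl_ker (\<eta> - \<beta>) t) \<longlongrightarrow> 0) at_top"
      using rl_ker_tendsto_0[of "\<eta> - \<beta>"] assms by (auto intro: tendsto_mult_right_zero)
    show "\<forall>\<^sub>F t in at_top. ker \<eta> t \<le> C * rl_ker (\<eta> - \<beta>) t"
      using eventually_gt_at_top[of 0] by eventually_elim (rule le)
    show "\<forall>\<^sub>F t in at_top. 0 \<le> ker \<eta> t"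
      using eventually_ge_at_top[of 0] by eventually_elim (rule ker_nonneg, use assms beta in auto)
  qed auto
qed

text \<open>Three ranges: for \<eta> \<ge> 1 the previous lemma, for \<beta> \<le> \<eta> < 1 the
  comparison with \<open>rl_ker \<eta>\<close>, and for \<eta> < \<beta> the recursion, which leads
  to the order \<eta> + \<beta> of the other ranges.\<close>

lemma ker_tendsto_0:
  assumes "0 < \<eta>" "\<eta> < 1 + \<beta>"
  shows "(ker \<eta> \<longlongrightarrow> 0) at_top"
proof -
  have *: "(ker \<eta> \<longlongrightarrow> 0) at_top" if "\<beta> \<le> \<eta>" "\<eta> < 1 + \<beta>" for \<eta>
  proof (cases "1 \<le> \<eta>")
    case False
    show ?thesis
    proof (rule tendsto_sandwich[where f="\<lambda>_. 0" and h="rl_ker \<eta>"])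
      show "(rl_ker \<eta> \<longlongrightarrow> 0) at_top"
        using rl_ker_tendsto_0 False by auto
      show "\<forall>\<^sub>F t in at_top. ker \<eta> t \<le> rl_ker \<eta> t"
        using eventually_ge_at_top[of 0] by eventually_elim (rule ker_le_rl_ker, use that beta in auto)
      show "\<forall>\<^sub>F t in at_top. 0 \<le> ker \<eta> t"
        using eventually_ge_at_top[of 0] by eventually_elim (rule ker_nonneg, use that beta in auto)
    qed auto
  qed (use ker_tendsto_0_ge_1 that in auto)
  show ?thesis
  proof (cases "\<beta> \<le> \<eta>")
    case False
    have "((\<lambda>t. rl_ker \<eta> t - \<mu> * ker (\<eta> + \<beta>) t) \<longlongrightarrow> 0 - \<mu> * 0) at_top"
      using False beta assms by (intro tendsto_intros rl_ker_tendsto_0 *) auto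
    moreover have "\<forall>\<^sub>F t in at_top. rl_ker \<eta> t - \<mu> * ker (\<eta> + \<beta>) t = ker \<eta> t"
      using eventually_ge_at_top[of 0] by eventually_elim (use ker_rec assms in auto)
    ultimately show ?thesis
      using tendsto_cong[of "\<lambda>t. rl_ker \<eta> t - \<mu> * ker (\<eta> + \<beta>) t" "ker \<eta>" at_top 0] by simp
  qed (use * assms in auto)
qed

lemma surv_tendsto_0: "(surv \<longlongrightarrow> 0) at_top"
proof -
  have "\<forall>\<^sub>F t in at_top. surv t = ker 1 t"
    using eventually_gt_at_top[of 0] by eventually_elim (rule surv_eq)
  then show ?thesis using ker_tendsto_0[of 1] beta tendsto_cong[of surv "ker 1" at_top 0] by simp
qed

text \<open>The only singularity is that of t^(\<eta> - 1) at 0, and decay handles large t;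
  \<open>K\<close> merges the estimates on (0, 1], (1, T] and beyond T.\<close>

lemma ker_bound:
  assumes "0 < \<eta>" "\<eta> < 1 + \<beta>"
  shows "\<exists>K>0. \<forall>t>0. \<bar>ker \<eta> t\<bar> \<le> K * (1 + (if t \<le> 1 then t powr (\<eta> - 1) else 0))"
proof -
  have "\<forall>\<^sub>F t in at_top. \<bar>ker \<eta> t\<bar> < 1"
    using tendsto_rabs_zero[OF ker_tendsto_0[OF assms]] by (rule order_tendstoD(2)) auto
  then obtain N where N: "\<And>t. N \<le> t \<Longrightarrow> \<bar>ker \<eta> t\<bar> < 1" by (auto simp: eventually_at_top_linorder)
  define T where "T = max N 1"
  have Gpos: "Gamma \<eta> > 0" "Gamma (\<eta> + \<beta>) > 0" using assms beta by (auto intro: Gamma_real_pos)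
  \<comment> \<open>On (1, T] this dominates both powers t^(\<eta> - 1) and t^(\<eta> + \<beta> - 1)
    that occur in \<open>abs_le\<close>.\<close>
  define M where "M = T powr (\<eta> + \<beta>)"
  have M: "0 < M" by (simp add: M_def T_def)
  define K where "K = 1 + (1 / Gamma \<eta> + \<mu> / Gamma (\<eta> + \<beta>)) * (1 + M)"
  have K: "1 \<le> K" using Gpos lam M by (simp add: K_def)
  \<comment> \<open>For \<eta> < \<beta> no sign of \<open>ker \<eta>\<close> is available, so the
    bound goes through the two nonnegative terms of \<open>ker_rec\<close>.\<close>
  have abs_le: "\<bar>ker \<eta> t\<bar> \<le> t powr (\<eta> - 1) / Gamma \<eta> + \<mu> * (t powr (\<eta> + \<beta> - 1) / Gamma (\<eta> + \<beta>))"
    if t: "0 < t" for t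
  proof -
    have "0 \<le> ker (\<eta> + \<beta>) t" by (rule ker_nonneg) (use assms t in auto)
    moreover have "\<mu> * ker (\<eta> + \<beta>) t \<le> \<mu> * rl_ker (\<eta> + \<beta>) t"
      using lam t assms beta by (intro mult_left_mono ker_le_rl_ker) auto
    moreover have "0 \<le> rl_ker \<eta> t" using assms by (rule_tac rl_ker_nonneg)
    moreover have "0 \<le> \<mu> * ker (\<eta> + \<beta>) t" using \<open>0 \<le> ker (\<eta> + \<beta>) t\<close> lam by simp
    ultimately show ?thesis
      using ker_rec[OF assms(1), of t] t by (simp add: rl_ker_def)
  qed
  have "\<bar>ker \<eta> t\<bar> \<le> K * (1 + (if t \<le> 1 then t powr (\<eta> - 1) else 0))" if t: "0 < t" for t
  proof -
    consider "t \<le> 1" | "1 < t" "t \<le> T" | "T < t" by linarith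
    then show ?thesis
    proof cases
      case 1
      have "t powr (\<eta> + \<beta> - 1) \<le> t powr (\<eta> - 1)"
        using 1 t beta by (intro powr_mono') auto
      then have "\<mu> * (t powr (\<eta> + \<beta> - 1) / Gamma (\<eta> + \<beta>)) \<le> \<mu> * (t powr (\<eta> - 1) / Gamma (\<eta> + \<beta>))"
        using lam Gpos by (intro mult_left_mono divide_right_mono) auto
      then have "\<bar>ker \<eta> t\<bar> \<le> (1 / Gamma \<eta> + \<mu> / Gamma (\<eta> + \<beta>)) * t powr (\<eta> - 1)"
        using abs_le[OF t] by (simp add: algebra_simps)
      also have "\<dots> \<le> K * t powr (\<eta> - 1)"
      proof (rule mult_right_mono)
        have "0 \<le> 1 / Gamma \<eta> + \<mu> / Gamma (\<eta> + \<beta>)" using Gpos lam by simp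
        then have "(1 / Gamma \<eta> + \<mu> / Gamma (\<eta> + \<beta>)) * 1 \<le> (1 / Gamma \<eta> + \<mu> / Gamma (\<eta> + \<beta>)) * (1 + M)"
          using M by (intro mult_left_mono) auto
        then show "1 / Gamma \<eta> + \<mu> / Gamma (\<eta> + \<beta>) \<le> K" by (simp add: K_def)
      qed simp
      also have "\<dots> \<le> K * (1 + (if t \<le> 1 then t powr (\<eta> - 1) else 0))"
        using K 1 by (intro mult_left_mono) auto
      finally show ?thesis .
    next
      case 2
      have "t powr (\<eta> + \<beta>) \<le> M"
        unfolding M_def using 2 t assms beta by (intro powr_mono2) auto
      moreover have "t powr (\<eta> - 1) \<le> t powr (\<eta> + \<beta>)" "t powr (\<eta> + \<beta> - 1) \<le> t powr (\<eta> + \<beta>)"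
        using 2 beta by (auto intro!: powr_mono)
      ultimately have "t powr (\<eta> - 1) \<le> M" "t powr (\<eta> + \<beta> - 1) \<le> M" by linarith+
      then have "\<mu> * (t powr (\<eta> + \<beta> - 1) / Gamma (\<eta> + \<beta>)) \<le> \<mu> * (M / Gamma (\<eta> + \<beta>))"
         "t powr (\<eta> - 1) / Gamma \<eta> \<le> M / Gamma \<eta>"
        using lam Gpos by (auto intro!: mult_left_mono divide_right_mono)
      then have "\<bar>ker \<eta> t\<bar> \<le> (1 / Gamma \<eta> + \<mu> / Gamma (\<eta> + \<beta>)) * M"
        using abs_le[OF t] by (simp add: algebra_simps)
      also have "\<dots> \<le> K" using Gpos lam by (simp add: K_def distrib_left)
      finally show ?thesis using 2 by simp
    next
      case 3
      then show ?thesis using N[of t] K by (auto simp: T_def)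
    qed
  qed
  then show ?thesis using K by (intro exI[of _ K]) auto
qed

end

subsection \<open>Weighted bounds for integrable densities\<close>

lemma conv_cong: "(\<And>s. 0 \<le> s \<Longrightarrow> s \<le> t \<Longrightarrow> f s = g s) \<Longrightarrow> conv a f t = conv a g t"
  unfolding conv_def by (intro set_lebesgue_integral_cong) auto

lemma conv_exists_cong:
  "(\<And>s. 0 \<le> s \<Longrightarrow> s \<le> t \<Longrightarrow> f s = g s) \<Longrightarrow> conv_exists a f t \<longleftrightarrow> conv_exists a g t"
  unfolding conv_exists_def by (intro set_integrable_cong) auto

lemma conv_cong_left: "(\<And>u. 0 \<le> u \<Longrightarrow> u \<le> t \<Longrightarrow> a u = b u) \<Longrightarrow> conv a f t = conv b f t"
  unfolding conv_def by (intro set_lebesgue_integral_cong) auto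

lemma conv_add:
  assumes "conv_exists a f t" "conv_exists a g t"
  shows "conv_exists a (\<lambda>s. f s + g s) t" "conv a (\<lambda>s. f s + g s) t = conv a f t + conv a g t"
  using assms by (simp_all add: conv_def conv_exists_def distrib_left)

lemma conv_diff:
  assumes "conv_exists a f t" "conv_exists a g t"
  shows "conv_exists a (\<lambda>s. f s - g s) t" "conv a (\<lambda>s. f s - g s) t = conv a f t - conv a g t"
  using assms by (simp_all add: conv_def conv_exists_def right_diff_distrib)

lemma conv_diff_left:
  assumes "conv_exists a f t" "conv_exists b f t"
  shows "conv (\<lambda>u. a u - b u) f t = conv a f t - conv b f t"
  using assms by (simp add: conv_def conv_exists_def left_diff_distrib)

lemma conv_cmult: "conv a (\<lambda>s. c * f s) t = c * conv a f t"
  by (simp add: conv_def mult.left_commute)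

lemma conv_exists_cmult: "conv_exists a f t \<Longrightarrow> conv_exists a (\<lambda>s. c * f s) t"
  by (simp add: conv_exists_def mult.left_commute)

lemma conv_cmult_left: "conv (\<lambda>u. c * a u) f t = c * conv a f t"
  by (simp add: conv_def mult.assoc)

lemma abs_set_integral_le:
  fixes f :: "real \<Rightarrow> real"
  shows "\<bar>LBINT s:A. f s\<bar> \<le> (LBINT s:A. \<bar>f s\<bar>)"
  unfolding set_lebesgue_integral_def
  using integral_abs_bound[of lborel "\<lambda>s. indicator A s *\<^sub>R f s"] by (simp add: abs_mult)

lemma set_borel_measurable_mult_reflect:
  fixes a g :: "real \<Rightarrow> real"
  assumes [measurable]: "a \<in> borel_measurable borel" and g: "set_borel_measurable borel A g" 
    and sub: "B \<subseteq> A" "B \<in> sets borel"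
  shows "set_borel_measurable borel B (\<lambda>s. a (t - s) * g s)"
proof -
  have [measurable]: "(\<lambda>s. indicator A s *\<^sub>R g s) \<in> borel_measurable borel" "B \<in> sets borel"
    using g sub by (auto simp: set_borel_measurable_def)
  have "(\<lambda>s. indicator B s * a (t - s) * (indicator A s *\<^sub>R g s)) \<in> borel_measurable borel"
    by measurable
  also have "(\<lambda>s. indicator B s * a (t - s) * (indicator A s *\<^sub>R g s)) = (\<lambda>s. indicator B s *\<^sub>R (a (t - s) * g s))"
    using sub by (auto simp: fun_eq_iff indicator_def)
  finally show ?thesis by (simp add: set_borel_measurable_def)
qed

lemma set_borel_measurable_subset':
  fixes g :: "real \<Rightarrow> real"
  assumes "set_borel_measurable borel A g" "B \<subseteq> A" "B \<in> sets borel"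
  shows "set_borel_measurable borel B g"
  using set_borel_measurable_mult_reflect[of "\<lambda>_. 1" A g B] assms by simp

lemma continuous_on_set_borel_measurable:
  fixes g :: "real \<Rightarrow> real"
  assumes "continuous_on {a..b} g"
  shows "set_borel_measurable borel {a..b} g"
  using assms by (intro set_measurable_continuous_on) auto

text \<open>The value \<open>\<infinity>\<close> of the convolution weight at \<open>u = 0\<close> for \<open>\<eta> < 1\<close> is replaced by \<open>1\<close>
  because \<open>0 powr x = 0\<close>; this affects a null set only.\<close>

definition weight :: "real \<Rightarrow> real \<Rightarrow> real" where
  "weight \<eta> u = 1 + (if u \<le> 1 then u powr (\<eta> - 1) else 0)"

lemma weight_measurable [measurable]: "weight \<eta> \<in> borel_measurable borel"
  unfolding weight_def[abs_def] by measurable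

lemma weight_ge_1: "1 \<le> weight \<eta> u"
  by (simp add: weight_def)

abbreviation weighted :: "real \<Rightarrow> (real \<Rightarrow> real) \<Rightarrow> real \<Rightarrow> real \<Rightarrow> real" where
  "weighted \<eta> g t s \<equiv> weight \<eta> (t - s) * \<bar>g s\<bar>"

text \<open>What a kernel that is dominated by \<open>weight \<eta>\<close> and vanishes at infinity
  needs from \<open>g\<close> for its convolution with \<open>g\<close> to be bounded and tend to 0.
  Both the L^1 and the L^p densities reach the kernels through this interface.\<close>

definition controlled :: "real \<Rightarrow> (real \<Rightarrow> real) \<Rightarrow> real \<Rightarrow> bool" where
  "controlled \<eta> g B \<longleftrightarrow>
    set_borel_measurable borel {0..} g \<and> set_integrable lborel {0..} g \<and>
    (\<forall>t\<ge>0. set_integrable lborel {0..t} (\<lambda>s. weighted \<eta> g t s) \<and>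
       (LBINT s:{0..t}. weighted \<eta> g t s) \<le> B) \<and>
    (\<forall>\<epsilon>>0. \<exists>M\<ge>0. \<forall>t\<ge>M. (LBINT s:{M..t}. weighted \<eta> g t s) \<le> \<epsilon>)"

text \<open>Allows the same weight to serve for all orders above \<eta>. The constant grows with t,
  so the estimate yields existence of convolutions on bounded intervals, not uniform bounds.\<close>

lemma rl_ker_le_weight:
  assumes "0 < \<eta>" "\<eta> \<le> a" "0 < u" "u \<le> t"
  shows "rl_ker a u \<le> (1 + t powr a) / Gamma a * weight \<eta> u"
proof -
  have G: "0 < Gamma a" using assms by (auto intro: Gamma_real_pos)
  have "u powr (a - 1) \<le> (1 + t powr a) * weight \<eta> u"
  proof (cases "u \<le> 1")
    case True
    then have "u powr (a - 1) \<le> u powr (\<eta> - 1)" using assms by (intro powr_mono') auto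
    also have "\<dots> \<le> 1 * weight \<eta> u" using True by (simp add: weight_def)
    also have "\<dots> \<le> (1 + t powr a) * weight \<eta> u"
      using weight_ge_1[of \<eta> u] by (intro mult_right_mono) auto
    finally show ?thesis .
  next
    case False
    then have "u powr (a - 1) \<le> u powr a" by (intro powr_mono) auto
    also have "\<dots> \<le> t powr a" using assms by (intro powr_mono2) auto
    also have "\<dots> \<le> (1 + t powr a) * 1" by simp
    also have "\<dots> \<le> (1 + t powr a) * weight \<eta> u"
      using weight_ge_1[of \<eta> u] by (intro mult_left_mono) (auto simp: add_nonneg_nonneg)
    finally show ?thesis .
  qed
  then show ?thesis using G by (simp add: rl_ker_def field_simps)
qed

lemma conv_exists_weight:
  assumes g: "set_borel_measurable borel {0..} g"
    and int: "set_integrable lborel {0..t} (\<lambda>s. weighted \<eta> g t s)"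
    and a: "a \<in> borel_measurable borel" "\<forall>u\<in>{0<..t}. \<bar>a u\<bar> \<le> K * weight \<eta> u"
  shows "conv_exists a g t"
    and "set_integrable lborel {0..t} (\<lambda>s. \<bar>a (t - s)\<bar> * \<bar>g s\<bar>)"
    and "AE s\<in>{0..t} in lborel. \<bar>a (t - s)\<bar> * \<bar>g s\<bar> \<le> K * weighted \<eta> g t s"
proof -
  show AE: "AE s\<in>{0..t} in lborel. \<bar>a (t - s)\<bar> * \<bar>g s\<bar> \<le> K * weighted \<eta> g t s"
    using AE_lborel_singleton[of t]
  proof eventually_elim
    case (elim s)
    show ?case
    proof
      assume "s \<in> {0..t}"
      then have "\<bar>a (t - s)\<bar> \<le> K * weight \<eta> (t - s)" using a(2) elim by auto
      then have "\<bar>a (t - s)\<bar> * \<bar>g s\<bar> \<le> (K * weight \<eta> (t - s)) * \<bar>g s\<bar>" by (rule mult_right_mono) auto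
      then show "\<bar>a (t - s)\<bar> * \<bar>g s\<bar> \<le> K * weighted \<eta> g t s" by (simp add: mult.assoc)
    qed
  qed
  have "set_integrable lborel {0..t} (\<lambda>s. K * weighted \<eta> g t s)" using int by simp
  then show ci: "conv_exists a g t"
    unfolding conv_exists_def
  proof (rule set_integrable_bound)
    show "set_borel_measurable lborel {0..t} (\<lambda>s. a (t - s) * g s)"
      using set_borel_measurable_mult_reflect[OF a(1) g, of "{0..t}" t] by (simp add: set_borel_measurable_def)
    show "AE s in lborel. s \<in> {0..t} \<longrightarrow> norm (a (t - s) * g s) \<le> norm (K * weighted \<eta> g t s)"
      using AE
    proof eventually_elim
      case (elim s)
      have "K * weighted \<eta> g t s \<le> norm (K * weighted \<eta> g t s)" by simp
      with elim show ?case by (auto simp only: abs_mult real_norm_def intro: order_trans)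
    qed
  qed
  show "set_integrable lborel {0..t} (\<lambda>s. \<bar>a (t - s)\<bar> * \<bar>g s\<bar>)"
    using set_integrable_abs[OF ci[unfolded conv_exists_def]] by (simp add: abs_mult)
qed

lemma conv_weight_bound:
  assumes "set_borel_measurable borel {0..} g"
    and "set_integrable lborel {0..t} (\<lambda>s. weighted \<eta> g t s)"
    and "a \<in> borel_measurable borel" "\<forall>u\<in>{0<..t}. \<bar>a u\<bar> \<le> K * weight \<eta> u"
  shows "0 \<le> M \<Longrightarrow> M \<le> t \<Longrightarrow>
    (LBINT s:{M..t}. \<bar>a (t - s)\<bar> * \<bar>g s\<bar>) \<le> K * (LBINT s:{M..t}. weighted \<eta> g t s)"
    (is "_ \<Longrightarrow> _ \<Longrightarrow> ?A")
    and "0 \<le> t \<Longrightarrow> \<bar>conv a g t\<bar> \<le> K * (LBINT s:{0..t}. weighted \<eta> g t s)"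
proof -
  note * = conv_exists_weight[OF assms]
  show A: "(LBINT s:{M..t}. \<bar>a (t - s)\<bar> * \<bar>g s\<bar>) \<le> K * (LBINT s:{M..t}. weighted \<eta> g t s)"
    if "0 \<le> M" "M \<le> t" for M
  proof -
    have "(LBINT s:{M..t}. \<bar>a (t - s)\<bar> * \<bar>g s\<bar>) \<le> (LBINT s:{M..t}. K * weighted \<eta> g t s)"
    proof (rule set_integral_mono_AE)
      show "set_integrable lborel {M..t} (\<lambda>s. \<bar>a (t - s)\<bar> * \<bar>g s\<bar>)"
        by (rule set_integrable_subset[OF *(2)]) (use that in auto)
      show "set_integrable lborel {M..t} (\<lambda>s. K * weighted \<eta> g t s)"
        by (rule set_integrable_mult_right, rule set_integrable_subset[OF assms(2)]) (use that in auto)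
      show "AE s\<in>{M..t} in lborel. \<bar>a (t - s)\<bar> * \<bar>g s\<bar> \<le> K * weighted \<eta> g t s"
        using *(3) by eventually_elim (use that in auto)
    qed
    then show ?thesis by simp
  qed
  show "\<bar>conv a g t\<bar> \<le> K * (LBINT s:{0..t}. weighted \<eta> g t s)" if "0 \<le> t"
    using A[of 0] that abs_set_integral_le[of "{0..t}" "\<lambda>s. a (t - s) * g s"] by (simp add: conv_def abs_mult)
qed

lemma set_integral_mono_set:
  fixes f :: "real \<Rightarrow> real"
  assumes "set_integrable lborel B f" "A \<subseteq> B" "A \<in> sets borel" "\<And>s. 0 \<le> f s"
  shows "(LBINT s:A. f s) \<le> (LBINT s:B. f s)"
  unfolding set_lebesgue_integral_def
  using assms set_integrable_subset[of lborel B f A]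
  by (intro integral_mono) (auto simp: indicator_def set_integrable_def)

lemma set_integral_tail:
  fixes \<phi> :: "real \<Rightarrow> real"
  assumes int: "set_integrable lborel {0..} \<phi>" and eps: "0 < \<epsilon>"
  shows "\<forall>\<^sub>F n in sequentially. (LBINT s:{real n..}. \<phi> s) \<le> \<epsilon>"
proof -
  have "(\<lambda>n. LBINT s:{real n..}. \<phi> s) \<longlonglongrightarrow> (LBINT s:(\<Inter>n. {real n..}). \<phi> s)"
    using int by (intro set_integral_cont_down) (auto simp: decseq_def)
  moreover have "(\<Inter>n. {real n..}) = {}"
  proof -
    have "\<exists>n. \<not> real n \<le> x" for x :: real using reals_Archimedean2[of x] by (auto simp: not_le)
    then show ?thesis by auto
  qed
  ultimately have "(\<lambda>n. LBINT s:{real n..}. \<phi> s) \<longlonglongrightarrow> 0" by (simp add: set_lebesgue_integral_def)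
  then have "\<forall>\<^sub>F n in sequentially. (LBINT s:{real n..}. \<phi> s) < \<epsilon>"
    using eps by (rule order_tendstoD(2))
  then show ?thesis by eventually_elim simp
qed

text \<open>For \<eta> \<ge> 1 there is no singularity and the weight is at most 2, whence the
  constant.\<close>

lemma controlled_L1:
  assumes eta: "1 \<le> \<eta>" and g: "set_borel_measurable borel {0..} g" "set_integrable lborel {0..} g"
  shows "controlled \<eta> g (2 * (LBINT s:{0..}. \<bar>g s\<bar>))"
proof -
  have int: "set_integrable lborel {0..} (\<lambda>s. \<bar>g s\<bar>)" using g(2) by (rule set_integrable_abs)
  have w: "weight \<eta> u \<le> 2" if "0 \<le> u" for u
    using eta that powr_mono2[of "\<eta> - 1" u 1] by (simp add: weight_def)
  have wi: "set_integrable lborel {0..t} (\<lambda>s. weighted \<eta> g t s)" for t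
  proof (rule set_integrable_bound[where f="\<lambda>s. 2 * \<bar>g s\<bar>"])
    show "set_integrable lborel {0..t} (\<lambda>s. 2 * \<bar>g s\<bar>)"
      by (rule set_integrable_mult_right, rule set_integrable_subset[OF int]) auto
    have "set_borel_measurable borel {0..} (\<lambda>s. \<bar>g s\<bar>)"
      using int by (simp add: set_integrable_def set_borel_measurable_def)
    then show "set_borel_measurable lborel {0..t} (\<lambda>s. weighted \<eta> g t s)"
      using set_borel_measurable_mult_reflect[of "weight \<eta>" "{0..}" "\<lambda>s. \<bar>g s\<bar>" "{0..t}" t]
      by (simp add: set_borel_measurable_def)
    show "AE s in lborel. s \<in> {0..t} \<longrightarrow> norm (weighted \<eta> g t s) \<le> norm (2 * \<bar>g s\<bar>)"
      using w weight_ge_1[of \<eta>] by (auto simp: abs_mult intro!: mult_right_mono AE_I2 order_trans[OF abs_of_nonneg[THEN eq_refl]] intro: order_trans[OF zero_le_one])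
  qed
  have bd: "(LBINT s:{M..t}. weighted \<eta> g t s) \<le> 2 * (LBINT s:{M..}. \<bar>g s\<bar>)" if "0 \<le> M" for M t
  proof -
    have "(LBINT s:{M..t}. weighted \<eta> g t s) \<le> (LBINT s:{M..t}. 2 * \<bar>g s\<bar>)"
    proof (rule set_integral_mono)
      show "set_integrable lborel {M..t} (\<lambda>s. weighted \<eta> g t s)"
        by (rule set_integrable_subset[OF wi[of t]]) (use that in auto)
      show "set_integrable lborel {M..t} (\<lambda>s. 2 * \<bar>g s\<bar>)"
        by (rule set_integrable_mult_right, rule set_integrable_subset[OF int]) (use that in auto)
    qed (use w in \<open>auto intro!: mult_right_mono\<close>)
    also have "\<dots> = 2 * (LBINT s:{M..t}. \<bar>g s\<bar>)" by simp
    also have "(LBINT s:{M..t}. \<bar>g s\<bar>) \<le> (LBINT s:{M..}. \<bar>g s\<bar>)"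
      using set_integrable_subset[OF int, of "{M..}"] that by (intro set_integral_mono_set) auto
    finally show ?thesis by simp
  qed
  have "\<exists>M\<ge>0. \<forall>t\<ge>M. (LBINT s:{M..t}. weighted \<eta> g t s) \<le> \<epsilon>" if "0 < \<epsilon>" for \<epsilon>
  proof -
    obtain n where "(LBINT s:{real n..}. \<bar>g s\<bar>) \<le> \<epsilon> / 2"
      using eventually_happens'[OF _ set_integral_tail[OF int, of "\<epsilon> / 2"]] \<open>0 < \<epsilon>\<close> by auto
    then have "(LBINT s:{real n..t}. weighted \<eta> g t s) \<le> \<epsilon>" for t
      using bd[of "real n" t] by simp
    then show ?thesis by (intro exI[of _ "real n"]) auto
  qed
  then show ?thesis
    using g wi bd[of 0] by (simp add: controlled_def)
qed

text \<open>The exponent \<open>a - 1\<close> is \<open>(\<eta> - 1) q\<close> for the exponent \<open>q\<close> conjugate to \<open>p\<close>.\<close>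

definition Lp_const :: "real \<Rightarrow> real \<Rightarrow> real" where
  "Lp_const p \<eta> = (let a = (\<eta> - 1) * (p / (p - 1)) + 1 in 2 + Gamma a * rl_ker (a + 1) 1)"

text \<open>With q conjugate to p, the condition 1 < p \<eta> says precisely that u^((\<eta> - 1) q)
  is integrable at 0.\<close>

lemma Lp_const_pos:
  assumes p: "1 < p" "1 < p * \<eta>"
  shows "0 < (\<eta> - 1) * (p / (p - 1)) + 1" and "0 < Lp_const p \<eta>"
proof -
  have "0 < ((\<eta> - 1) * p + (p - 1)) / (p - 1)"
    using p by (intro divide_pos_pos) (auto simp: algebra_simps)
  also have "\<dots> = (\<eta> - 1) * (p / (p - 1)) + 1" using p by (simp add: add_divide_distrib)
  finally show a: "0 < (\<eta> - 1) * (p / (p - 1)) + 1" .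
  have "0 < 2 + Gamma b * rl_ker (b + 1) 1" if "0 < b" for b
    using that rl_ker_nonneg[of "b + 1" 1] Gamma_real_nonneg[of b] by (simp add: add_pos_nonneg)
  from this[OF a] show "0 < Lp_const p \<eta>" by (simp add: Lp_const_def Let_def)
qed

text \<open>Young's inequality with balancing factors \<delta>^(1/q) and \<delta>^(-1/q) takes the
  place of Hoelder's: the singular part contributes a multiple of \<delta>, and the L^p part
  \<delta>^(1 - p) \<delta>^p = \<delta>. The bound is linear in \<delta>, and the free lower end
  \<open>M\<close> makes it usable for tails as well.\<close>

lemma weight_Lp_bound:
  assumes p: "1 < p" "1 < p * \<eta>"
    and g: "set_borel_measurable borel {0..} g" "set_integrable lborel {0..} g"
      "set_integrable lborel {0..} (\<lambda>s. \<bar>g s\<bar> powr p)"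
    and M: "0 \<le> M" and \<delta>: "0 < \<delta>"
    and le: "(LBINT s:{M..}. \<bar>g s\<bar>) \<le> \<delta>" "(LBINT s:{M..}. \<bar>g s\<bar> powr p) \<le> \<delta> powr p"
  shows "set_integrable lborel {M..t} (\<lambda>s. weighted \<eta> g t s)"
    and "(LBINT s:{M..t}. weighted \<eta> g t s) \<le> Lp_const p \<eta> * \<delta>"
proof -
  define q where "q = p / (p - 1)"
  have q: "1 < q" "1 / q + 1 / p = 1" using p by (auto simp: q_def field_simps)
  define a where "a = (\<eta> - 1) * q + 1"
  have a: "0 < a" unfolding a_def q_def by (rule Lp_const_pos(1)[OF p])
  then have Ga: "0 < Gamma a" by (auto intro: Gamma_real_pos)
  \<comment> \<open>This is the integral of u^(a - 1) over [0, 1]; the 2 in \<open>Lp_const\<close>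
    accounts for the L^1 and the L^p terms, each worth \<delta>.\<close>
  define D where "D = Gamma a * rl_ker (a + 1) 1"
  have const: "Lp_const p \<eta> = 2 + D" by (simp add: Lp_const_def D_def a_def q_def Let_def)
  define B where "B s = \<bar>g s\<bar> + \<delta> * Gamma a * (indicator {0..1} (t - s) * rl_ker a (t - s)) + \<delta> powr (1 - p) * \<bar>g s\<bar> powr p" for s
  have young: "weighted \<eta> g t s \<le> B s" if "s \<le> t" for s
  proof (cases "t - s \<le> 1")
    case True
    define u where "u = t - s"
    have "u powr (\<eta> - 1) * \<bar>g s\<bar> = (\<delta> powr (1 / q) * u powr (\<eta> - 1)) * (\<delta> powr (- (1 / q)) * \<bar>g s\<bar>)"
      using \<delta> by (simp add: powr_minus field_simps)
    also have "\<dots> \<le> (\<delta> powr (1 / q) * u powr (\<eta> - 1)) powr q / q + (\<delta> powr (- (1 / q)) * \<bar>g s\<bar>) powr p / p"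
      by (rule Youngs_inequality) (use p q in auto)
    also have "\<dots> \<le> (\<delta> powr (1 / q) * u powr (\<eta> - 1)) powr q + (\<delta> powr (- (1 / q)) * \<bar>g s\<bar>) powr p"
    proof -
      have "x / y \<le> x" if "0 \<le> x" "1 < y" for x y :: real
        using that mult_left_mono[of 1 y x] by (simp add: field_simps)
      then show ?thesis using p q by (intro add_mono) auto
    qed
    also have "(\<delta> powr (1 / q) * u powr (\<eta> - 1)) powr q = \<delta> * u powr (a - 1)"
      using \<delta> q by (simp add: powr_mult powr_powr a_def)
    also have "(\<delta> powr (- (1 / q)) * \<bar>g s\<bar>) powr p = \<delta> powr (1 - p) * \<bar>g s\<bar> powr p"
    proof -
      have "- (1 / q) * p = 1 - p" using p by (simp add: q_def field_simps)
      then show ?thesis by (simp add: powr_mult powr_powr)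
    qed
    finally have "u powr (\<eta> - 1) * \<bar>g s\<bar> \<le> \<delta> * u powr (a - 1) + \<delta> powr (1 - p) * \<bar>g s\<bar> powr p" .
    moreover have "Gamma a * rl_ker a u = u powr (a - 1)" using Ga by (simp add: rl_ker_def)
    moreover have "u \<in> {0..1}" using True that by (auto simp: u_def)
    ultimately show ?thesis
      unfolding B_def u_def[symmetric] weight_def by (simp add: algebra_simps)
  next
    case False
    then show ?thesis by (simp add: B_def weight_def)
  qed
  have rl: "set_integrable lborel {M..t} (\<lambda>s. indicator {0..1} (t - s) * rl_ker a (t - s))"
    and rl_le: "(LBINT s:{M..t}. indicator {0..1} (t - s) * rl_ker a (t - s)) \<le> rl_ker (a + 1) 1"
  proof -
    have i: "integrable lborel (\<lambda>u. indicator {0..1} u *\<^sub>R rl_ker a u)"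
      using set_integrable_rl_ker[OF a, of 1] by (simp add: set_integrable_def)
    have i2: "integrable lborel (\<lambda>s. indicator {M..t} s *\<^sub>R (indicator {0..1} (t - s) *\<^sub>R rl_ker a (t - s)))"
      using lborel_integrable_real_affine[OF i, of "-1" t] by (intro integrable_mult_indicator) auto
    then show "set_integrable lborel {M..t} (\<lambda>s. indicator {0..1} (t - s) * rl_ker a (t - s))"
      by (simp add: set_integrable_def)
    have "(LBINT s:{M..t}. indicator {0..1} (t - s) * rl_ker a (t - s)) \<le>
        (\<integral>s. indicator {0..1} (t - s) *\<^sub>R rl_ker a (t - s) \<partial>lborel)"
      unfolding set_lebesgue_integral_def
      using i2 lborel_integrable_real_affine[OF i, of "-1" t] rl_ker_nonneg[OF a]
      by (intro integral_mono) (auto simp: indicator_def)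
    also have "\<dots> = (LBINT u:{0..1}. rl_ker a u)"
      unfolding set_lebesgue_integral_def
      using lborel_integral_real_affine[of "-1" "\<lambda>u. indicator {0..1} u *\<^sub>R rl_ker a u" t] by simp
    also have "\<dots> = rl_ker (a + 1) 1" using set_integral_rl_ker[OF a, of 1] by simp
    finally show "(LBINT s:{M..t}. indicator {0..1} (t - s) * rl_ker a (t - s)) \<le> rl_ker (a + 1) 1" .
  qed
  have gi: "set_integrable lborel {M..} (\<lambda>s. \<bar>g s\<bar>)" "set_integrable lborel {M..} (\<lambda>s. \<bar>g s\<bar> powr p)"
    using set_integrable_subset[OF set_integrable_abs[OF g(2)], of "{M..}"] set_integrable_subset[OF g(3), of "{M..}"] M
    by auto
  then have gi': "set_integrable lborel {M..t} (\<lambda>s. \<bar>g s\<bar>)" "set_integrable lborel {M..t} (\<lambda>s. \<bar>g s\<bar> powr p)"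
    by (auto intro: set_integrable_subset)
  have Bi: "set_integrable lborel {M..t} B"
    unfolding B_def using rl gi' by (intro set_integral_add set_integrable_mult_right)
  show wi: "set_integrable lborel {M..t} (\<lambda>s. weighted \<eta> g t s)"
  proof (rule set_integrable_bound[OF Bi])
    have "set_borel_measurable borel {M..} (\<lambda>s. \<bar>g s\<bar>)"
      using gi(1) by (simp add: set_integrable_def set_borel_measurable_def)
    then show "set_borel_measurable lborel {M..t} (\<lambda>s. weighted \<eta> g t s)"
      using set_borel_measurable_mult_reflect[of "weight \<eta>" "{M..}" "\<lambda>s. \<bar>g s\<bar>" "{M..t}" t]
      by (simp add: set_borel_measurable_def)
    have "0 \<le> weight \<eta> u" for u using weight_ge_1[of \<eta> u] by simp
    then show "AE s in lborel. s \<in> {M..t} \<longrightarrow> norm (weighted \<eta> g t s) \<le> norm (B s)"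
      using young by (auto simp: abs_mult intro!: AE_I2 intro: order_trans[OF _ abs_ge_self])
  qed
  have "(LBINT s:{M..t}. weighted \<eta> g t s) \<le> (LBINT s:{M..t}. B s)"
    using young by (intro set_integral_mono wi Bi) auto
  also have "\<dots> = (LBINT s:{M..t}. \<bar>g s\<bar>) + \<delta> * Gamma a * (LBINT s:{M..t}. indicator {0..1} (t - s) * rl_ker a (t - s))
      + \<delta> powr (1 - p) * (LBINT s:{M..t}. \<bar>g s\<bar> powr p)"
    unfolding B_def using rl gi' 
    by (subst set_integral_add, intro set_integral_add set_integrable_mult_right, auto simp del: set_integral_mult_right)+ simp
  also have "\<dots> \<le> \<delta> + \<delta> * Gamma a * rl_ker (a + 1) 1 + \<delta> powr (1 - p) * \<delta> powr p"
    using set_integral_mono_set[OF gi(1), of "{M..t}"] set_integral_mono_set[OF gi(2), of "{M..t}"] le rl_le \<delta> Ga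
    by (intro add_mono mult_left_mono) auto
  also have "\<dots> = (2 + D) * \<delta>"
    using \<delta> by (simp add: D_def algebra_simps flip: powr_add)
  finally show "(LBINT s:{M..t}. weighted \<eta> g t s) \<le> Lp_const p \<eta> * \<delta>"
    unfolding const .
qed

lemma controlled_Lp:
  assumes p: "1 < p" "1 < p * \<eta>"
    and g: "set_borel_measurable borel {0..} g" "set_integrable lborel {0..} g"
      "set_integrable lborel {0..} (\<lambda>s. \<bar>g s\<bar> powr p)"
    and \<delta>: "0 < \<delta>" "(LBINT s:{0..}. \<bar>g s\<bar>) \<le> \<delta>" "(LBINT s:{0..}. \<bar>g s\<bar> powr p) \<le> \<delta> powr p"
  shows "controlled \<eta> g (Lp_const p \<eta> * \<delta>)"
proof -
  note bound = weight_Lp_bound[OF p g]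
  have K: "0 < Lp_const p \<eta>" by (rule Lp_const_pos(2)[OF p])
  have "\<exists>M\<ge>0. \<forall>t\<ge>M. (LBINT s:{M..t}. weighted \<eta> g t s) \<le> \<epsilon>" if "0 < \<epsilon>" for \<epsilon>
  proof -
    \<comment> \<open>By linearity, the tail estimate is the same bound with \<open>d\<close> for
      \<delta>, once both tails of \<open>g\<close> are small enough for \<open>d\<close>.\<close>
    define d where "d = \<epsilon> / Lp_const p \<eta>"
    have d: "0 < d" using that K by (simp add: d_def)
    have "\<forall>\<^sub>F n in sequentially. (LBINT s:{real n..}. \<bar>g s\<bar>) \<le> d"
      "\<forall>\<^sub>F n in sequentially. (LBINT s:{real n..}. \<bar>g s\<bar> powr p) \<le> d powr p"
      using set_integral_tail[OF set_integrable_abs[OF g(2)], of d] set_integral_tail[OF g(3), of "d powr p"] d by auto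
    then have "\<forall>\<^sub>F n in sequentially. (LBINT s:{real n..}. \<bar>g s\<bar>) \<le> d \<and> (LBINT s:{real n..}. \<bar>g s\<bar> powr p) \<le> d powr p"
      by eventually_elim simp
    then obtain n where n: "(LBINT s:{real n..}. \<bar>g s\<bar>) \<le> d" "(LBINT s:{real n..}. \<bar>g s\<bar> powr p) \<le> d powr p"
      by (auto simp: eventually_sequentially)
    have "(LBINT s:{real n..t}. weighted \<eta> g t s) \<le> \<epsilon>" for t
      using bound(2)[OF _ d n, of t] K by (simp add: d_def)
    then show ?thesis by (intro exI[of _ "real n"]) auto
  qed
  then show ?thesis
    using bound(1,2)[OF order_refl \<delta>] g by (auto simp: controlled_def)
qed

context fractional_resolvent
begin

subsection \<open>Variation of constants\<close>

text \<open>The resolvent of \<open>\<mu>\<close> times the kernel of order \<open>\<beta>\<close> is \<^term>\<open>\<lambda>t. \<mu> * ker \<beta> t\<close>.\<close>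

definition perturb :: "(real \<Rightarrow> real) \<Rightarrow> real \<Rightarrow> real" where
  "perturb u t = u t - \<mu> * conv (ker \<beta>) u t"

text \<open>Existence of the convolution is included because \<open>perturb\<close> is additive only
  under it; the pieces of the data are treated separately and then summed.\<close>

definition tame :: "real \<Rightarrow> (real \<Rightarrow> real) \<Rightarrow> bool" where
  "tame B u \<longleftrightarrow> (\<forall>t\<ge>0. conv_exists (ker \<beta>) u t \<and> \<bar>perturb u t\<bar> \<le> B) \<and> (perturb u \<longlongrightarrow> 0) at_top"

lemma perturb_add:
  assumes "conv_exists (ker \<beta>) u t" "conv_exists (ker \<beta>) v t"
  shows "perturb (\<lambda>s. u s + v s) t = perturb u t + perturb v t"
  unfolding perturb_def conv_add(2)[OF assms] by (simp add: algebra_simps)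

lemma perturb_diff:
  assumes "conv_exists (ker \<beta>) u t" "conv_exists (ker \<beta>) v t"
  shows "perturb (\<lambda>s. u s - v s) t = perturb u t - perturb v t"
  unfolding perturb_def conv_diff(2)[OF assms] by (simp add: algebra_simps)

lemma perturb_cong:
  assumes "0 \<le> t" "\<And>s. 0 \<le> s \<Longrightarrow> s \<le> t \<Longrightarrow> u s = v s"
  shows "perturb u t = perturb v t"
  using conv_cong[of t u v "ker \<beta>"] assms by (simp add: perturb_def)

lemma conv_exists_ker_bounded:
  assumes "set_borel_measurable borel {0..t} g" "\<And>s. 0 \<le> s \<Longrightarrow> s \<le> t \<Longrightarrow> \<bar>g s\<bar> \<le> B" "0 < \<eta>"
  shows "conv_exists (ker \<eta>) g t"
  using conv_exists_bounded[OF set_integrable_ker[OF assms(3)] assms(1,2)] by blast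

text \<open>Associativity moves the resolvent onto the kernel, where \<open>ker_rec\<close>
  collapses the combination.\<close>

lemma perturb_conv:
  assumes "0 < \<eta>" "0 \<le> t" and g: "set_borel_measurable borel {0..t} g"
    and int: "conv_exists (ker (\<beta> + \<eta>)) g t" "conv_exists (rl_ker \<eta>) g t"
  shows "conv_exists (ker \<beta>) (conv (rl_ker \<eta>) g) t"
    and "perturb (conv (rl_ker \<eta>) g) t = conv (ker \<eta>) g t"
proof -
  note assoc = conv_assoc[of "ker \<beta>" "rl_ker \<eta>" t g "ker (\<beta> + \<eta>)", OF ker_measurable _ rl_ker_measurable _ g _ _ int(1)]
  have nn: "0 \<le> ker \<beta> s" if "0 < s" for s using ker_beta_pos[OF that] by simp
  show "conv_exists (ker \<beta>) (conv (rl_ker \<eta>) g) t"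
    by (rule assoc(1)) (use nn assms beta in \<open>auto simp: rl_ker_nonneg conv_ker_rl_ker\<close>)
  have "conv (ker \<beta>) (conv (rl_ker \<eta>) g) t = conv (ker (\<beta> + \<eta>)) g t"
    by (rule assoc(2)) (use nn assms beta in \<open>auto simp: rl_ker_nonneg conv_ker_rl_ker\<close>)
  then have "perturb (conv (rl_ker \<eta>) g) t = conv (rl_ker \<eta>) g t - conv (\<lambda>u. \<mu> * ker (\<beta> + \<eta>) u) g t"
    by (simp add: perturb_def conv_cmult_left)
  also have "\<dots> = conv (\<lambda>u. rl_ker \<eta> u - \<mu> * ker (\<beta> + \<eta>) u) g t"
    by (rule conv_diff_left[symmetric]) (use int in \<open>auto simp: conv_exists_def mult.assoc\<close>)
  also have "\<dots> = conv (ker \<eta>) g t"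
    by (rule conv_cong_left) (use ker_rec[OF assms(1)] in \<open>auto simp: add.commute\<close>)
  finally show "perturb (conv (rl_ker \<eta>) g) t = conv (ker \<eta>) g t" .
qed

text \<open>With G = - \<mu> X + H, apply \<open>perturb\<close> to u = X - k * G. By
  \<open>perturb_conv\<close> the last term becomes \<open>conv (ker \<beta>) G\<close>, and its X
  part cancels the resolvent term of \<open>perturb X\<close>.\<close>

lemma variation_of_constants:
  assumes T: "0 \<le> T"
    and X: "set_borel_measurable borel {0..T} X" "\<And>s. 0 \<le> s \<Longrightarrow> s \<le> T \<Longrightarrow> \<bar>X s\<bar> \<le> B"
    and H: "set_borel_measurable borel {0..T} H" "\<And>s. 0 \<le> s \<Longrightarrow> s \<le> T \<Longrightarrow> \<bar>H s\<bar> \<le> B'"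
    and eq: "\<And>s. 0 \<le> s \<Longrightarrow> s \<le> T \<Longrightarrow> X s = u s + conv (rl_ker \<beta>) (\<lambda>r. - \<mu> * X r + H r) s"
  shows "X T = perturb u T + conv (ker \<beta>) H T"
proof -
  define G where "G r = - \<mu> * X r + H r" for r
  have Gm: "set_borel_measurable borel {0..T} G"
  proof -
    have "(\<lambda>s. - \<mu> * (indicator {0..T} s *\<^sub>R X s) + indicator {0..T} s *\<^sub>R H s) \<in> borel_measurable borel"
      using X(1) H(1) unfolding set_borel_measurable_def by measurable
    also have "(\<lambda>s. - \<mu> * (indicator {0..T} s *\<^sub>R X s) + indicator {0..T} s *\<^sub>R H s) = (\<lambda>s. indicator {0..T} s *\<^sub>R G s)"
      by (auto simp: G_def indicator_def fun_eq_iff)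
    finally show ?thesis by (simp add: set_borel_measurable_def)
  qed
  have Gb: "\<bar>G s\<bar> \<le> \<mu> * B + B'" if "0 \<le> s" "s \<le> T" for s
  proof -
    have "\<bar>G s\<bar> \<le> \<bar>- \<mu> * X s\<bar> + \<bar>H s\<bar>" unfolding G_def by (rule abs_triangle_ineq)
    also have "\<dots> \<le> \<mu> * B + B'"
      using X(2)[OF that] H(2)[OF that] lam by (auto simp: abs_mult intro!: add_mono mult_left_mono)
    finally show ?thesis .
  qed
  note Gi = conv_exists_ker_bounded[OF Gm Gb]
  have Xi: "conv_exists (ker \<beta>) X T" by (rule conv_exists_ker_bounded[OF X beta(1)])
  have Hi: "conv_exists (ker \<beta>) H T" by (rule conv_exists_ker_bounded[OF H beta(1)])
  have rG: "conv_exists (rl_ker \<beta>) G T"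
    using conv_exists_bounded[OF set_integrable_rl_ker[OF beta(1)] Gm Gb] by blast
  have kG: "conv_exists (ker (\<beta> + \<beta>)) G T" using Gi[of "\<beta> + \<beta>"] beta by simp
  note pc = perturb_conv[OF beta(1) T Gm kG rG]
  have "perturb u T = perturb (\<lambda>s. X s - conv (rl_ker \<beta>) G s) T"
    by (rule perturb_cong[OF T]) (simp add: eq G_def[abs_def])
  also have "\<dots> = perturb X T - perturb (conv (rl_ker \<beta>) G) T"
    by (rule perturb_diff[OF Xi pc(1)])
  also have "perturb (conv (rl_ker \<beta>) G) T = conv (ker \<beta>) G T" by (rule pc(2))
  also have "conv (ker \<beta>) G T = - \<mu> * conv (ker \<beta>) X T + conv (ker \<beta>) H T"
    unfolding G_def by (simp only: conv_add(2)[OF conv_exists_cmult[OF Xi, of "- \<mu>"] Hi] conv_cmult)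
  finally show ?thesis by (simp add: perturb_def)
qed

text \<open>After \<open>perturb_conv\<close> only \<open>conv (ker \<eta>) g\<close> remains. For
  its limit, split at a fixed \<open>M\<close>: on [M, t] the weighted tail is small, and on [0, M]
  the kernel is evaluated at arguments of at least t - M, where it is small, against the finite L^1
  norm of \<open>g\<close>.\<close>

lemma perturb_controlled:
  assumes eta: "0 < \<eta>" "\<eta> < 1 + \<beta>"
  shows "\<exists>K>0. \<forall>g B. controlled \<eta> g B \<longrightarrow>
    tame (K * B) (conv (rl_ker \<eta>) g)"
proof -
  obtain K where K: "0 < K" "\<And>u. 0 < u \<Longrightarrow> \<bar>ker \<eta> u\<bar> \<le> K * weight \<eta> u"
    using ker_bound[OF eta] by (auto simp: weight_def)
  show ?thesis
    unfolding tame_def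
  proof (intro exI[of _ K] conjI allI impI)
    show "0 < K" by fact
    fix g B assume c: "controlled \<eta> g B"
    have gm: "set_borel_measurable borel {0..} g" and gi: "set_integrable lborel {0..} g"
      using c by (auto simp: controlled_def)
    have wi: "set_integrable lborel {0..t} (\<lambda>s. weighted \<eta> g t s)"
      and wb: "(LBINT s:{0..t}. weighted \<eta> g t s) \<le> B" if "0 \<le> t" for t
      using c that by (auto simp: controlled_def)
    have tail: "\<exists>M\<ge>0. \<forall>t\<ge>M. (LBINT s:{M..t}. weighted \<eta> g t s) \<le> \<epsilon>" if "0 < \<epsilon>" for \<epsilon>
      using c that by (auto simp: controlled_def)
    have kb: "\<forall>u\<in>{0<..t}. \<bar>ker \<eta> u\<bar> \<le> K * weight \<eta> u" for t using K by auto
    have rlw: "\<forall>u\<in>{0<..t}. \<bar>rl_ker a u\<bar> \<le> (1 + t powr a) / Gamma a * weight \<eta> u" if "\<eta> \<le> a" for a t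
      using that eta rl_ker_le_weight[of \<eta> a] rl_ker_nonneg[of a] by auto
    have rli: "conv_exists (rl_ker a) g t" if "\<eta> \<le> a" "0 \<le> t" for a t
      by (rule conv_exists_weight(1)[OF gm wi rl_ker_measurable rlw]) (use that in auto)
    have keri: "conv_exists (ker (\<beta> + \<eta>)) g t" if "0 \<le> t" for t
    proof (rule conv_exists_weight(1)[OF gm wi ker_measurable])
      \<comment> \<open>The order \<beta> + \<eta> may be 1 + \<beta> or larger, beyond the reach of
        \<open>ker_bound\<close>; comparison with the Riemann-Liouville kernel on a bounded interval
        suffices for existence.\<close>
      show "\<forall>u\<in>{0<..t}. \<bar>ker (\<beta> + \<eta>) u\<bar> \<le> (1 + t powr (\<beta> + \<eta>)) / Gamma (\<beta> + \<eta>) * weight \<eta> u"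
      proof
        fix u assume u: "u \<in> {0<..t}"
        have "\<bar>ker (\<beta> + \<eta>) u\<bar> \<le> \<bar>rl_ker (\<beta> + \<eta>) u\<bar>"
          using ker_nonneg[of "\<beta> + \<eta>" u] ker_le_rl_ker[of "\<beta> + \<eta>" u] u eta beta by auto
        also have "\<dots> \<le> (1 + t powr (\<beta> + \<eta>)) / Gamma (\<beta> + \<eta>) * weight \<eta> u"
          using rlw[of "\<beta> + \<eta>" t] beta u by auto
        finally show "\<bar>ker (\<beta> + \<eta>) u\<bar> \<le> (1 + t powr (\<beta> + \<eta>)) / Gamma (\<beta> + \<eta>) * weight \<eta> u" .
      qed
    qed (use that in auto)
    have gmt: "set_borel_measurable borel {0..t} g" for t
      by (rule set_borel_measurable_subset'[OF gm]) auto
    note pc = perturb_conv[OF eta(1) _ gmt keri rli[OF order_refl]]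
    fix t :: real
    {
      assume t: "0 \<le> t"
      show "conv_exists (ker \<beta>) (conv (rl_ker \<eta>) g) t" using pc(1) t by auto
      have "\<bar>conv (ker \<eta>) g t\<bar> \<le> K * (LBINT s:{0..t}. weighted \<eta> g t s)"
        by (rule conv_weight_bound(2)[OF gm wi[OF t] ker_measurable kb t])
      also have "\<dots> \<le> K * B" using wb[OF t] K by simp
      finally show "\<bar>perturb (conv (rl_ker \<eta>) g) t\<bar> \<le> K * B" using pc(2) t by auto
    }
    have "(conv (ker \<eta>) g \<longlongrightarrow> 0) at_top"
    proof (rule tendstoI)
      fix e :: real assume e: "0 < e"
      define I where "I = (LBINT s:{0..}. \<bar>g s\<bar>)"
      have I: "0 \<le> I" unfolding I_def set_lebesgue_integral_def by (intro Bochner_Integration.integral_nonneg) auto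
      obtain M where M: "0 \<le> M" "\<And>t. M \<le> t \<Longrightarrow> (LBINT s:{M..t}. weighted \<eta> g t s) \<le> e / (4 * K)"
        using tail[of "e / (4 * K)"] e K by auto
      have "\<forall>\<^sub>F u in at_top. \<bar>ker \<eta> u\<bar> < e / (4 * (I + 1))"
        using tendsto_rabs_zero[OF ker_tendsto_0[OF eta]] by (rule order_tendstoD(2)) (use e I in auto)
      then obtain N where N: "\<And>u. N \<le> u \<Longrightarrow> \<bar>ker \<eta> u\<bar> < e / (4 * (I + 1))"
        by (auto simp: eventually_at_top_linorder)
      have "dist (conv (ker \<eta>) g t) 0 < e" if t: "t \<ge> M + \<bar>N\<bar>" for t
      proof -
        have t0: "0 \<le> t" "M \<le> t" using t M by auto
        note ki = conv_exists_weight(2)[OF gm wi[OF t0(1)] ker_measurable kb]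
        have "\<bar>conv (ker \<eta>) g t\<bar> \<le> (LBINT s:{0..t}. \<bar>ker \<eta> (t - s)\<bar> * \<bar>g s\<bar>)"
          using abs_set_integral_le[of "{0..t}" "\<lambda>s. ker \<eta> (t - s) * g s"] by (simp add: conv_def abs_mult)
        also have "\<dots> = (LBINT s:{0..M}. \<bar>ker \<eta> (t - s)\<bar> * \<bar>g s\<bar>) + (LBINT s:{M..t}. \<bar>ker \<eta> (t - s)\<bar> * \<bar>g s\<bar>)"
          by (rule set_integral_split[OF ki M(1) t0(2)])
        also have "(LBINT s:{M..t}. \<bar>ker \<eta> (t - s)\<bar> * \<bar>g s\<bar>) \<le> K * (LBINT s:{M..t}. weighted \<eta> g t s)"
          by (rule conv_weight_bound(1)[OF gm wi[OF t0(1)] ker_measurable kb M(1) t0(2)])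
        also have "\<dots> \<le> K * (e / (4 * K))" using M(2)[OF t0(2)] K by (intro mult_left_mono) auto
        also have "\<dots> = e / 4" using K by simp
        also have "(LBINT s:{0..M}. \<bar>ker \<eta> (t - s)\<bar> * \<bar>g s\<bar>) \<le> (LBINT s:{0..M}. e / (4 * (I + 1)) * \<bar>g s\<bar>)"
        proof (rule set_integral_mono)
          show "set_integrable lborel {0..M} (\<lambda>s. \<bar>ker \<eta> (t - s)\<bar> * \<bar>g s\<bar>)"
            by (rule set_integrable_subset[OF ki]) (use t0 in auto)
          show "set_integrable lborel {0..M} (\<lambda>s. e / (4 * (I + 1)) * \<bar>g s\<bar>)"
            by (rule set_integrable_mult_right, rule set_integrable_subset[OF set_integrable_abs[OF gi]]) auto
          show "\<bar>ker \<eta> (t - s)\<bar> * \<bar>g s\<bar> \<le> e / (4 * (I + 1)) * \<bar>g s\<bar>" if "s \<in> {0..M}" for s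
          proof (rule mult_right_mono)
            have "N \<le> t - s" using that t abs_ge_self[of N] by (simp del: abs_ge_self) 
            then show "\<bar>ker \<eta> (t - s)\<bar> \<le> e / (4 * (I + 1))" using N by (blast intro: less_imp_le)
          qed simp
        qed
        also have "\<dots> = e / (4 * (I + 1)) * (LBINT s:{0..M}. \<bar>g s\<bar>)" by simp
        also have "\<dots> \<le> e / (4 * (I + 1)) * I"
        proof (rule mult_left_mono)
          show "(LBINT s:{0..M}. \<bar>g s\<bar>) \<le> I"
            unfolding I_def by (rule set_integral_mono_set[OF set_integrable_abs[OF gi]]) auto
        qed (use e I in auto)
        also have "\<dots> \<le> e / 4" using e I by (simp add: field_simps)
        finally show ?thesis using e by simp
      qed
      then show "\<forall>\<^sub>F t in at_top. dist (conv (ker \<eta>) g t) 0 < e"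
        by (auto simp: eventually_at_top_linorder)
    qed
    moreover have "\<forall>\<^sub>F t in at_top. perturb (conv (rl_ker \<eta>) g) t = conv (ker \<eta>) g t"
      using eventually_ge_at_top[of 0] by eventually_elim (use pc(2) in auto)
    ultimately show "(perturb (conv (rl_ker \<eta>) g) \<longlongrightarrow> 0) at_top"
      using tendsto_cong by fast
  qed
qed

text \<open>R = \<mu> \<open>ker \<beta>\<close> is nonnegative with mass 1 - \<open>surv t\<close>
  on [0, t]. Seen from t, the stretch [0, M] therefore has weight
  \<open>surv (t - M) - surv t\<close>, and [M, t] has weight
  \<open>1 - surv (t - M)\<close>.\<close>

lemma resolvent_average_bound:
  assumes t: "0 \<le> M" "M \<le> t" and \<phi>: "set_borel_measurable borel {0..t} \<phi>"
    and B: "0 \<le> B" "\<And>s. 0 \<le> s \<Longrightarrow> s \<le> M \<Longrightarrow> \<bar>\<phi> s\<bar> \<le> B"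
    and m: "0 \<le> m" "\<And>s. M \<le> s \<Longrightarrow> s \<le> t \<Longrightarrow> \<bar>\<phi> s\<bar> \<le> m"
  shows "\<bar>\<mu> * conv (ker \<beta>) \<phi> t\<bar> \<le> B * (surv (t - M) - surv t) + m * (1 - surv (t - M))"
proof -
  have t0: "0 \<le> t" using t by simp
  have knn: "0 \<le> ker \<beta> (t - s)" if "s \<le> t" for s using ker_nonneg[of \<beta> "t - s"] that by simp
  have "\<bar>\<phi> s\<bar> \<le> max B m" if "0 \<le> s" "s \<le> t" for s
    using B(2)[of s] m(2)[of s] that by (cases "s \<le> M") auto
  then have ci: "conv_exists (ker \<beta>) \<phi> t"
    by (rule conv_exists_ker_bounded[OF \<phi>]) (use beta in auto)
  then have int: "set_integrable lborel {0..t} (\<lambda>s. ker \<beta> (t - s) * \<bar>\<phi> s\<bar>)"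
    using set_integrable_abs[OF ci[unfolded conv_exists_def]] knn
    by (subst set_integrable_cong[OF refl refl, where f'="\<lambda>s. \<bar>ker \<beta> (t - s) * \<phi> s\<bar>"]) (auto simp: abs_mult)
  have ki: "set_integrable lborel {0..t} (\<lambda>s. ker \<beta> (t - s))"
    using set_integral_reflect(2)[of 0 t "ker \<beta>"] set_integrable_ker[OF beta(1)] by simp
  have sub: "{0..M} \<subseteq> {0..t}" "{M..t} \<subseteq> {0..t}" using t by auto
  have I2: "(LBINT s:{M..t}. ker \<beta> (t - s)) = ker (\<beta> + 1) (t - M)"
    using set_integral_reflect(1)[of M t "ker \<beta>"] set_integral_ker(1)[OF beta(1), of "t - M"] t by simp
  have I1: "(LBINT s:{0..M}. ker \<beta> (t - s)) = ker (\<beta> + 1) t - ker (\<beta> + 1) (t - M)"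
    using set_integral_split[OF ki t] I2 set_integral_ker(2)[OF beta(1) t0] by simp
  have "\<bar>conv (ker \<beta>) \<phi> t\<bar> \<le> (LBINT s:{0..t}. \<bar>ker \<beta> (t - s) * \<phi> s\<bar>)"
    unfolding conv_def by (rule abs_set_integral_le)
  also have "\<dots> = (LBINT s:{0..t}. ker \<beta> (t - s) * \<bar>\<phi> s\<bar>)"
    by (rule set_lebesgue_integral_cong) (auto simp: abs_mult knn)
  also have "\<dots> = (LBINT s:{0..M}. ker \<beta> (t - s) * \<bar>\<phi> s\<bar>) + (LBINT s:{M..t}. ker \<beta> (t - s) * \<bar>\<phi> s\<bar>)"
    by (rule set_integral_split[OF int t])
  also have "(LBINT s:{0..M}. ker \<beta> (t - s) * \<bar>\<phi> s\<bar>) \<le> (LBINT s:{0..M}. B * ker \<beta> (t - s))"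
  proof (rule set_integral_mono)
    show "set_integrable lborel {0..M} (\<lambda>s. ker \<beta> (t - s) * \<bar>\<phi> s\<bar>)"
      by (rule set_integrable_subset[OF int]) (use sub in auto)
    show "set_integrable lborel {0..M} (\<lambda>s. B * ker \<beta> (t - s))"
      by (rule set_integrable_mult_right, rule set_integrable_subset[OF ki]) (use sub in auto)
    show "ker \<beta> (t - s) * \<bar>\<phi> s\<bar> \<le> B * ker \<beta> (t - s)" if "s \<in> {0..M}" for s
      using mult_left_mono[OF B(2) knn, of s s] that t by (simp add: mult.commute)
  qed
  also have "(LBINT s:{M..t}. ker \<beta> (t - s) * \<bar>\<phi> s\<bar>) \<le> (LBINT s:{M..t}. m * ker \<beta> (t - s))"
  proof (rule set_integral_mono)
    show "set_integrable lborel {M..t} (\<lambda>s. ker \<beta> (t - s) * \<bar>\<phi> s\<bar>)"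
      by (rule set_integrable_subset[OF int]) (use sub in auto)
    show "set_integrable lborel {M..t} (\<lambda>s. m * ker \<beta> (t - s))"
      by (rule set_integrable_mult_right, rule set_integrable_subset[OF ki]) (use sub in auto)
    show "ker \<beta> (t - s) * \<bar>\<phi> s\<bar> \<le> m * ker \<beta> (t - s)" if "s \<in> {M..t}" for s
      using mult_left_mono[OF m(2) knn, of s s] that t by (simp add: mult.commute)
  qed
  finally have "\<bar>conv (ker \<beta>) \<phi> t\<bar> \<le> B * (ker (\<beta> + 1) t - ker (\<beta> + 1) (t - M)) + m * ker (\<beta> + 1) (t - M)"
    by (simp add: I1 I2)
  then have "\<mu> * \<bar>conv (ker \<beta>) \<phi> t\<bar> \<le> \<mu> * (B * (ker (\<beta> + 1) t - ker (\<beta> + 1) (t - M)) + m * ker (\<beta> + 1) (t - M))"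
    using lam by simp
  also have "\<dots> = B * (surv (t - M) - surv t) + m * (1 - surv (t - M))"
    by (simp add: surv_def algebra_simps)
  finally show ?thesis using lam by (simp add: abs_mult)
qed

lemma resolvent_average_le:
  assumes "0 \<le> t" "set_borel_measurable borel {0..t} \<phi>" "0 \<le> m" "\<And>s. 0 \<le> s \<Longrightarrow> s \<le> t \<Longrightarrow> \<bar>\<phi> s\<bar> \<le> m"
  shows "\<bar>\<mu> * conv (ker \<beta>) \<phi> t\<bar> \<le> m"
proof -
  have "\<bar>\<mu> * conv (ker \<beta>) \<phi> t\<bar> \<le> m * (surv (t - 0) - surv t) + m * (1 - surv (t - 0))"
    by (rule resolvent_average_bound) (use assms in auto)
  also have "\<dots> \<le> m" using surv_nonneg[of t] assms by (simp add: algebra_simps)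
  finally show ?thesis .
qed

text \<open>The average forgets the distant past: once \<phi> is below \<open>m\<close> after M, the
  earlier values carry weight at most \<open>surv (t - M)\<close>, which tends to 0.\<close>

lemma resolvent_average_eventually_le:
  assumes \<phi>: "\<And>t. 0 \<le> t \<Longrightarrow> set_borel_measurable borel {0..t} \<phi>" "\<And>t. 0 \<le> t \<Longrightarrow> \<bar>\<phi> t\<bar> \<le> B"
    and m: "0 \<le> m" "\<forall>\<^sub>F t in at_top. \<bar>\<phi> t\<bar> \<le> m" and e: "0 < \<epsilon>"
  shows "\<forall>\<^sub>F t in at_top. \<bar>\<mu> * conv (ker \<beta>) \<phi> t\<bar> \<le> m + \<epsilon>"
proof -
  have B: "0 \<le> B" using \<phi>(2)[of 0] by simp
  obtain N where "\<And>t. N \<le> t \<Longrightarrow> \<bar>\<phi> t\<bar> \<le> m" using m(2) by (auto simp: eventually_at_top_linorder)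
  then obtain M where M: "0 \<le> M" "\<And>t. M \<le> t \<Longrightarrow> \<bar>\<phi> t\<bar> \<le> m" by (intro that[of "max N 0"]) auto
  have "\<forall>\<^sub>F u in at_top. surv u < \<epsilon> / (B + 1)"
    using surv_tendsto_0 by (rule order_tendstoD(2)) (use e B in auto)
  then obtain N where N: "\<And>u. N \<le> u \<Longrightarrow> surv u < \<epsilon> / (B + 1)" by (auto simp: eventually_at_top_linorder)
  have "\<bar>\<mu> * conv (ker \<beta>) \<phi> t\<bar> \<le> m + \<epsilon>" if t: "M + \<bar>N\<bar> \<le> t" for t
  proof -
    have "\<bar>\<mu> * conv (ker \<beta>) \<phi> t\<bar> \<le> B * (surv (t - M) - surv t) + m * (1 - surv (t - M))"
      by (rule resolvent_average_bound) (use t M \<phi> B m in auto)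
    also have "\<dots> \<le> B * (\<epsilon> / (B + 1)) + m * 1"
    proof (intro add_mono mult_left_mono)
      have "N \<le> t - M" using t abs_ge_self[of N] by (simp del: abs_ge_self)
      then show "surv (t - M) - surv t \<le> \<epsilon> / (B + 1)"
        using N[of "t - M"] surv_nonneg[of t] t M by linarith
      show "1 - surv (t - M) \<le> 1" using surv_nonneg[of "t - M"] t by simp
    qed (use B m in auto)
    also have "B * (\<epsilon> / (B + 1)) \<le> \<epsilon>" using B e by (simp add: field_simps)
    finally show ?thesis by simp
  qed
  then show ?thesis by (auto simp: eventually_at_top_linorder)
qed

section \<open>Initial conditions of the first and the second class\<close>

lemma conv_ker_const:
  assumes "0 \<le> t"
  shows "conv (ker \<beta>) (\<lambda>s. c) t = c * ker (\<beta> + 1) t" and "conv_exists (ker \<beta>) (\<lambda>s. c) t"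
  using set_integral_ker(2)[OF beta(1) assms] set_integral_reflect(2)[of 0 t "ker \<beta>"] set_integrable_ker[OF beta(1), of t]
  by (simp_all add: conv_def conv_exists_def mult.commute)

text \<open>Split off the limit L. A constant is perturbed into L times \<open>surv\<close>, which
  decays, and the remainder \<zeta> tends to 0, so its average does too. The factor 2 counts \<xi>
  and its average.\<close>

lemma perturb_E1:
  assumes cont: "continuous_on {0..} \<xi>" and lim: "(\<xi> \<longlongrightarrow> L) at_top" and B: "\<And>t. 0 \<le> t \<Longrightarrow> \<bar>\<xi> t\<bar> \<le> B"
  shows "0 \<le> t \<Longrightarrow> conv_exists (ker \<beta>) \<xi> t"
    and "0 \<le> t \<Longrightarrow> \<bar>perturb \<xi> t\<bar> \<le> 2 * B"
    and "(perturb \<xi> \<longlongrightarrow> 0) at_top"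
proof -
  have m: "set_borel_measurable borel {0..t} \<xi>" for t
    by (intro continuous_on_set_borel_measurable continuous_on_subset[OF cont]) auto
  show ci: "conv_exists (ker \<beta>) \<xi> t" if "0 \<le> t" for t
    by (rule conv_exists_ker_bounded[OF m]) (use B beta in auto)
  have B0: "0 \<le> B" using B[of 0] by simp
  show "\<bar>perturb \<xi> t\<bar> \<le> 2 * B" if "0 \<le> t"
  proof -
    have "\<bar>\<mu> * conv (ker \<beta>) \<xi> t\<bar> \<le> B" by (rule resolvent_average_le[OF that m B0]) (rule B)
    then show ?thesis using B[OF that] unfolding perturb_def by linarith
  qed
  define \<zeta> where "\<zeta> s = \<xi> s - L" for s
  have "continuous_on {0..} \<zeta>" unfolding \<zeta>_def by (intro continuous_intros cont)
  then have zm: "set_borel_measurable borel {0..t} \<zeta>" for t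
    by (intro continuous_on_set_borel_measurable) (auto intro: continuous_on_subset)
  have zb: "\<bar>\<zeta> t\<bar> \<le> B + \<bar>L\<bar>" if "0 \<le> t" for t using B[OF that] by (simp add: \<zeta>_def)
  have z0: "(\<zeta> \<longlongrightarrow> 0) at_top" using tendsto_diff[OF lim tendsto_const[of L]] by (simp add: \<zeta>_def[abs_def])
  have conv0: "((\<lambda>t. \<mu> * conv (ker \<beta>) \<zeta> t) \<longlongrightarrow> 0) at_top"
  proof (rule tendstoI)
    fix e :: real assume e: "0 < e"
    have "\<forall>\<^sub>F t in at_top. \<bar>\<zeta> t\<bar> < e / 4"
      using tendsto_rabs_zero[OF z0] by (rule order_tendstoD(2)) (use e in auto)
    then have "\<forall>\<^sub>F t in at_top. \<bar>\<zeta> t\<bar> \<le> e / 4" by eventually_elim simp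
    then have "\<forall>\<^sub>F t in at_top. \<bar>\<mu> * conv (ker \<beta>) \<zeta> t\<bar> \<le> e / 4 + e / 4"
      by (intro resolvent_average_eventually_le[OF zm zb]) (use e in auto)
    then show "\<forall>\<^sub>F t in at_top. dist (\<mu> * conv (ker \<beta>) \<zeta> t) 0 < e"
      by eventually_elim (use e in auto)
  qed
  have eq: "perturb \<xi> t = \<zeta> t + L * surv t - \<mu> * conv (ker \<beta>) \<zeta> t" if t: "0 \<le> t" for t
  proof -
    have "conv (ker \<beta>) \<xi> t = conv (ker \<beta>) (\<lambda>s. \<zeta> s + L) t" by (rule conv_cong) (simp add: \<zeta>_def)
    also have "\<dots> = conv (ker \<beta>) \<zeta> t + conv (ker \<beta>) (\<lambda>s. L) t"
      by (rule conv_add(2)[OF conv_exists_ker_bounded[OF zm zb beta(1)] conv_ker_const(2)[OF t]]) auto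
    finally show ?thesis unfolding perturb_def surv_def by (simp add: conv_ker_const[OF t] \<zeta>_def[of t] algebra_simps)
  qed
  have "((\<lambda>t. \<zeta> t + L * surv t - \<mu> * conv (ker \<beta>) \<zeta> t) \<longlongrightarrow> 0 + L * 0 - 0) at_top"
    by (intro tendsto_intros z0 surv_tendsto_0 conv0)
  moreover have "\<forall>\<^sub>F t in at_top. perturb \<xi> t = \<zeta> t + L * surv t - \<mu> * conv (ker \<beta>) \<zeta> t"
    using eventually_ge_at_top[of 0] by eventually_elim (rule eq)
  ultimately show "(perturb \<xi> \<longlongrightarrow> 0) at_top"
    using tendsto_cong[of "perturb \<xi>" "\<lambda>t. \<zeta> t + L * surv t - \<mu> * conv (ker \<beta>) \<zeta> t" at_top 0] by simp
qed

text \<open>By the fundamental theorem \<xi> is its initial value plus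
  \<open>conv (rl_ker 1) \<xi>'\<close>. Perturbation gives the initial value times
  \<open>surv\<close> plus \<open>conv (ker 1) \<xi>'\<close>, and the bound on \<xi>' is D
  \<Gamma>(\<upsilon>) times the kernel of order \<upsilon>, which raises the order of
  \<open>ker 1\<close> to 1 + \<upsilon>.\<close>

lemma perturb_E2:
  assumes \<upsilon>: "0 < \<upsilon>" "\<upsilon> < \<beta>" and cont: "continuous_on {0..} \<xi>'"
    and deriv: "\<And>t. 0 \<le> t \<Longrightarrow> (\<xi> has_real_derivative \<xi>' t) (at t within {0..})"
    and D: "0 \<le> D" "\<And>t. 0 < t \<Longrightarrow> \<bar>\<xi>' t\<bar> \<le> D * t powr (\<upsilon> - 1)"
  shows "0 \<le> t \<Longrightarrow> conv_exists (ker \<beta>) \<xi> t"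
    and "0 \<le> t \<Longrightarrow> \<bar>perturb \<xi> t\<bar> \<le> \<bar>\<xi> 0\<bar> * surv t + D * Gamma \<upsilon> * ker (1 + \<upsilon>) t"
proof -
  have gm: "set_borel_measurable borel {0..t} \<xi>'" for t
    by (intro continuous_on_set_borel_measurable continuous_on_subset[OF cont]) auto
  have gb: "\<exists>B. \<forall>s\<in>{0..t}. \<bar>\<xi>' s\<bar> \<le> B" for t
  proof -
    have "compact (\<xi>' ` {0..t})"
      by (intro compact_continuous_image continuous_on_subset[OF cont]) auto
    then show ?thesis using compact_imp_bounded bounded_iff[of "\<xi>' ` {0..t}"] by auto
  qed
  have ki: "conv_exists (ker \<eta>) \<xi>' t" if "0 < \<eta>" for \<eta> t
  proof -
    obtain B where "\<forall>s\<in>{0..t}. \<bar>\<xi>' s\<bar> \<le> B" using gb by blast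
    then show ?thesis by (intro conv_exists_ker_bounded[OF gm _ that, where B=B]) auto
  qed
  have ri: "conv_exists (rl_ker \<eta>) \<xi>' t" if "0 < \<eta>" for \<eta> t
  proof -
    obtain B where "\<forall>s\<in>{0..t}. \<bar>\<xi>' s\<bar> \<le> B" using gb by blast
    then show ?thesis by (intro conv_exists_bounded[OF set_integrable_rl_ker[OF that] gm, where B=B]) auto
  qed
  have ftc: "\<xi> t = \<xi> 0 + conv (rl_ker 1) \<xi>' t" if t: "0 \<le> t" for t
  proof -
    have "(LBINT s:{0..t}. \<xi>' s) = \<xi> t - \<xi> 0"
      unfolding set_lebesgue_integral_def
    proof (rule integral_FTC_Icc[OF t])
      show "(\<xi> has_vector_derivative \<xi>' x) (at x within {0..t})" if "0 \<le> x" "x \<le> t" for x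
        using DERIV_subset[OF deriv[OF that(1)], of "{0..t}"] by (auto simp: has_real_derivative_iff_has_vector_derivative)
    qed (rule continuous_on_subset[OF cont], auto)
    moreover have "(LBINT s:{0..t}. \<xi>' s) = conv (rl_ker 1) \<xi>' t"
      unfolding conv_def set_lebesgue_integral_def
    proof (rule integral_cong_AE)
      show "AE s in lborel. indicator {0..t} s *\<^sub>R \<xi>' s = indicator {0..t} s *\<^sub>R (rl_ker 1 (t - s) * \<xi>' s)"
        using AE_lborel_singleton[of t] by eventually_elim (auto simp: rl_ker_def indicator_def)
      show "(\<lambda>s. indicator {0..t} s *\<^sub>R \<xi>' s) \<in> borel_measurable lborel"
        using gm by (simp add: set_borel_measurable_def)
      show "(\<lambda>s. indicator {0..t} s *\<^sub>R (rl_ker 1 (t - s) * \<xi>' s)) \<in> borel_measurable lborel"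
        using ri[of 1 t] by (auto simp: conv_exists_def set_integrable_def)
    qed
    ultimately show ?thesis by simp
  qed
  note pc = perturb_conv[OF zero_less_one _ gm ki ri[OF zero_less_one]]
  have c1: "conv_exists (ker \<beta>) (conv (rl_ker 1) \<xi>') t" if "0 \<le> t" for t
    using pc(1)[OF that] beta by simp
  show "conv_exists (ker \<beta>) \<xi> t" if "0 \<le> t" for t
  proof -
    have "conv_exists (ker \<beta>) \<xi> t \<longleftrightarrow> conv_exists (ker \<beta>) (\<lambda>s. \<xi> 0 + conv (rl_ker 1) \<xi>' s) t"
      by (rule conv_exists_cong) (rule ftc)
    with conv_add(1)[OF conv_ker_const(2)[OF that] c1[OF that]] show ?thesis by simp
  qed
  show "\<bar>perturb \<xi> t\<bar> \<le> \<bar>\<xi> 0\<bar> * surv t + D * Gamma \<upsilon> * ker (1 + \<upsilon>) t" if t: "0 \<le> t"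
  proof -
    have "perturb \<xi> t = perturb (\<lambda>s. \<xi> 0 + conv (rl_ker 1) \<xi>' s) t"
      by (rule perturb_cong[OF t]) (rule ftc)
    also have "\<dots> = perturb (\<lambda>s. \<xi> 0) t + perturb (conv (rl_ker 1) \<xi>') t"
      by (rule perturb_add[OF conv_ker_const(2)[OF t] c1[OF t]])
    also have "perturb (\<lambda>s. \<xi> 0) t = \<xi> 0 * surv t"
      by (simp add: perturb_def surv_def conv_ker_const[OF t] right_diff_distrib)
    also have "perturb (conv (rl_ker 1) \<xi>') t = conv (ker 1) \<xi>' t"
      using pc(2)[OF t] beta by simp
    finally have eq: "perturb \<xi> t = \<xi> 0 * surv t + conv (ker 1) \<xi>' t" .
    have "\<bar>conv (ker 1) \<xi>' t\<bar> \<le> (LBINT s:{0..t}. \<bar>ker 1 (t - s) * \<xi>' s\<bar>)"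
      unfolding conv_def by (rule abs_set_integral_le)
    also have "\<dots> \<le> (LBINT s:{0..t}. D * Gamma \<upsilon> * (ker 1 (t - s) * rl_ker \<upsilon> s))"
    proof (rule set_integral_mono_AE)
      show "set_integrable lborel {0..t} (\<lambda>s. \<bar>ker 1 (t - s) * \<xi>' s\<bar>)"
        using ki[of 1 t] by (intro set_integrable_abs) (simp add: conv_exists_def)
      show "set_integrable lborel {0..t} (\<lambda>s. D * Gamma \<upsilon> * (ker 1 (t - s) * rl_ker \<upsilon> s))"
        using conv_ker_rl_ker(2)[of 1 \<upsilon> t] \<upsilon> t by (simp add: conv_exists_def)
      show "AE s\<in>{0..t} in lborel. \<bar>ker 1 (t - s) * \<xi>' s\<bar> \<le> D * Gamma \<upsilon> * (ker 1 (t - s) * rl_ker \<upsilon> s)"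
        using AE_lborel_singleton[of 0]
      proof eventually_elim
        case (elim s)
        show ?case
        proof
          assume "s \<in> {0..t}"
          then have s: "0 < s" "s \<le> t" using elim by auto
          have k: "0 \<le> ker 1 (t - s)" using ker_nonneg[of 1 "t - s"] beta s by simp
          have "Gamma \<upsilon> > 0" using \<upsilon> by (auto intro: Gamma_real_pos)
          then have "Gamma \<upsilon> * rl_ker \<upsilon> s = s powr (\<upsilon> - 1)" by (simp add: rl_ker_def)
          then have "\<bar>\<xi>' s\<bar> \<le> D * Gamma \<upsilon> * rl_ker \<upsilon> s" using D(2)[OF s(1)] by (simp add: mult.assoc)
          then have "ker 1 (t - s) * \<bar>\<xi>' s\<bar> \<le> ker 1 (t - s) * (D * Gamma \<upsilon> * rl_ker \<upsilon> s)"
            using k by (rule mult_left_mono)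
          then show "\<bar>ker 1 (t - s) * \<xi>' s\<bar> \<le> D * Gamma \<upsilon> * (ker 1 (t - s) * rl_ker \<upsilon> s)"
            using k by (simp add: abs_mult mult_ac)
        qed
      qed
    qed
    also have "\<dots> = D * Gamma \<upsilon> * ker (1 + \<upsilon>) t"
      using conv_ker_rl_ker(1)[of 1 \<upsilon> t] \<upsilon> t by (simp add: conv_def)
    finally have "\<bar>conv (ker 1) \<xi>' t\<bar> \<le> D * Gamma \<upsilon> * ker (1 + \<upsilon>) t" .
    moreover have "\<bar>\<xi> 0 * surv t\<bar> = \<bar>\<xi> 0\<bar> * surv t" using surv_nonneg[OF t] by (simp add: abs_mult)
    ultimately show ?thesis unfolding eq by (intro order_trans[OF abs_triangle_ineq]) simp
  qed
qed

end

subsection \<open>Integration by parts for the Young integral\<close>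

lemma small_mesh:
  fixes c d :: real
  assumes "0 < d"
  shows "\<exists>N. \<forall>n\<ge>N. 1 \<le> n \<and> c / real n < d"
proof -
  have "(\<lambda>n. c / real n) \<longlonglongrightarrow> 0" by (rule lim_const_over_n)
  then have "\<forall>\<^sub>F n in sequentially. 1 \<le> n \<and> c / real n < d"
    by (intro eventually_conj eventually_ge_at_top order_tendstoD(2)) (use assms in auto)
  then show ?thesis by (simp add: eventually_sequentially)
qed

text \<open>Compare each term with the increment of P = \<phi> \<theta> - \<integral> \<phi>'
  \<theta>. The error is the integral of \<phi>'(y) (\<theta>(y) - \<theta>(s)) over one cell with
  right end s, small by uniform continuity of \<theta>; thus continuity of \<theta> is
  enough.\<close>

lemma uniform_riemann_stieltjes_sum:
  fixes \<phi> \<theta> \<phi>' :: "real \<Rightarrow> real"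
  assumes ab: "a < b" and \<theta>: "continuous_on {a..b} \<theta>" and \<phi>': "continuous_on {a..b} \<phi>'"
    and deriv: "\<And>x. a \<le> x \<Longrightarrow> x \<le> b \<Longrightarrow> (\<phi> has_real_derivative \<phi>' x) (at x within {a..b})"
  defines "\<sigma> \<equiv> \<lambda>n i. a + real i * ((b - a) / real n)"
  shows "(\<lambda>n. \<Sum>i<n. \<phi> (\<sigma> n i) * (\<theta> (\<sigma> n (Suc i)) - \<theta> (\<sigma> n i)))
    \<longlonglongrightarrow> \<phi> b * \<theta> b - \<phi> a * \<theta> a - (LBINT s:{a..b}. \<phi>' s * \<theta> s)"
proof -
  obtain C where C: "0 < C" "\<And>x. x \<in> {a..b} \<Longrightarrow> \<bar>\<phi>' x\<bar> \<le> C"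
  proof -
    have "bounded (\<phi>' ` {a..b})" by (intro compact_imp_bounded compact_continuous_image \<phi>') auto
    then obtain C where "0 < C" "\<forall>y\<in>\<phi>' ` {a..b}. norm y \<le> C" unfolding bounded_pos by blast
    then show ?thesis by (intro that[of C]) auto
  qed
  have unif: "uniformly_continuous_on {a..b} \<theta>" by (rule compact_uniformly_continuous[OF \<theta>]) auto
  let ?L = "\<phi> b * \<theta> b - \<phi> a * \<theta> a - (LBINT s:{a..b}. \<phi>' s * \<theta> s)"
  have int: "set_integrable lborel {c..d} f" if "continuous_on {a..b} f" "a \<le> c" "d \<le> b" for c d and f :: "real \<Rightarrow> real"
    by (rule borel_integrable_atLeastAtMost'[OF continuous_on_subset[OF that(1)]]) (use that in auto)
  show ?thesis
  proof (rule LIMSEQ_I)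
    fix r :: real assume r: "0 < r"
    define D where "D = C * (b - a)"
    have D: "0 < D" using C ab by (simp add: D_def)
    \<comment> \<open>The n cell errors e C k add up to e C (b - a) = r / 2.\<close>
    define e where "e = r / 2 / D"
    have e: "0 < e" using r D by (simp add: e_def)
    obtain d where d: "0 < d" "\<And>x y. x \<in> {a..b} \<Longrightarrow> y \<in> {a..b} \<Longrightarrow> dist y x < d \<Longrightarrow> dist (\<theta> y) (\<theta> x) < e"
      using uniformly_continuous_onE[OF unif e] by metis
    obtain N where N: "\<And>n. N \<le> n \<Longrightarrow> 1 \<le> n \<and> (b - a) / real n < d"
      using small_mesh[of d "b - a"] d(1) by blast
    show "\<exists>no. \<forall>n\<ge>no. norm ((\<Sum>i<n. \<phi> (\<sigma> n i) * (\<theta> (\<sigma> n (Suc i)) - \<theta> (\<sigma> n i))) - ?L) < r"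
    proof (intro exI[of _ N] allI impI)
      fix n assume n: "N \<le> n"
      define k where "k = (b - a) / real n"
      have k: "0 < k" "real n * k = b - a" using N[OF n] ab by (auto simp: k_def)
      have kd: "k < d" using N[OF n] by (simp add: k_def)
      define s where "s i = \<sigma> n i" for i
      have s: "s i = a + real i * k" for i by (simp add: s_def \<sigma>_def k_def)
      have s_in: "a \<le> s i" "s i \<le> b" if "i \<le> n" for i
      proof -
        have "real i * k \<le> real n * k" using that k by (intro mult_right_mono) auto
        then show "s i \<le> b" using k by (simp add: s)
      qed (use k in \<open>simp add: s\<close>)
      have s_Suc: "s (Suc i) = s i + k" for i by (simp add: s algebra_simps)
      define \<Psi> where "\<Psi> x = (LBINT y:{a..x}. \<phi>' y * \<theta> y)" for x
      define P where "P i = \<phi> (s i) * \<theta> (s i) - \<Psi> (s i)" for i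
      have step: "\<bar>\<phi> (s i) * (\<theta> (s (Suc i)) - \<theta> (s i)) - (P (Suc i) - P i)\<bar> \<le> e * C * k" if i: "i < n" for i
      proof -
        have si: "a \<le> s i" "s i \<le> s (Suc i)" "s (Suc i) \<le> b" using s_in[of i] s_in[of "Suc i"] i k by (auto simp: s_Suc)
        note I = int[OF _ si(1) si(3)]
        have 1: "(LBINT y:{s i..s (Suc i)}. \<phi>' y) = \<phi> (s (Suc i)) - \<phi> (s i)"
          unfolding set_lebesgue_integral_def
        proof (rule integral_FTC_Icc[OF si(2)])
          show "(\<phi> has_vector_derivative \<phi>' x) (at x within {s i..s (Suc i)})" if "s i \<le> x" "x \<le> s (Suc i)" for x
            using DERIV_subset[OF deriv[of x], of "{s i..s (Suc i)}"] that si
            by (auto simp: has_real_derivative_iff_has_vector_derivative)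
        qed (rule continuous_on_subset[OF \<phi>'], use si in auto)
        have 2: "\<Psi> (s (Suc i)) - \<Psi> (s i) = (LBINT y:{s i..s (Suc i)}. \<phi>' y * \<theta> y)"
          unfolding \<Psi>_def using si
          by (subst set_integral_split[of a "s (Suc i)" _ "s i"]) (auto intro!: int continuous_intros \<phi>' \<theta>)
        \<comment> \<open>Summation by parts on one cell: the term evaluates \<phi> at the left end,
          so \<theta> comes out at the right end.\<close>
        have "\<phi> (s i) * (\<theta> (s (Suc i)) - \<theta> (s i)) - (P (Suc i) - P i) =
            (LBINT y:{s i..s (Suc i)}. \<phi>' y * \<theta> y) - \<theta> (s (Suc i)) * (LBINT y:{s i..s (Suc i)}. \<phi>' y)"
          unfolding 1 2[symmetric] P_def by (simp add: algebra_simps)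
        also have "\<dots> = (LBINT y:{s i..s (Suc i)}. \<phi>' y * \<theta> y - \<theta> (s (Suc i)) * \<phi>' y)"
          by (subst set_integral_diff) (auto intro!: I continuous_intros \<phi>' \<theta>)
        also have "\<bar>\<dots>\<bar> \<le> (LBINT y:{s i..s (Suc i)}. \<bar>\<phi>' y * \<theta> y - \<theta> (s (Suc i)) * \<phi>' y\<bar>)"
          by (rule abs_set_integral_le)
        also have "\<dots> \<le> (LBINT y:{s i..s (Suc i)}. e * C)"
        proof (rule set_integral_mono)
          show "set_integrable lborel {s i..s (Suc i)} (\<lambda>y. \<bar>\<phi>' y * \<theta> y - \<theta> (s (Suc i)) * \<phi>' y\<bar>)"
            by (intro I continuous_intros \<phi>' \<theta>)
          show "set_integrable lborel {s i..s (Suc i)} (\<lambda>y. e * C)"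
            by (intro I continuous_intros)
          fix y assume y: "y \<in> {s i..s (Suc i)}"
          have "dist (\<theta> y) (\<theta> (s (Suc i))) < e"
            by (rule d(2)) (use y si kd in \<open>auto simp: dist_real_def s_Suc\<close>)
          then have "\<bar>\<theta> y - \<theta> (s (Suc i))\<bar> * \<bar>\<phi>' y\<bar> \<le> e * C"
            using C y si e by (intro mult_mono) (auto simp: dist_real_def)
          then show "\<bar>\<phi>' y * \<theta> y - \<theta> (s (Suc i)) * \<phi>' y\<bar> \<le> e * C"
            by (simp add: abs_mult[symmetric] algebra_simps)
        qed
        also have "\<dots> = e * C * k" using k by (simp add: set_lebesgue_integral_def s_Suc)
        finally show ?thesis .
      qed
      have "(\<Sum>i<n. P (Suc i) - P i) = P n - P 0" by (rule sum_lessThan_telescope)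
      also have "P n - P 0 = ?L"
      proof -
        have "AE y in lborel. indicator {a..a} y *\<^sub>R (\<phi>' y * \<theta> y) = 0"
          using AE_lborel_singleton[of a] by eventually_elim (auto simp: indicator_def)
        then have "\<Psi> a = 0" unfolding \<Psi>_def set_lebesgue_integral_def by (rule integral_eq_zero_AE)
        then show ?thesis using k by (simp add: P_def s \<Psi>_def)
      qed
      finally have tel: "(\<Sum>i<n. P (Suc i) - P i) = ?L" .
      have "norm ((\<Sum>i<n. \<phi> (\<sigma> n i) * (\<theta> (\<sigma> n (Suc i)) - \<theta> (\<sigma> n i))) - ?L) =
         \<bar>\<Sum>i<n. \<phi> (s i) * (\<theta> (s (Suc i)) - \<theta> (s i)) - (P (Suc i) - P i)\<bar>"
        unfolding tel[symmetric] s_def sum_subtractf by simp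
      also have "\<dots> \<le> (\<Sum>i<n. e * C * k)"
        by (rule order_trans[OF sum_abs sum_mono]) (use step in auto)
      also have "\<dots> = e * C * (b - a)" using k by simp
      also have "\<dots> = r / 2"
      proof -
        have "e * C * (b - a) = e * D" by (simp add: D_def mult.assoc)
        then show ?thesis using D by (simp add: e_def)
      qed
      finally show "norm ((\<Sum>i<n. \<phi> (\<sigma> n i) * (\<theta> (\<sigma> n (Suc i)) - \<theta> (\<sigma> n i))) - ?L) < r"
        using r by simp
    qed
  qed
qed

text \<open>The mesh condition only bounds the first and the last interval of a partition, so
  those can be fixed (away from the singularities of \<open>\<phi>'\<close> at the end points) while the partition in
  between is refined.\<close>

lemma young_integral_by_parts:
  fixes \<phi> \<theta> \<phi>' :: "real \<Rightarrow> real"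
  assumes t: "0 < t" and J: "has_young_integral \<phi> \<theta> 0 t J"
    and \<phi>: "continuous_on {0..t} \<phi>" "\<phi> t = 0" and \<theta>: "continuous_on {0..t} \<theta>" "\<theta> 0 = 0"
    and deriv: "\<And>x. 0 < x \<Longrightarrow> x < t \<Longrightarrow> (\<phi> has_real_derivative \<phi>' x) (at x)"
    and cont': "continuous_on {0<..<t} \<phi>'"
    and int: "set_integrable lborel {0..t} (\<lambda>s. \<phi>' s * \<theta> s)"
  shows "J = - (LBINT s:{0..t}. \<phi>' s * \<theta> s)"
proof -
  \<comment> \<open>The limit of the Riemann sums whose partition has the fixed first cell [0, a],
    the fixed last cell [b, t] and a uniform refinement in between; the first term uses \<theta>(0)
    = 0.\<close>
  define Q where "Q a b = \<phi> 0 * \<theta> a + (\<phi> b * \<theta> b - \<phi> a * \<theta> a - (LBINT s:{a..b}. \<phi>' s * \<theta> s)) + \<phi> b * (\<theta> t - \<theta> b)" for a b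
  have Q_le: "\<exists>\<delta>>0. \<forall>a b. 0 < a \<longrightarrow> a < \<delta> \<longrightarrow> a < b \<longrightarrow> b < t \<longrightarrow> t - b < \<delta> \<longrightarrow> \<bar>Q a b - J\<bar> \<le> \<epsilon>"
    if eps: "0 < \<epsilon>" for \<epsilon>
  proof -
    obtain \<delta> where \<delta>: "0 < \<delta>" "\<And>n \<sigma>. \<sigma> 0 = 0 \<and> \<sigma> n = t \<and> (\<forall>i<n. \<sigma> i < \<sigma> (Suc i) \<and> \<sigma> (Suc i) - \<sigma> i < \<delta>) \<Longrightarrow>
        \<bar>(\<Sum>i<n. \<phi> (\<sigma> i) * (\<theta> (\<sigma> (Suc i)) - \<theta> (\<sigma> i))) - J\<bar> < \<epsilon>"
      using J eps unfolding has_young_integral_def by blast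
    have "\<bar>Q a b - J\<bar> \<le> \<epsilon>" if ab: "0 < a" "a < \<delta>" "a < b" "b < t" "t - b < \<delta>" for a b
    proof -
      define \<rho> where "\<rho> n i = a + real i * ((b - a) / real n)" for n i
      define S where "S n = (\<Sum>i<n. \<phi> (\<rho> n i) * (\<theta> (\<rho> n (Suc i)) - \<theta> (\<rho> n i)))" for n
      have lim: "S \<longlonglongrightarrow> \<phi> b * \<theta> b - \<phi> a * \<theta> a - (LBINT s:{a..b}. \<phi>' s * \<theta> s)"
        unfolding S_def[abs_def] \<rho>_def
      proof (rule uniform_riemann_stieltjes_sum[OF ab(3)])
        show "continuous_on {a..b} \<theta>" by (rule continuous_on_subset[OF \<theta>(1)]) (use ab in auto)
        show "continuous_on {a..b} \<phi>'" by (rule continuous_on_subset[OF cont']) (use ab in auto)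
        show "(\<phi> has_real_derivative \<phi>' x) (at x within {a..b})" if "a \<le> x" "x \<le> b" for x
          using deriv[of x] that ab by (auto intro: has_field_derivative_at_within)
      qed
      then have lim: "(\<lambda>n. \<bar>\<phi> 0 * \<theta> a + S n + \<phi> b * (\<theta> t - \<theta> b) - J\<bar>) \<longlonglongrightarrow> \<bar>Q a b - J\<bar>"
        unfolding Q_def by (intro tendsto_intros)
      obtain N where N: "\<And>n. N \<le> n \<Longrightarrow> 1 \<le> n \<and> (b - a) / real n < \<delta>"
        using small_mesh[of \<delta> "b - a"] \<delta>(1) by blast
      have "\<bar>\<phi> 0 * \<theta> a + S n + \<phi> b * (\<theta> t - \<theta> b) - J\<bar> \<le> \<epsilon>" if n: "N \<le> n" for n
      proof -
        define k where "k = (b - a) / real n"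
        have k: "0 < k" "real n * k = b - a" using N[OF n] ab by (auto simp: k_def)
        have kd: "k < \<delta>" using N[OF n] by (simp add: k_def)
        have \<rho>: "\<rho> n i = a + real i * k" for i by (simp add: \<rho>_def k_def)
        \<comment> \<open>Index shift by one for the extra cell [0, a]: there are n + 2 cells in
          all, and \<open>\<sigma> (Suc n)\<close> is b.\<close>
        define \<sigma> where "\<sigma> i = (if i = 0 then 0 else if i \<le> Suc n then \<rho> n (i - 1) else t)" for i
        have \<sigma>_Suc: "\<sigma> (Suc i) = \<rho> n i" if "i \<le> n" for i using that by (simp add: \<sigma>_def)
        have \<sigma>_last: "\<sigma> (Suc (Suc n)) = t" "\<sigma> (Suc n) = b" "\<sigma> 0 = 0" "\<sigma> (Suc 0) = a"
          using k by (simp_all add: \<sigma>_def \<rho>)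
        have mesh: "\<sigma> i < \<sigma> (Suc i) \<and> \<sigma> (Suc i) - \<sigma> i < \<delta>" if i: "i < Suc (Suc n)" for i
        proof -
          consider "i = 0" | j where "i = Suc j" "j < n" | "i = Suc n" using i by (cases i) (auto simp: less_Suc_eq)
          then show ?thesis
          proof cases
            case 1 then show ?thesis using \<sigma>_last ab by simp
          next
            case 2 then show ?thesis using k kd by (simp add: \<sigma>_Suc \<rho> algebra_simps)
          next
            case 3 then show ?thesis using \<sigma>_last ab by simp
          qed
        qed
        have "\<bar>(\<Sum>i<Suc (Suc n). \<phi> (\<sigma> i) * (\<theta> (\<sigma> (Suc i)) - \<theta> (\<sigma> i))) - J\<bar> < \<epsilon>"
          by (rule \<delta>(2)) (use mesh \<sigma>_last in auto)
        also have "(\<Sum>i<Suc (Suc n). \<phi> (\<sigma> i) * (\<theta> (\<sigma> (Suc i)) - \<theta> (\<sigma> i))) =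
           \<phi> 0 * \<theta> a + S n + \<phi> b * (\<theta> t - \<theta> b)"
        proof -
          have "(\<Sum>i<Suc n. \<phi> (\<sigma> i) * (\<theta> (\<sigma> (Suc i)) - \<theta> (\<sigma> i))) =
            \<phi> (\<sigma> 0) * (\<theta> (\<sigma> (Suc 0)) - \<theta> (\<sigma> 0)) + (\<Sum>i<n. \<phi> (\<sigma> (Suc i)) * (\<theta> (\<sigma> (Suc (Suc i))) - \<theta> (\<sigma> (Suc i))))"
            by (subst sum.lessThan_Suc_shift) simp
          also have "(\<Sum>i<n. \<phi> (\<sigma> (Suc i)) * (\<theta> (\<sigma> (Suc (Suc i))) - \<theta> (\<sigma> (Suc i)))) = S n"
            unfolding S_def by (intro sum.cong refl) (simp add: \<sigma>_Suc)
          finally show ?thesis using \<theta>(2) by (simp add: \<sigma>_last)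
        qed
        finally show ?thesis by simp
      qed
      then show ?thesis
        by (intro tendsto_upperbound[OF lim]) (auto simp: eventually_sequentially intro!: exI[of _ N])
    qed
    with \<delta>(1) show ?thesis by blast
  qed
  \<comment> \<open>The shift by 3 keeps \<open>a n\<close> at most t / 3, so that
    \<open>a n < b n\<close> for every n.\<close>
  define a where "a n = t / real (n + 3)" for n :: nat
  define b where "b n = t - a n" for n :: nat
  have a: "0 < a n" "a n < b n" "b n < t" "a n \<le> t" "0 \<le> b n" for n
  proof -
    have "0 < a n" using t by (simp add: a_def)
    moreover have "a n \<le> t / 3" unfolding a_def using t by (intro divide_left_mono) auto
    ultimately show "0 < a n" "a n < b n" "b n < t" "a n \<le> t" "0 \<le> b n"
      using t unfolding b_def by linarith+
  qed
  have a0: "a \<longlonglongrightarrow> 0"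
  proof -
    have "(\<lambda>n. t * inverse (real (n + 3))) \<longlonglongrightarrow> t * 0"
      by (intro tendsto_mult tendsto_const LIMSEQ_ignore_initial_segment[OF lim_inverse_n])
    then show ?thesis by (simp add: a_def[abs_def] divide_inverse)
  qed
  then have bt: "b \<longlonglongrightarrow> t" using tendsto_diff[OF tendsto_const[of t] a0] by (simp add: b_def[abs_def])
  have along: "(\<lambda>n. F (a n)) \<longlonglongrightarrow> F 0" "(\<lambda>n. F (b n)) \<longlonglongrightarrow> F t" if "continuous_on {0..t} F" for F :: "real \<Rightarrow> real"
    using that a t by (auto intro!: continuous_on_tendsto_compose[OF that] a0 bt always_eventually simp: less_imp_le order.strict_implies_order)
  have ints: "(\<lambda>n. LBINT s:{a n..b n}. \<phi>' s * \<theta> s) \<longlonglongrightarrow> (LBINT s:{0..t}. \<phi>' s * \<theta> s)"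
  proof -
    have U: "(\<Union>n. {a n..b n}) = {0<..<t}"
    proof (intro equalityI subsetI)
      fix x assume x: "x \<in> {0<..<t}"
      have "\<forall>\<^sub>F n in sequentially. a n < x" "\<forall>\<^sub>F n in sequentially. x < b n"
        using a0 bt x by (auto intro: order_tendstoD)
      then have "\<forall>\<^sub>F n in sequentially. a n < x \<and> x < b n" by (rule eventually_conj)
      then obtain n where "a n < x \<and> x < b n" by (auto simp: eventually_sequentially)
      then show "x \<in> (\<Union>n. {a n..b n})" by (auto intro!: exI[of _ n])
    next
      fix x assume "x \<in> (\<Union>n. {a n..b n})"
      then obtain n where "a n \<le> x" "x \<le> b n" by auto
      then show "x \<in> {0<..<t}" using a[of n] by auto
    qed
    have int': "set_integrable lborel {0<..<t} (\<lambda>s. \<phi>' s * \<theta> s)"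
      by (rule set_integrable_subset[OF int]) auto
    have "(\<lambda>n. LBINT s:{a n..b n}. \<phi>' s * \<theta> s) \<longlonglongrightarrow> (LBINT s:(\<Union>n. {a n..b n}). \<phi>' s * \<theta> s)"
    proof (rule set_integral_cont_up)
      have "a n \<le> a m" if "m \<le> n" for m n
        using t that by (auto simp: a_def intro!: divide_left_mono)
      then show "incseq (\<lambda>n. {a n..b n})" by (fastforce simp: incseq_def b_def)
      show "set_integrable lborel (\<Union>n. {a n..b n}) (\<lambda>s. \<phi>' s * \<theta> s)"
        unfolding U by (rule int')
    qed auto
    also have "(LBINT s:(\<Union>n. {a n..b n}). \<phi>' s * \<theta> s) = (LBINT s:{0..t}. \<phi>' s * \<theta> s)"
      unfolding U
    proof (rule set_integral_cong_set)
      show "AE s in lborel. (s \<in> {0..t}) = (s \<in> {0<..<t})"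
        using AE_lborel_singleton[of 0] AE_lborel_singleton[of t] by eventually_elim auto
    qed (use borel_measurable_integrable[OF int[unfolded set_integrable_def]]
        borel_measurable_integrable[OF int'[unfolded set_integrable_def]] in \<open>auto simp: set_borel_measurable_def\<close>)
    finally show ?thesis .
  qed
  \<comment> \<open>As the end cells shrink, the boundary terms tend to values that vanish because
    \<phi>(t) = 0 and \<theta>(0) = 0; the integral converges by monotone exhaustion of the open
    interval.\<close>
  have Qlim: "(\<lambda>n. \<bar>Q (a n) (b n) - J\<bar>) \<longlonglongrightarrow>
      \<bar>(\<phi> 0 * \<theta> 0 + (\<phi> t * \<theta> t - \<phi> 0 * \<theta> 0 - (LBINT s:{0..t}. \<phi>' s * \<theta> s)) + \<phi> t * (\<theta> t - \<theta> t)) - J\<bar>"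
    unfolding Q_def by (intro tendsto_intros along \<phi> \<theta> ints)
  have "\<bar>- (LBINT s:{0..t}. \<phi>' s * \<theta> s) - J\<bar> \<le> 0"
  proof (rule field_le_epsilon)
    fix e :: real assume "0 < e"
    from Q_le[OF this] obtain \<delta> where \<delta>: "\<delta> > 0"
      "\<And>a b. 0 < a \<Longrightarrow> a < \<delta> \<Longrightarrow> a < b \<Longrightarrow> b < t \<Longrightarrow> t - b < \<delta> \<Longrightarrow> \<bar>Q a b - J\<bar> \<le> e" by blast
    have "\<forall>\<^sub>F n in sequentially. a n < \<delta>" using a0 \<delta>(1) by (rule order_tendstoD)
    then have "\<forall>\<^sub>F n in sequentially. \<bar>Q (a n) (b n) - J\<bar> \<le> e"
      by eventually_elim (rule \<delta>(2), use a in \<open>auto simp: b_def\<close>)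
    from tendsto_upperbound[OF Qlim this] show "\<bar>- (LBINT s:{0..t}. \<phi>' s * \<theta> s) - J\<bar> \<le> 0 + e"
      using \<phi>(2) \<theta>(2) by simp
  qed
  then show ?thesis by simp
qed

section \<open>The forcing term as a sum of convolutions\<close>

lemma locally_hoelder_continuous:
  assumes "locally_hoelder \<gamma> u" "0 < \<gamma>"
  shows "continuous_on {0..} u"
proof -
  have "continuous_on {0..T} u" if T: "0 \<le> T" for T
  proof -
    obtain K where K: "\<And>s r. s \<in> {0..T} \<Longrightarrow> r \<in> {0..T} \<Longrightarrow> \<bar>u s - u r\<bar> \<le> K * \<bar>s - r\<bar> powr \<gamma>"
      using assms(1) T unfolding locally_hoelder_def by blast
    show ?thesis
      unfolding continuous_on_def
    proof
      fix x assume x: "x \<in> {0..T}"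
      have "((\<lambda>y. K * \<bar>y - x\<bar> powr \<gamma>) \<longlongrightarrow> K * \<bar>x - x\<bar> powr \<gamma>) (at x within {0..T})"
        using assms(2) by (intro tendsto_intros tendsto_powr') auto
      moreover have "\<forall>\<^sub>F y in at x within {0..T}. norm (u y - u x) \<le> K * \<bar>y - x\<bar> powr \<gamma>"
        unfolding eventually_at_filter by (intro always_eventually) (use K x in simp)
      ultimately have "((\<lambda>y. u y - u x) \<longlongrightarrow> 0) (at x within {0..T})"
        using assms(2) by (intro Lim_null_comparison[of "\<lambda>y. u y - u x" "\<lambda>y. K * \<bar>y - x\<bar> powr \<gamma>"]) auto
      then show "(u \<longlongrightarrow> u x) (at x within {0..T})" by (simp add: LIM_zero_iff)
    qed
  qed
  then show ?thesis
    unfolding continuous_on_eq_continuous_within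
  proof (intro ballI)
    fix x :: real assume x: "x \<in> {0..}" and *: "\<And>T. 0 \<le> T \<Longrightarrow> \<forall>x\<in>{0..T}. continuous (at x within {0..T}) u"
    have "continuous (at x within {0..x+1}) u" using *[of "x + 1"] x by auto
    moreover have "at x within {0..x+1} = at x within {0..}"
      by (rule at_within_nhd[of _ "{..<x+1}"]) auto
    ultimately show "continuous (at x within {0..}) u" by simp
  qed
qed

lemma C1_on_pos_deriv:
  fixes f :: "real \<Rightarrow> real"
  assumes "f C1_differentiable_on {0<..}"
  shows "x > 0 \<Longrightarrow> (f has_real_derivative deriv f x) (at x)" and "continuous_on {0<..} (deriv f)"
proof -
  obtain D where D: "\<And>x. x > 0 \<Longrightarrow> (f has_vector_derivative D x) (at x)" "continuous_on {0<..} D"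
    using assms unfolding C1_differentiable_on_def by auto
  have fd: "(f has_real_derivative D x) (at x)" if "x > 0" for x
    using D(1)[OF that] by (simp add: has_real_derivative_iff_has_vector_derivative)
  then have eq: "deriv f x = D x" if "x > 0" for x using that DERIV_imp_deriv by blast
  show "x > 0 \<Longrightarrow> (f has_real_derivative deriv f x) (at x)" using fd eq by simp
  show "continuous_on {0<..} (deriv f)"
    using D(2) eq by (subst continuous_on_cong[OF refl, where g=D]) auto
qed

text \<open>Integration by parts with \<phi>(s) = (t - s)^(\<alpha> - 1) f(s), which vanishes at s =
  t. The product rule produces one kernel of order \<alpha> - 1 and one of order \<alpha>; the
  singularity of the former is integrable because \<alpha> > 1.\<close>

lemma young_forcing_eq:
  assumes \<alpha>: "1 < \<alpha>" and t: "0 \<le> t"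
    and J: "has_young_integral (\<lambda>s. (t - s) powr (\<alpha> - 1) * f s) \<theta> 0 t J"
    and f: "continuous_on {0..} f" "f C1_differentiable_on {0<..}" and \<theta>: "continuous_on {0..} \<theta>" "\<theta> 0 = 0"
    and int: "set_borel_measurable borel {0..} (\<lambda>s. deriv f s * \<theta> s)" "set_integrable lborel {0..} (\<lambda>s. deriv f s * \<theta> s)"
  shows "1 / Gamma \<alpha> * J =
    conv (rl_ker (\<alpha> - 1)) (\<lambda>s. f s * \<theta> s) t - conv (rl_ker \<alpha>) (\<lambda>s. deriv f s * \<theta> s) t"
proof (cases "t = 0")
  case True
  have "\<bar>J\<bar> \<le> 0"
  proof (rule field_le_epsilon)
    fix e :: real assume "0 < e"
    then obtain \<delta> where "\<And>(n::nat) \<sigma>. \<sigma> 0 = 0 \<and> \<sigma> n = t \<and> (\<forall>i<n. \<sigma> i < \<sigma> (Suc i) \<and> \<sigma> (Suc i) - \<sigma> i < \<delta>) \<Longrightarrow>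
        \<bar>(\<Sum>i<n. (t - \<sigma> i) powr (\<alpha> - 1) * f (\<sigma> i) * (\<theta> (\<sigma> (Suc i)) - \<theta> (\<sigma> i))) - J\<bar> < e"
      using J unfolding has_young_integral_def by blast
    \<comment> \<open>For t = 0 the empty partition is allowed whatever the mesh, and its sum is
      0.\<close>
    from this[of "\<lambda>_. 0" 0] True show "\<bar>J\<bar> \<le> 0 + e" by simp
  qed
  with True show ?thesis by (simp add: conv_at_0)
next
  case False
  with t have t: "0 < t" by simp
  define \<phi>' where "\<phi>' s = - ((\<alpha> - 1) * (t - s) powr (\<alpha> - 2) * f s) + (t - s) powr (\<alpha> - 1) * deriv f s" for s
  have Ga: "0 < Gamma \<alpha>" "0 < Gamma (\<alpha> - 1)" "Gamma \<alpha> = (\<alpha> - 1) * Gamma (\<alpha> - 1)"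
  proof -
    have "\<alpha> - 1 \<notin> \<int>\<^sub>\<le>\<^sub>0" using \<alpha> by (auto elim!: nonpos_Ints_cases)
    then show "Gamma \<alpha> = (\<alpha> - 1) * Gamma (\<alpha> - 1)" using Gamma_plus1[of "\<alpha> - 1"] by simp
  qed (use \<alpha> in \<open>auto intro!: Gamma_real_pos\<close>)
  have fc: "continuous_on {0..t} f" "continuous_on {0..t} \<theta>"
    by (rule continuous_on_subset[OF f(1)] continuous_on_subset[OF \<theta>(1)], simp)+
  have ci1: "conv_exists (rl_ker (\<alpha> - 1)) (\<lambda>s. f s * \<theta> s) t"
  proof -
    have c: "continuous_on {0..t} (\<lambda>s. f s * \<theta> s)" by (intro continuous_intros fc)
    then have "bounded ((\<lambda>s. f s * \<theta> s) ` {0..t})" by (intro compact_imp_bounded compact_continuous_image) auto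
    then obtain B where "\<forall>s\<in>{0..t}. \<bar>f s * \<theta> s\<bar> \<le> B" by (auto simp: bounded_iff)
    then show ?thesis
      using \<alpha> by (intro conv_exists_bounded[where B=B] set_integrable_rl_ker continuous_on_set_borel_measurable c) auto
  qed
  have ci2: "conv_exists (rl_ker \<alpha>) (\<lambda>s. deriv f s * \<theta> s) t"
  proof (rule conv_exists_weight(1)[OF int(1)])
    show "set_integrable lborel {0..t} (\<lambda>s. weight \<alpha> (t - s) * \<bar>deriv f s * \<theta> s\<bar>)"
      using controlled_L1[OF _ int, of \<alpha>] \<alpha> t by (auto simp: controlled_def)
    show "\<forall>u\<in>{0<..t}. \<bar>rl_ker \<alpha> u\<bar> \<le> (1 + t powr \<alpha>) / Gamma \<alpha> * weight \<alpha> u"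
      using rl_ker_le_weight[of \<alpha> \<alpha>] rl_ker_nonneg[of \<alpha>] \<alpha> by auto
  qed simp
  have e1: "(t - s) powr (\<alpha> - 2) = Gamma (\<alpha> - 1) * rl_ker (\<alpha> - 1) (t - s)" for s
    using Ga(2) by (simp add: rl_ker_def)
  have e2: "(t - s) powr (\<alpha> - 1) = Gamma \<alpha> * rl_ker \<alpha> (t - s)" for s
    using Ga(1) by (simp add: rl_ker_def)
  \<comment> \<open>The functional equation \<Gamma>(\<alpha>) = (\<alpha> - 1) \<Gamma>(\<alpha> -
    1) absorbs the factor \<alpha> - 1 from differentiating the power.\<close>
  have eq: "\<phi>' s * \<theta> s = (- Gamma \<alpha>) * (rl_ker (\<alpha> - 1) (t - s) * (f s * \<theta> s)) + Gamma \<alpha> * (rl_ker \<alpha> (t - s) * (deriv f s * \<theta> s))" for s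
    unfolding \<phi>'_def e1 e2 Ga(3) by (simp add: algebra_simps)
  have i1: "set_integrable lborel {0..t} (\<lambda>s. (- Gamma \<alpha>) * (rl_ker (\<alpha> - 1) (t - s) * (f s * \<theta> s)))"
    and i2: "set_integrable lborel {0..t} (\<lambda>s. Gamma \<alpha> * (rl_ker \<alpha> (t - s) * (deriv f s * \<theta> s)))"
    using ci1 ci2 unfolding conv_exists_def by (intro set_integrable_mult_right; simp)+
  have "J = - (LBINT s:{0..t}. \<phi>' s * \<theta> s)"
  proof (rule young_integral_by_parts[OF t J])
    show "continuous_on {0..t} (\<lambda>s. (t - s) powr (\<alpha> - 1) * f s)"
      using \<alpha> by (intro continuous_intros continuous_on_powr' fc) auto
    show "continuous_on {0..t} \<theta>" by fact
    show "((\<lambda>s. (t - s) powr (\<alpha> - 1) * f s) has_real_derivative \<phi>' x) (at x)" if "0 < x" "x < t" for x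
      unfolding \<phi>'_def using that
      by (auto intro!: derivative_eq_intros C1_on_pos_deriv(1)[OF f(2)] simp: algebra_simps)
    show "continuous_on {0<..<t} \<phi>'"
      unfolding \<phi>'_def
      by (intro continuous_intros continuous_on_subset[OF f(1)] continuous_on_subset[OF C1_on_pos_deriv(2)[OF f(2)]]) auto
    show "set_integrable lborel {0..t} (\<lambda>s. \<phi>' s * \<theta> s)"
      unfolding eq by (intro set_integral_add i1 i2)
  qed (use \<theta> in auto)
  also have "(LBINT s:{0..t}. \<phi>' s * \<theta> s) =
      (- Gamma \<alpha>) * conv (rl_ker (\<alpha> - 1)) (\<lambda>s. f s * \<theta> s) t + Gamma \<alpha> * conv (rl_ker \<alpha>) (\<lambda>s. deriv f s * \<theta> s) t"
    unfolding eq set_integral_add(2)[OF i1 i2] by (simp only: conv_def set_integral_mult_right)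
  finally have "J = Gamma \<alpha> * (conv (rl_ker (\<alpha> - 1)) (\<lambda>s. f s * \<theta> s) t - conv (rl_ker \<alpha>) (\<lambda>s. deriv f s * \<theta> s) t)"
    by (simp add: algebra_simps)
  then show ?thesis using Ga(1) by simp
qed

subsection \<open>Stability\<close>

lemma Lp_fun_1:
  assumes "Lp_fun 1 g"
  shows "set_borel_measurable borel {0..} g" "set_integrable lborel {0..} g"
proof -
  have m: "set_borel_measurable lborel {0..} g" and i: "set_integrable lborel {0..} (\<lambda>s. \<bar>g s\<bar>)"
    using assms by (auto simp: Lp_fun_def)
  show "set_borel_measurable borel {0..} g" using m by (simp add: set_borel_measurable_def)
  show "set_integrable lborel {0..} g" using i set_integrable_abs_iff[OF m] by simp
qed

lemma Lp_norm_nonneg: "0 \<le> Lp_norm p g"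
  by (simp add: Lp_norm_def)

lemma Lp_norm_le:
  assumes "0 < p" "Lp_norm p g \<le> \<delta>"
  shows "(LBINT s:{0..}. \<bar>g s\<bar> powr p) \<le> \<delta> powr p"
proof -
  define I where "I = (LBINT s:{0..}. \<bar>g s\<bar> powr p)"
  have "0 \<le> I" unfolding I_def set_lebesgue_integral_def by (rule Bochner_Integration.integral_nonneg) auto
  then have "I = (I powr (1 / p)) powr p" using assms(1) by (simp add: powr_powr)
  also have "\<dots> \<le> \<delta> powr p"
    using assms by (intro powr_mono2) (auto simp: Lp_norm_def I_def)
  finally show ?thesis by (simp add: I_def)
qed

lemma Lp_norm_1_le:
  assumes "Lp_norm 1 g \<le> \<delta>"
  shows "(LBINT s:{0..}. \<bar>g s\<bar>) \<le> \<delta>"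
  using Lp_norm_le[of 1 g \<delta>] assms Lp_norm_nonneg[of 1 g] by simp

lemma deriv_eq_within_half_line:
  assumes "(\<xi> has_real_derivative D) (at t within {0..})" "0 < t"
  shows "deriv \<xi> t = D"
proof -
  have "at t within {0..} = at t" using assms(2) by (intro at_within_interior) auto
  then show ?thesis using assms(1) DERIV_imp_deriv by auto
qed

text \<open>One constant for all pieces of the data, so that smallness in part (a) and mere
  finiteness in part (b) can be treated by the same estimates.\<close>

definition data_bound ::
  "real \<Rightarrow> real \<Rightarrow> real \<Rightarrow> real \<Rightarrow> (real \<Rightarrow> real) \<Rightarrow> (real \<Rightarrow> real) \<Rightarrow> (real \<Rightarrow> real) \<Rightarrow> (real \<Rightarrow> real) \<Rightarrow> (real \<Rightarrow> real) \<Rightarrow> bool" where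
  "data_bound \<upsilon> p0 p \<delta> \<xi>1 \<xi>2 g f \<theta> \<longleftrightarrow>
    (\<forall>t\<ge>0. \<bar>\<xi>1 t\<bar> \<le> \<delta>) \<and> \<bar>\<xi>2 0\<bar> \<le> \<delta> \<and> (\<forall>t>0. \<bar>deriv \<xi>2 t\<bar> \<le> \<delta> * t powr (\<upsilon> - 1)) \<and>
    Lp_norm 1 g \<le> \<delta> \<and> Lp_norm p0 g \<le> \<delta> \<and>
    Lp_norm 1 (\<lambda>s. f s * \<theta> s) \<le> \<delta> \<and> Lp_norm p (\<lambda>s. f s * \<theta> s) \<le> \<delta> \<and> Lp_norm 1 (\<lambda>s. deriv f s * \<theta> s) \<le> \<delta>"

context fractional_resolvent
begin

definition forcing :: "real \<Rightarrow> (real \<Rightarrow> real) \<Rightarrow> (real \<Rightarrow> real) \<Rightarrow> real \<Rightarrow> real" where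
  "forcing \<alpha> f \<theta> t = conv (rl_ker (\<alpha> - 1)) (\<lambda>s. f s * \<theta> s) t - conv (rl_ker \<alpha>) (\<lambda>s. deriv f s * \<theta> s) t"

text \<open>The kernel of order 1 + \<upsilon> in \<open>perturb_E2\<close> has no singularity, so
  it is bounded by 2 C; it decays because 1 + \<upsilon> < 1 + \<beta>.\<close>

lemma perturb_in_E2:
  assumes \<upsilon>: "0 < \<upsilon>" "\<upsilon> < \<beta>"
  shows "\<exists>K>0. \<forall>\<xi> \<delta>. in_E2 \<beta> \<upsilon> \<xi> \<longrightarrow> 0 < \<delta> \<longrightarrow> \<bar>\<xi> 0\<bar> \<le> \<delta> \<longrightarrow> (\<forall>t>0. \<bar>deriv \<xi> t\<bar> \<le> \<delta> * t powr (\<upsilon> - 1)) \<longrightarrow>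
    tame (K * \<delta>) \<xi>"
proof -
  obtain C where C: "0 < C" "\<And>t. 0 < t \<Longrightarrow> \<bar>ker (1 + \<upsilon>) t\<bar> \<le> C * weight (1 + \<upsilon>) t"
    using ker_bound[of "1 + \<upsilon>"] \<upsilon> by (auto simp: weight_def)
  have kb: "ker (1 + \<upsilon>) t \<le> 2 * C" if "0 \<le> t" for t
  proof (cases "t = 0")
    case False
    have "t powr \<upsilon> \<le> 1" if "t \<le> 1" using powr_mono2[of \<upsilon> t 1] that \<open>0 \<le> t\<close> \<upsilon> by simp
    then have "weight (1 + \<upsilon>) t \<le> 2" by (auto simp: weight_def)
    then have "C * weight (1 + \<upsilon>) t \<le> C * 2" using C by (intro mult_left_mono) auto
    then show ?thesis using C(2)[of t] False that by simp
  qed (use C in simp)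
  have G: "0 < Gamma \<upsilon>" using \<upsilon> by (auto intro: Gamma_real_pos)
  define K where "K = 1 + Gamma \<upsilon> * (2 * C)"
  show ?thesis
    unfolding tame_def
  proof (intro exI[of _ K] conjI allI impI)
    show "0 < K" using G C by (simp add: K_def add_pos_pos)
    fix \<xi> :: "real \<Rightarrow> real" and \<delta> :: real
    assume E2: "in_E2 \<beta> \<upsilon> \<xi>" and \<delta>: "0 < \<delta>" "\<bar>\<xi> 0\<bar> \<le> \<delta>" and d: "\<forall>t>0. \<bar>deriv \<xi> t\<bar> \<le> \<delta> * t powr (\<upsilon> - 1)"
    obtain \<xi>' where \<xi>': "continuous_on {0..} \<xi>'" "\<And>t. 0 \<le> t \<Longrightarrow> (\<xi> has_real_derivative \<xi>' t) (at t within {0..})"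
      using E2 by (auto simp: in_E2_def)
    have "deriv \<xi> t = \<xi>' t" if "0 < t" for t
      using deriv_eq_within_half_line[OF \<xi>'(2) that] that by simp
    then have d': "\<bar>\<xi>' t\<bar> \<le> \<delta> * t powr (\<upsilon> - 1)" if "0 < t" for t using d that by auto
    note * = perturb_E2[OF \<upsilon> \<xi>' less_imp_le[OF \<delta>(1)] d']
    fix t :: real
    {
      assume t: "0 \<le> t"
      show "conv_exists (ker \<beta>) \<xi> t" by (rule *(1)[OF _ _ t])
      have "\<bar>perturb \<xi> t\<bar> \<le> \<bar>\<xi> 0\<bar> * surv t + \<delta> * Gamma \<upsilon> * ker (1 + \<upsilon>) t" by (rule *(2)[OF _ _ t])
      also have "\<dots> \<le> \<delta> * 1 + \<delta> * Gamma \<upsilon> * (2 * C)"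
        using surv_le_1[OF t] surv_nonneg[OF t] kb[OF t] \<delta> G by (intro add_mono mult_mono mult_left_mono) auto
      also have "\<dots> = K * \<delta>" by (simp add: K_def algebra_simps)
      finally show "\<bar>perturb \<xi> t\<bar> \<le> K * \<delta>" .
    }
    show "(perturb \<xi> \<longlongrightarrow> 0) at_top"
    proof (rule Lim_null_comparison)
      show "\<forall>\<^sub>F t in at_top. norm (perturb \<xi> t) \<le> \<bar>\<xi> 0\<bar> * surv t + \<delta> * Gamma \<upsilon> * ker (1 + \<upsilon>) t"
        using eventually_ge_at_top[of 0] by eventually_elim (simp, rule *(2))
      have "((\<lambda>t. \<bar>\<xi> 0\<bar> * surv t + \<delta> * Gamma \<upsilon> * ker (1 + \<upsilon>) t) \<longlongrightarrow> \<bar>\<xi> 0\<bar> * 0 + \<delta> * Gamma \<upsilon> * 0) at_top"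
        using \<upsilon> by (intro tendsto_intros surv_tendsto_0 ker_tendsto_0) auto
      then show "((\<lambda>t. \<bar>\<xi> 0\<bar> * surv t + \<delta> * Gamma \<upsilon> * ker (1 + \<upsilon>) t) \<longlongrightarrow> 0) at_top" by simp
    qed
  qed
qed

lemma perturb_Lp:
  assumes \<eta>: "0 < \<eta>" "\<eta> < 1 + \<beta>" and p: "1 < p" "1 < p * \<eta>"
  shows "\<exists>K>0. \<forall>g \<delta>. Lp_fun 1 g \<longrightarrow> Lp_fun p g \<longrightarrow> 0 < \<delta> \<longrightarrow> Lp_norm 1 g \<le> \<delta> \<longrightarrow> Lp_norm p g \<le> \<delta> \<longrightarrow>
    tame (K * \<delta>) (conv (rl_ker \<eta>) g)"
proof -
  let ?K1 = "Lp_const p \<eta>"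
  obtain K2 where K2: "0 < K2" "\<And>g B. controlled \<eta> g B \<Longrightarrow>
    tame (K2 * B) (conv (rl_ker \<eta>) g)"
    using perturb_controlled[OF \<eta>] by blast
  show ?thesis
    unfolding tame_def
  proof (intro exI[of _ "K2 * ?K1"] conjI allI impI)
    show "0 < K2 * ?K1" using Lp_const_pos(2)[OF p] K2 by simp
  next
    fix g \<delta>
    assume g: "Lp_fun 1 g" "Lp_fun p g" and \<delta>: "0 < \<delta>" "Lp_norm 1 g \<le> \<delta>" "Lp_norm p g \<le> \<delta>"
    have "controlled \<eta> g (?K1 * \<delta>)"
      using g(2) p by (intro controlled_Lp[OF p] Lp_fun_1[OF g(1)] \<delta>(1) Lp_norm_1_le \<delta> Lp_norm_le) (auto simp: Lp_fun_def)
    note * = K2(2)[OF this, unfolded tame_def]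
    show "(perturb (conv (rl_ker \<eta>) g) \<longlongrightarrow> 0) at_top" using * by blast
    fix t :: real assume "0 \<le> t"
    then show "conv_exists (ker \<beta>) (conv (rl_ker \<eta>) g) t" "\<bar>perturb (conv (rl_ker \<eta>) g) t\<bar> \<le> K2 * ?K1 * \<delta>"
      using * by (auto simp: mult.assoc)
  qed
qed

lemma perturb_L1:
  assumes \<eta>: "1 \<le> \<eta>" "\<eta> < 1 + \<beta>"
  shows "\<exists>K>0. \<forall>g \<delta>. Lp_fun 1 g \<longrightarrow> 0 < \<delta> \<longrightarrow> Lp_norm 1 g \<le> \<delta> \<longrightarrow>
    tame (K * \<delta>) (conv (rl_ker \<eta>) g)"
proof -
  obtain K2 where K2: "0 < K2" "\<And>g B. controlled \<eta> g B \<Longrightarrow>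
    tame (K2 * B) (conv (rl_ker \<eta>) g)"
    using perturb_controlled[of \<eta>] \<eta> by auto
  show ?thesis
    unfolding tame_def
  proof (intro exI[of _ "K2 * 2"] conjI allI impI)
    show "0 < K2 * 2" using K2 by simp
  next
    fix g \<delta>
    assume g: "Lp_fun 1 g" and \<delta>: "0 < \<delta>" "Lp_norm 1 g \<le> \<delta>"
    note * = K2(2)[OF controlled_L1[OF \<eta>(1) Lp_fun_1[OF g]], unfolded tame_def]
    show "(perturb (conv (rl_ker \<eta>) g) \<longlongrightarrow> 0) at_top" using * by blast
    fix t :: real assume t: "0 \<le> t"
    show "conv_exists (ker \<beta>) (conv (rl_ker \<eta>) g) t" using * t by blast
    have "\<bar>perturb (conv (rl_ker \<eta>) g) t\<bar> \<le> K2 * (2 * (LBINT s:{0..}. \<bar>g s\<bar>))" using * t by blast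
    also have "\<dots> \<le> K2 * (2 * \<delta>)" using Lp_norm_1_le[OF \<delta>(2)] K2 by (intro mult_left_mono) auto
    finally show "\<bar>perturb (conv (rl_ker \<eta>) g) t\<bar> \<le> K2 * 2 * \<delta>" by (simp add: mult.assoc)
  qed
qed

text \<open>The forcing consists of f \<theta> against order \<alpha> - 1 < 1, where the L^p norm is
  used, and f' \<theta> against order \<alpha> \<ge> 1, where the L^1 norm is enough.\<close>

lemma perturb_data:
  assumes \<alpha>: "1 < \<alpha>" "\<alpha> < 2" "\<alpha> < \<beta> + 1" and p: "p > 1 / (\<alpha> - 1)"
    and \<upsilon>: "0 < \<upsilon>" "\<upsilon> < \<beta>" and \<eta>: "0 < \<eta>" "\<eta> < \<beta> + 1" and p0: "p0 > max (1 / \<eta>) 1"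
  shows "\<exists>K>0. \<forall>\<xi> \<xi>1 \<xi>2 \<xi>3 g f \<theta> \<delta>.
    E_decomposition \<beta> \<upsilon> \<eta> p0 \<xi> \<xi>1 \<xi>2 \<xi>3 g \<longrightarrow> integrable_forcing p f \<theta> \<longrightarrow> 0 < \<delta> \<longrightarrow>
    data_bound \<upsilon> p0 p \<delta> \<xi>1 \<xi>2 g f \<theta> \<longrightarrow>
    (\<forall>t\<ge>0. \<bar>perturb (\<lambda>t. \<xi> t + forcing \<alpha> f \<theta> t) t\<bar> \<le> K * \<delta>) \<and>
    (perturb (\<lambda>t. \<xi> t + forcing \<alpha> f \<theta> t) \<longlongrightarrow> 0) at_top"
proof -
  obtain K2 where K2: "0 < K2" "\<And>\<xi> \<delta>. in_E2 \<beta> \<upsilon> \<xi> \<Longrightarrow> 0 < \<delta> \<Longrightarrow> \<bar>\<xi> 0\<bar> \<le> \<delta> \<Longrightarrow> (\<forall>t>0. \<bar>deriv \<xi> t\<bar> \<le> \<delta> * t powr (\<upsilon> - 1)) \<Longrightarrow>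
    tame (K2 * \<delta>) \<xi>"
    using perturb_in_E2[OF \<upsilon>] by blast
  have p0': "1 < p0" "1 < p0 * \<eta>" using p0 \<eta> by (auto simp: field_simps)
  have "1 < 1 / (\<alpha> - 1)" using \<alpha> by simp
  with p have p': "1 < p" by linarith
  have p'': "1 < p * (\<alpha> - 1)" using p \<alpha> by (simp add: field_simps)
  obtain K3 where K3: "0 < K3" "\<And>g \<delta>. Lp_fun 1 g \<Longrightarrow> Lp_fun p0 g \<Longrightarrow> 0 < \<delta> \<Longrightarrow> Lp_norm 1 g \<le> \<delta> \<Longrightarrow> Lp_norm p0 g \<le> \<delta> \<Longrightarrow>
    tame (K3 * \<delta>) (conv (rl_ker \<eta>) g)"
    using perturb_Lp[of \<eta> p0] \<eta> p0' by (auto simp: add.commute)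
  obtain K4 where K4: "0 < K4" "\<And>g \<delta>. Lp_fun 1 g \<Longrightarrow> Lp_fun p g \<Longrightarrow> 0 < \<delta> \<Longrightarrow> Lp_norm 1 g \<le> \<delta> \<Longrightarrow> Lp_norm p g \<le> \<delta> \<Longrightarrow>
    tame (K4 * \<delta>) (conv (rl_ker (\<alpha> - 1)) g)"
    using perturb_Lp[of "\<alpha> - 1" p] \<alpha> p' p'' by auto
  obtain K5 where K5: "0 < K5" "\<And>g \<delta>. Lp_fun 1 g \<Longrightarrow> 0 < \<delta> \<Longrightarrow> Lp_norm 1 g \<le> \<delta> \<Longrightarrow>
    tame (K5 * \<delta>) (conv (rl_ker \<alpha>) g)"
    using perturb_L1[of \<alpha>] \<alpha> by (auto simp: add.commute)
  \<comment> \<open>The 2 is the constant of \<open>perturb_E1\<close>.\<close>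
  define K where "K = 2 + K2 + K3 + K4 + K5"
  have "(\<forall>t\<ge>0. \<bar>perturb (\<lambda>t. \<xi> t + forcing \<alpha> f \<theta> t) t\<bar> \<le> K * \<delta>) \<and>
    (perturb (\<lambda>t. \<xi> t + forcing \<alpha> f \<theta> t) \<longlongrightarrow> 0) at_top"
    if E: "E_decomposition \<beta> \<upsilon> \<eta> p0 \<xi> \<xi>1 \<xi>2 \<xi>3 g" and F: "integrable_forcing p f \<theta>" and \<delta>: "0 < \<delta>"
    and db: "data_bound \<upsilon> p0 p \<delta> \<xi>1 \<xi>2 g f \<theta>"
    for \<xi> \<xi>1 \<xi>2 \<xi>3 g f \<theta> \<delta>
  proof -
    have n1: "\<forall>t\<ge>0. \<bar>\<xi>1 t\<bar> \<le> \<delta>" and n2: "\<bar>\<xi>2 0\<bar> \<le> \<delta>" "\<forall>t>0. \<bar>deriv \<xi>2 t\<bar> \<le> \<delta> * t powr (\<upsilon> - 1)"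
    and n3: "Lp_norm 1 g \<le> \<delta>" "Lp_norm p0 g \<le> \<delta>"
    and n4: "Lp_norm 1 (\<lambda>s. f s * \<theta> s) \<le> \<delta>" "Lp_norm p (\<lambda>s. f s * \<theta> s) \<le> \<delta>"
    and n5: "Lp_norm 1 (\<lambda>s. deriv f s * \<theta> s) \<le> \<delta>"
      using db by (auto simp: data_bound_def)
    obtain L where E1: "continuous_on {0..} \<xi>1" "(\<xi>1 \<longlongrightarrow> L) at_top" using E by (auto simp: E_decomposition_def in_E1_def)
    define z3 where "z3 = conv (rl_ker \<eta>) g"
    define z4 where "z4 = conv (rl_ker (\<alpha> - 1)) (\<lambda>s. f s * \<theta> s)"
    define z5 where "z5 = conv (rl_ker \<alpha>) (\<lambda>s. deriv f s * \<theta> s)"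
    note P1 = perturb_E1[OF E1, of \<delta>]
    have P2: "tame (K2 * \<delta>) \<xi>2"
      by (rule K2(2)[OF _ \<delta> n2]) (use E in \<open>auto simp: E_decomposition_def\<close>)
    have P3: "tame (K3 * \<delta>) z3"
      unfolding z3_def by (rule K3(2)[OF _ _ \<delta> n3]) (use E in \<open>auto simp: E_decomposition_def E3_density_def\<close>)
    have P4: "tame (K4 * \<delta>) z4"
      unfolding z4_def by (rule K4(2)[OF _ _ \<delta> n4]) (use F in \<open>auto simp: integrable_forcing_def\<close>)
    have P5: "tame (K5 * \<delta>) z5"
      unfolding z5_def by (rule K5(2)[OF _ \<delta> n5]) (use F in \<open>auto simp: integrable_forcing_def\<close>)
    note P = P2[unfolded tame_def] P3[unfolded tame_def] P4[unfolded tame_def] P5[unfolded tame_def]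
    have eq: "perturb (\<lambda>t. \<xi> t + forcing \<alpha> f \<theta> t) t = perturb \<xi>1 t + perturb \<xi>2 t + perturb z3 t + (perturb z4 t - perturb z5 t)"
      if t: "0 \<le> t" for t
    proof -
      have i: "conv_exists (ker \<beta>) \<xi>1 t" "conv_exists (ker \<beta>) \<xi>2 t" "conv_exists (ker \<beta>) z3 t"
        "conv_exists (ker \<beta>) z4 t" "conv_exists (ker \<beta>) z5 t"
        using P1(1) P n1 t by auto
      note i12 = conv_add(1)[OF i(1,2)]
      note i123 = conv_add(1)[OF i12 i(3)]
      note i45 = conv_diff(1)[OF i(4,5)]
      have "perturb (\<lambda>t. \<xi> t + forcing \<alpha> f \<theta> t) t = perturb (\<lambda>t. (\<xi>1 t + \<xi>2 t + z3 t) + (z4 t - z5 t)) t"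
        by (rule perturb_cong[OF t]) (use E in \<open>auto simp: E_decomposition_def E3_density_def forcing_def
          z3_def z4_def z5_def conv_def rl_ker_def\<close>)
      also have "\<dots> = perturb \<xi>1 t + perturb \<xi>2 t + perturb z3 t + (perturb z4 t - perturb z5 t)"
        unfolding perturb_add[OF i123 i45] perturb_add[OF i12 i(3)] perturb_add[OF i(1,2)] perturb_diff[OF i(4,5)] ..
      finally show ?thesis .
    qed
    have bd: "\<bar>perturb (\<lambda>t. \<xi> t + forcing \<alpha> f \<theta> t) t\<bar> \<le> K * \<delta>" if t: "0 \<le> t" for t
    proof -
      have "\<bar>perturb \<xi>1 t\<bar> \<le> 2 * \<delta>" by (rule P1(2)[OF _ t]) (use n1 in auto)
      moreover have "\<bar>perturb \<xi>2 t\<bar> \<le> K2 * \<delta>" "\<bar>perturb z3 t\<bar> \<le> K3 * \<delta>" "\<bar>perturb z4 t\<bar> \<le> K4 * \<delta>" "\<bar>perturb z5 t\<bar> \<le> K5 * \<delta>"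
        using P t by auto
      ultimately have "\<bar>perturb (\<lambda>t. \<xi> t + forcing \<alpha> f \<theta> t) t\<bar> \<le> 2 * \<delta> + K2 * \<delta> + K3 * \<delta> + K4 * \<delta> + K5 * \<delta>"
        unfolding eq[OF t] by linarith
      then show ?thesis by (simp add: K_def algebra_simps)
    qed
    have "((\<lambda>t. perturb \<xi>1 t + perturb \<xi>2 t + perturb z3 t + (perturb z4 t - perturb z5 t)) \<longlongrightarrow> 0 + 0 + 0 + (0 - 0)) at_top"
      using P by (intro tendsto_intros P1(3)) (use n1 in auto)
    moreover have "\<forall>\<^sub>F t in at_top. perturb (\<lambda>t. \<xi> t + forcing \<alpha> f \<theta> t) t =
        perturb \<xi>1 t + perturb \<xi>2 t + perturb z3 t + (perturb z4 t - perturb z5 t)"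
      using eventually_ge_at_top[of 0] by eventually_elim (rule eq)
    ultimately have "(perturb (\<lambda>t. \<xi> t + forcing \<alpha> f \<theta> t) \<longlongrightarrow> 0) at_top"
      by (subst tendsto_cong) auto
    with bd show ?thesis by blast
  qed
  moreover have "0 < K" using K2 K3 K4 K5 by (simp add: K_def)
  ultimately show ?thesis by (intro exI[of _ K]) blast
qed

lemma solution_eq:
  assumes sol: "is_solution \<beta> (- \<mu>) \<alpha> h \<xi> f \<theta> X" and adm: "admissible \<gamma> \<tau> f \<theta>" and F: "integrable_forcing p f \<theta>"
    and \<alpha>: "1 < \<alpha>" "0 < \<gamma>" "0 < \<tau>" and s: "0 \<le> s"
  shows "X s = (\<xi> s + forcing \<alpha> f \<theta> s) + conv (rl_ker \<beta>) (\<lambda>r. - \<mu> * X r + h (X r)) s"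
proof -
  obtain J where J: "has_young_integral (\<lambda>r. (s - r) powr (\<alpha> - 1) * f r) \<theta> 0 s J"
    and eq: "X s = \<xi> s + 1 / Gamma \<beta> * (LBINT r:{0..s}. (s - r) powr (\<beta> - 1) * (- \<mu> * X r + h (X r))) + 1 / Gamma \<alpha> * J"
    using sol s unfolding is_solution_def by blast
  have "1 / Gamma \<alpha> * J = forcing \<alpha> f \<theta> s"
    unfolding forcing_def
  proof (rule young_forcing_eq[OF \<alpha>(1) s J])
    show "continuous_on {0..} f" "continuous_on {0..} \<theta>"
      using adm \<alpha> by (auto simp: admissible_def intro: locally_hoelder_continuous)
    have "Lp_fun 1 (\<lambda>s. deriv f s * \<theta> s)" using F by (simp add: integrable_forcing_def)
    then show "set_borel_measurable borel {0..} (\<lambda>s. deriv f s * \<theta> s)" "set_integrable lborel {0..} (\<lambda>s. deriv f s * \<theta> s)"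
      by (rule Lp_fun_1)+
  qed (use adm in \<open>auto simp: admissible_def\<close>)
  moreover have "1 / Gamma \<beta> * (LBINT r:{0..s}. (s - r) powr (\<beta> - 1) * (- \<mu> * X r + h (X r))) =
      conv (rl_ker \<beta>) (\<lambda>r. - \<mu> * X r + h (X r)) s"
    by (simp add: conv_def rl_ker_def)
  ultimately show ?thesis using eq by simp
qed

section \<open>A priori bound, decay and smallness of solutions\<close>

context
  fixes X u h :: "real \<Rightarrow> real" and C :: real
  assumes X: "continuous_on {0..} X" and h: "h \<in> borel_measurable borel"
    and C: "0 \<le> C" "C < \<mu>"
    and eq: "\<forall>s\<ge>0. X s = u s + conv (rl_ker \<beta>) (\<lambda>r. - \<mu> * X r + h (X r)) s"
begin

lemma comp_measurable: "set_borel_measurable borel {0..t} (\<lambda>s. h (X s))"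
proof -
  \<comment> \<open>Nothing is known about \<open>X\<close> on the negative axis; constant extension
    from 0 gives a Borel function on the whole line.\<close>
  have "continuous_on UNIV (\<lambda>s. X (max 0 s))"
    by (rule continuous_on_compose2[OF X]) (auto intro!: continuous_intros)
  then have [measurable]: "(\<lambda>s. X (max 0 s)) \<in> borel_measurable borel" by (rule borel_measurable_continuous_onI)
  note h[measurable]
  have "(\<lambda>s. indicator {0..t} s *\<^sub>R h (X (max 0 s))) \<in> borel_measurable borel" by measurable
  also have "(\<lambda>s. indicator {0..t} s *\<^sub>R h (X (max 0 s))) = (\<lambda>s. indicator {0..t} s *\<^sub>R h (X s))"
    by (auto simp: fun_eq_iff indicator_def max_def)
  finally show ?thesis by (simp add: set_borel_measurable_def)
qed

lemma solution_variation_of_constants: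
  assumes T: "0 \<le> T" and hX: "\<And>s. 0 \<le> s \<Longrightarrow> s \<le> T \<Longrightarrow> \<bar>h (X s)\<bar> \<le> C * \<bar>X s\<bar>"
  shows "X T = perturb u T + conv (ker \<beta>) (\<lambda>s. h (X s)) T"
proof -
  have c: "continuous_on {0..T} X" by (rule continuous_on_subset[OF X]) auto
  then have "bounded (X ` {0..T})" by (intro compact_imp_bounded compact_continuous_image) auto
  then obtain B where "\<forall>s\<in>{0..T}. \<bar>X s\<bar> \<le> B" by (auto simp: bounded_iff)
  then have B: "\<bar>X s\<bar> \<le> B" if "0 \<le> s" "s \<le> T" for s using that by auto
  have "\<bar>h (X s)\<bar> \<le> C * B" if "0 \<le> s" "s \<le> T" for s
    using hX[OF that] mult_left_mono[OF B[OF that] C(1)] by linarith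
  then show ?thesis
    by (intro variation_of_constants[OF T continuous_on_set_borel_measurable[OF c] B comp_measurable, where B'="C * B"] eq[rule_format]) auto
qed

text \<open>At a maximum point S of \<bar>X\<bar> on [0, T], the nonlinear term is at most C / \<mu>
  times \<bar>X(S)\<bar>, because R has mass at most 1; it can then be absorbed on the left.\<close>

lemma solution_bound:
  assumes T: "0 \<le> T" and hX: "\<And>s. 0 \<le> s \<Longrightarrow> s \<le> T \<Longrightarrow> \<bar>h (X s)\<bar> \<le> C * \<bar>X s\<bar>"
    and y: "\<And>s. 0 \<le> s \<Longrightarrow> s \<le> T \<Longrightarrow> \<bar>perturb u s\<bar> \<le> y"
  shows "\<bar>X T\<bar> \<le> y / (1 - C / \<mu>)"
proof -
  have "continuous_on {0..T} (\<lambda>s. \<bar>X s\<bar>)"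
    by (intro continuous_intros continuous_on_subset[OF X]) auto
  then obtain S where S: "S \<in> {0..T}" "\<And>s. s \<in> {0..T} \<Longrightarrow> \<bar>X s\<bar> \<le> \<bar>X S\<bar>"
    using continuous_attains_sup[of "{0..T}" "\<lambda>s. \<bar>X s\<bar>"] T by auto
  have "\<bar>\<mu> * conv (ker \<beta>) (\<lambda>s. h (X s)) S\<bar> \<le> C * \<bar>X S\<bar>"
  proof (rule resolvent_average_le[OF _ comp_measurable])
    show "\<bar>h (X s)\<bar> \<le> C * \<bar>X S\<bar>" if "0 \<le> s" "s \<le> S" for s
      using hX[of s] S(2)[of s] S(1) that C(1) by (auto intro: order_trans mult_left_mono)
  qed (use S C in auto)
  then have "\<bar>conv (ker \<beta>) (\<lambda>s. h (X s)) S\<bar> \<le> C / \<mu> * \<bar>X S\<bar>"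
    using lam by (simp add: abs_mult field_simps)
  moreover have "X S = perturb u S + conv (ker \<beta>) (\<lambda>s. h (X s)) S"
    by (rule solution_variation_of_constants) (use S hX in auto)
  moreover have "\<bar>perturb u S\<bar> \<le> y" using y S by auto
  ultimately have "(1 - C / \<mu>) * \<bar>X S\<bar> \<le> y" by (simp add: left_diff_distrib)
  moreover have "0 < 1 - C / \<mu>" using C lam by simp
  ultimately have "\<bar>X S\<bar> \<le> y / (1 - C / \<mu>)" by (simp add: pos_le_divide_eq mult.commute)
  then show ?thesis using S(2)[of T] T by auto
qed

text \<open>An eventual bound \<open>m\<close> for \<bar>X\<bar> improves itself to
  \<open>r * m\<close> with a fixed r < 1, since the average forgets the times before
  \<open>m\<close> was valid; iteration gives the limit.\<close>

lemma solution_tendsto_0: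
  assumes hX: "\<And>s. 0 \<le> s \<Longrightarrow> \<bar>h (X s)\<bar> \<le> C * \<bar>X s\<bar>"
    and y: "\<And>s. 0 \<le> s \<Longrightarrow> \<bar>perturb u s\<bar> \<le> y" and Y: "(perturb u \<longlongrightarrow> 0) at_top"
  shows "(X \<longlongrightarrow> 0) at_top"
proof -
  define q where "q = C / \<mu>"
  have q: "0 \<le> q" "q < 1" using C lam by (auto simp: q_def)
  define r where "r = (1 + q) / 2"
  have r: "0 < r" "r < 1" using q by (auto simp: r_def)
  \<comment> \<open>The \<open>+ 1\<close> makes the starting bound strictly positive even for y =
    0, as the improvement step requires.\<close>
  define B where "B = y / (1 - q) + 1"
  have XB: "\<bar>X t\<bar> \<le> B" if "0 \<le> t" for t
    using solution_bound[OF that hX y] by (simp add: B_def q_def)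
  have y0: "0 \<le> y" using y[of 0] by simp
  have B: "0 < B" using y0 q by (simp add: B_def add_nonneg_pos)
  have hB: "\<bar>h (X t)\<bar> \<le> C * B" if "0 \<le> t" for t
    using hX[OF that] mult_left_mono[OF XB[OF that] C(1)] by linarith
  have step: "\<forall>\<^sub>F t in at_top. \<bar>X t\<bar> \<le> r * m" if m: "0 < m" "\<forall>\<^sub>F t in at_top. \<bar>X t\<bar> \<le> m" for m
  proof -
    \<comment> \<open>Two errors of this size, from \<open>perturb u\<close> and from the distant
      past, fill the gap (r - q) m = (1 - q) m / 2.\<close>
    define e where "e = (1 - q) * m / 4"
    have e: "0 < e" using q m by (simp add: e_def)
    have "\<forall>\<^sub>F t in at_top. \<bar>h (X t)\<bar> \<le> C * m"
      using m(2) eventually_ge_at_top[of 0]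
    proof eventually_elim
      case (elim t)
      then show ?case using hX[of t] mult_left_mono[OF elim(1) C(1)] by linarith
    qed
    then have 1: "\<forall>\<^sub>F t in at_top. \<bar>\<mu> * conv (ker \<beta>) (\<lambda>s. h (X s)) t\<bar> \<le> C * m + \<mu> * e"
      by (intro resolvent_average_eventually_le[OF comp_measurable hB]) (use C m e lam in auto)
    have 2: "\<forall>\<^sub>F t in at_top. \<bar>perturb u t\<bar> < e"
      using tendsto_rabs_zero[OF Y] by (rule order_tendstoD(2)) (rule e)
    show ?thesis
      using 1 2 eventually_ge_at_top[of 0]
    proof eventually_elim
      case (elim t)
      have "\<mu> * \<bar>conv (ker \<beta>) (\<lambda>s. h (X s)) t\<bar> \<le> \<mu> * (q * m + e)"
        using elim(1) lam by (simp add: abs_mult q_def algebra_simps)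
      then have "\<bar>conv (ker \<beta>) (\<lambda>s. h (X s)) t\<bar> \<le> q * m + e" using lam by simp
      moreover have "X t = perturb u t + conv (ker \<beta>) (\<lambda>s. h (X s)) t"
        by (rule solution_variation_of_constants) (use elim hX in auto)
      moreover have "e + (q * m + e) = r * m" by (simp add: e_def r_def field_simps)
      ultimately show ?case using elim(2) by linarith
    qed
  qed
  have iter: "\<forall>\<^sub>F t in at_top. \<bar>X t\<bar> \<le> r ^ n * B" for n
  proof (induction n)
    case 0
    show ?case using eventually_ge_at_top[of 0] by eventually_elim (use XB in auto)
  next
    case (Suc n)
    then show ?case using step[of "r ^ n * B"] r B by (simp add: mult.assoc)
  qed
  show ?thesis
  proof (rule tendstoI)
    fix e :: real assume e: "0 < e"
    have "(\<lambda>n. r ^ n * B) \<longlonglongrightarrow> 0 * B" using r by (intro tendsto_mult LIMSEQ_realpow_zero) auto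
    then have "\<forall>\<^sub>F n in sequentially. r ^ n * B < e" using e by (intro order_tendstoD(2)) auto
    then obtain n where "r ^ n * B < e" by (auto simp: eventually_sequentially)
    then show "\<forall>\<^sub>F t in at_top. dist (X t) 0 < e"
      using iter[of n] by (auto elim!: eventually_mono)
  qed
qed

text \<open>A continuation argument: at the first time at which \<open>|X|\<close> reaches \<open>e\<close>, the a priori
  bound forces \<open>|X| < e\<close>.\<close>

lemma solution_small:
  assumes hX: "\<And>x. \<bar>x\<bar> \<le> e \<Longrightarrow> \<bar>h x\<bar> \<le> C * \<bar>x\<bar>"
    and y: "\<And>s. 0 \<le> s \<Longrightarrow> \<bar>perturb u s\<bar> \<le> y" and ye: "y / (1 - C / \<mu>) < e" and t: "0 \<le> t"
  shows "\<bar>X t\<bar> < e"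
proof (rule ccontr)
  assume "\<not> \<bar>X t\<bar> < e"
  have q: "0 < 1 - C / \<mu>" "1 - C / \<mu> \<le> 1" using C lam by auto
  have y0: "0 \<le> y" using y[of 0] by simp
  have "y * (1 - C / \<mu>) \<le> y" using y0 q by (intro mult_left_le) auto
  then have "y \<le> y / (1 - C / \<mu>)" using q by (simp add: pos_le_divide_eq)
  \<comment> \<open>Both convolutions vanish at 0, so the initial value is controlled by the data
    alone.\<close>
  moreover have "X 0 = perturb u 0"
    using eq[rule_format, of 0] by (simp add: perturb_def conv_at_0)
  ultimately have X0: "\<bar>X 0\<bar> < e" using y[of 0] ye by simp
  define S where "S = {s \<in> {0..t}. e \<le> \<bar>X s\<bar>}"
  have c: "continuous_on {0..T} (\<lambda>s. \<bar>X s\<bar>)" for T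
    by (intro continuous_intros continuous_on_subset[OF X]) auto
  have "S = {0..t} \<inter> (\<lambda>s. \<bar>X s\<bar>) -` {e..}" by (auto simp: S_def)
  then have "closed S" by (simp add: continuous_closed_preimage[OF c])
  have "t \<in> S" using t \<open>\<not> \<bar>X t\<bar> < e\<close> by (simp add: S_def)
  define T where "T = Inf S"
  have bdd: "bdd_below S" by (auto simp: S_def intro!: bdd_belowI[of _ 0])
  have T: "T \<in> S" unfolding T_def using \<open>t \<in> S\<close> bdd \<open>closed S\<close> by (intro closed_contains_Inf) auto
  have least: "T \<le> s" if "s \<in> S" for s unfolding T_def using that bdd by (rule cInf_lower)
  have "0 \<le> T" using T by (simp add: S_def)
  \<comment> \<open>By the intermediate value theorem the level is met exactly at the first time, so
    up to and including \<open>T\<close> the values of \<open>X\<close> stay where the bound on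
    \<open>h\<close> is assumed.\<close>
  have XT: "\<bar>X T\<bar> = e"
  proof -
    have "\<exists>s\<ge>0. s \<le> T \<and> \<bar>X s\<bar> = e"
      by (rule IVT'[of "\<lambda>s. \<bar>X s\<bar>" 0 e T]) (use X0 T c in \<open>auto simp: S_def\<close>)
    then obtain s where s: "0 \<le> s" "s \<le> T" "\<bar>X s\<bar> = e" by auto
    then have "s \<in> S" using T by (auto simp: S_def)
    with least s show ?thesis by force
  qed
  have le: "\<bar>X s\<bar> \<le> e" if "0 \<le> s" "s \<le> T" for s
    using least[of s] that T XT by (cases "s = T") (force simp: S_def)+
  have "\<bar>X T\<bar> \<le> y / (1 - C / \<mu>)"
    by (rule solution_bound[OF \<open>0 \<le> T\<close>]) (use le hX y in auto)
  with ye XT show False by simp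
qed

end

end

section \<open>From the norms to the data bounds, and the stability statements\<close>

lemma in_E1_bounded:
  assumes "in_E1 \<xi>"
  shows "\<exists>B. \<forall>t\<ge>0. \<bar>\<xi> t\<bar> \<le> B"
proof -
  obtain L where cont: "continuous_on {0..} \<xi>" and L: "(\<xi> \<longlongrightarrow> L) at_top" using assms by (auto simp: in_E1_def)
  have "\<forall>\<^sub>F t in at_top. \<bar>\<xi> t\<bar> < \<bar>L\<bar> + 1"
    using tendsto_rabs[OF L] by (rule order_tendstoD(2)) simp
  then obtain N where N: "\<And>t. N \<le> t \<Longrightarrow> \<bar>\<xi> t\<bar> < \<bar>L\<bar> + 1" by (auto simp: eventually_at_top_linorder)
  have "bounded (\<xi> ` {0..N})"
    by (intro compact_imp_bounded compact_continuous_image continuous_on_subset[OF cont]) auto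
  then obtain B where B: "\<forall>s\<in>{0..N}. \<bar>\<xi> s\<bar> \<le> B" by (auto simp: bounded_iff)
  have "\<bar>\<xi> t\<bar> \<le> max B (\<bar>L\<bar> + 1)" if "0 \<le> t" for t
    using B N[of t] that by (cases "t \<le> N") (auto simp: le_max_iff_disj)
  then show ?thesis by blast
qed

lemma data_bound_exists:
  assumes "E_decomposition \<beta> \<upsilon> \<eta> p0 \<xi> \<xi>1 \<xi>2 \<xi>3 g"
  shows "\<exists>\<delta>>0. data_bound \<upsilon> p0 p \<delta> \<xi>1 \<xi>2 g f \<theta>"
proof -
  have E: "in_E1 \<xi>1" "in_E2 \<beta> \<upsilon> \<xi>2" using assms by (auto simp: E_decomposition_def)
  obtain B where B: "\<forall>t\<ge>0. \<bar>\<xi>1 t\<bar> \<le> B" using in_E1_bounded[OF E(1)] by blast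
  obtain \<xi>' C where \<xi>': "\<And>t. 0 \<le> t \<Longrightarrow> (\<xi>2 has_real_derivative \<xi>' t) (at t within {0..})"
    and C: "\<And>t. 0 < t \<Longrightarrow> \<bar>\<xi>' t\<bar> \<le> C * t powr (\<upsilon> - 1)"
    using E(2) by (auto simp: in_E2_def)
  have d: "deriv \<xi>2 t = \<xi>' t" if "0 < t" for t
    using deriv_eq_within_half_line[OF \<xi>' that] that by simp
  define N where "N = Lp_norm 1 g + Lp_norm p0 g + Lp_norm 1 (\<lambda>s. f s * \<theta> s) + Lp_norm p (\<lambda>s. f s * \<theta> s) + Lp_norm 1 (\<lambda>s. deriv f s * \<theta> s)"
  define \<delta> where "\<delta> = 1 + \<bar>B\<bar> + \<bar>\<xi>2 0\<bar> + \<bar>C\<bar> + N"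
  note nn = Lp_norm_nonneg[of 1 g] Lp_norm_nonneg[of p0 g] Lp_norm_nonneg[of 1 "\<lambda>s. f s * \<theta> s"]
    Lp_norm_nonneg[of p "\<lambda>s. f s * \<theta> s"] Lp_norm_nonneg[of 1 "\<lambda>s. deriv f s * \<theta> s"]
  have le: "\<bar>B\<bar> \<le> \<delta>" "\<bar>\<xi>2 0\<bar> \<le> \<delta>" "\<bar>C\<bar> \<le> \<delta>" "0 < \<delta>" using nn by (auto simp: \<delta>_def N_def)
  have "\<bar>deriv \<xi>2 t\<bar> \<le> \<delta> * t powr (\<upsilon> - 1)" if "0 < t" for t
  proof -
    have "C * t powr (\<upsilon> - 1) \<le> \<delta> * t powr (\<upsilon> - 1)" using le by (intro mult_right_mono) auto
    then show ?thesis using C[OF that] d[OF that] by simp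
  qed
  moreover have "\<bar>\<xi>1 t\<bar> \<le> \<delta>" if "0 \<le> t" for t using B[rule_format, OF that] le(1) by linarith
  ultimately have "data_bound \<upsilon> p0 p \<delta> \<xi>1 \<xi>2 g f \<theta>"
    using nn le(2) unfolding data_bound_def \<delta>_def N_def by auto
  with le(4) show ?thesis by blast
qed

context fractional_resolvent
begin

lemma small_data_imp_data_bound:
  assumes "small_data \<beta> A \<upsilon> \<eta> p0 p \<delta> \<xi> f \<theta>"
  shows "integrable_forcing p f \<theta> \<and>
    (\<exists>\<xi>1 \<xi>2 \<xi>3 g. E_decomposition \<beta> \<upsilon> \<eta> p0 \<xi> \<xi>1 \<xi>2 \<xi>3 g \<and> data_bound \<upsilon> p0 p \<delta> \<xi>1 \<xi>2 g f \<theta>)"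
proof -
  obtain \<xi>1 \<xi>2 \<xi>3 g where E: "E_decomposition \<beta> \<upsilon> \<eta> p0 \<xi> \<xi>1 \<xi>2 \<xi>3 g" and F: "integrable_forcing p f \<theta>"
    and less: "(norm_X1 \<xi>1 + norm_X2 \<beta> A \<upsilon> \<xi>2 + norm_X3 p0 g)
          + ennreal (Lp_norm 1 (\<lambda>s. f s * \<theta> s) + Lp_norm p (\<lambda>s. f s * \<theta> s)
              + Lp_norm 1 (\<lambda>s. deriv f s * \<theta> s)) < ennreal \<delta>"
    using assms unfolding small_data_def by blast
  note nn = Lp_norm_nonneg[of 1 g] Lp_norm_nonneg[of p0 g] Lp_norm_nonneg[of 1 "\<lambda>s. f s * \<theta> s"]
    Lp_norm_nonneg[of p "\<lambda>s. f s * \<theta> s"] Lp_norm_nonneg[of 1 "\<lambda>s. deriv f s * \<theta> s"]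
  have l1: "norm_X1 \<xi>1 < ennreal \<delta>" and l2: "norm_X2 \<beta> A \<upsilon> \<xi>2 < ennreal \<delta>" and l3: "norm_X3 p0 g < ennreal \<delta>"
    and l4: "ennreal (Lp_norm 1 (\<lambda>s. f s * \<theta> s) + Lp_norm p (\<lambda>s. f s * \<theta> s)
              + Lp_norm 1 (\<lambda>s. deriv f s * \<theta> s)) < ennreal \<delta>"
  proof -
    have le: "a \<le> a + b + c + d" "b \<le> a + b + c + d" "c \<le> a + b + c + d" "d \<le> a + b + c + d" for a b c d :: ennreal
      by (simp_all add: add_increasing add_increasing2)
    show "norm_X1 \<xi>1 < ennreal \<delta>" by (rule le_less_trans[OF le(1) less])
    show "norm_X2 \<beta> A \<upsilon> \<xi>2 < ennreal \<delta>" by (rule le_less_trans[OF le(2) less])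
    show "norm_X3 p0 g < ennreal \<delta>" by (rule le_less_trans[OF le(3) less])
    show "ennreal (Lp_norm 1 (\<lambda>s. f s * \<theta> s) + Lp_norm p (\<lambda>s. f s * \<theta> s)
              + Lp_norm 1 (\<lambda>s. deriv f s * \<theta> s)) < ennreal \<delta>" by (rule le_less_trans[OF le(4) less])
  qed
  have 1: "\<bar>\<xi>1 t\<bar> \<le> \<delta>" if "0 \<le> t" for t
  proof -
    have "ennreal \<bar>\<xi>1 t\<bar> \<le> norm_X1 \<xi>1" unfolding norm_X1_def by (rule SUP_upper) (use that in auto)
    then have "ennreal \<bar>\<xi>1 t\<bar> < ennreal \<delta>" using l1 by (rule le_less_trans)
    then show ?thesis by (simp add: ennreal_less_iff)
  qed
  have 2: "\<bar>\<xi>2 0\<bar> \<le> \<delta>"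
  proof -
    \<comment> \<open>Evaluating the first supremum at t = 0, where the Mittag-Leffler factor is 1,
      extracts the initial value.\<close>
    have "ennreal \<bar>\<xi>2 0 * mittag_leffler \<beta> 1 (A * 0 powr \<beta>)\<bar> \<le> norm_X2 \<beta> A \<upsilon> \<xi>2"
      unfolding norm_X2_def by (rule add_increasing2[OF _ SUP_upper]) auto
    then have "ennreal \<bar>\<xi>2 0 * mittag_leffler \<beta> 1 (A * 0 powr \<beta>)\<bar> < ennreal \<delta>" using l2 by (rule le_less_trans)
    then show ?thesis by (simp add: ennreal_less_iff mittag_leffler_zero)
  qed
  have 3: "\<bar>deriv \<xi>2 t\<bar> \<le> \<delta> * t powr (\<upsilon> - 1)" if "0 < t" for t
  proof -
    have "ennreal (t powr (1 - \<upsilon>) * \<bar>deriv \<xi>2 t\<bar>) \<le> norm_X2 \<beta> A \<upsilon> \<xi>2"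
      unfolding norm_X2_def by (rule add_increasing[OF _ SUP_upper]) (use that in auto)
    then have "ennreal (t powr (1 - \<upsilon>) * \<bar>deriv \<xi>2 t\<bar>) < ennreal \<delta>" using l2 by (rule le_less_trans)
    then have "t powr (1 - \<upsilon>) * \<bar>deriv \<xi>2 t\<bar> \<le> \<delta>" by (simp add: ennreal_less_iff)
    then have "t powr (\<upsilon> - 1) * (t powr (1 - \<upsilon>) * \<bar>deriv \<xi>2 t\<bar>) \<le> t powr (\<upsilon> - 1) * \<delta>" by (intro mult_left_mono) auto
    moreover have "t powr (\<upsilon> - 1) * t powr (1 - \<upsilon>) = 1" using that by (simp flip: powr_add)
    ultimately show ?thesis unfolding mult.assoc[symmetric] by (simp add: mult.commute)
  qed
  have 4: "Lp_norm 1 g + Lp_norm p0 g < \<delta>"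
    using l3 nn by (simp add: norm_X3_def ennreal_less_iff del: ennreal_plus)
  have 5: "Lp_norm 1 (\<lambda>s. f s * \<theta> s) + Lp_norm p (\<lambda>s. f s * \<theta> s) + Lp_norm 1 (\<lambda>s. deriv f s * \<theta> s) < \<delta>"
    using l4 nn by (simp add: ennreal_less_iff del: ennreal_plus)
  have "data_bound \<upsilon> p0 p \<delta> \<xi>1 \<xi>2 g f \<theta>"
    unfolding data_bound_def using 1 2 3 4 5 nn by auto
  with E F show ?thesis by blast
qed

end

theorem theorem4p3:
  fixes \<beta> A \<alpha> \<gamma> \<tau> p \<upsilon> \<eta> p0 :: real and h :: "real \<Rightarrow> real"
  assumes "0 < \<beta>" "\<beta> < 1"
    and "A < 0"
    and "1 < \<alpha>" "\<alpha> < 2" "\<beta> + 1 > \<alpha>"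
    and "0 < \<gamma>" "\<gamma> < 1" "\<alpha> + \<gamma> > 2"
    and "\<tau> + \<gamma> > 1"
    and "p > 1 / (\<alpha> - 1)"
    and "h \<in> borel_measurable borel"
    and "0 < \<upsilon>" "\<upsilon> < \<beta>"
    and "0 < \<eta>" "\<eta> < \<beta> + 1"
    and "p0 > max (1 / \<eta>) 1"
  shows "((\<exists>\<delta>0>0. \<exists>C>0. A + C < 0 \<and> (\<forall>x. \<bar>x\<bar> < \<delta>0 \<longrightarrow> \<bar>h x\<bar> \<le> C * \<bar>x\<bar>)) \<longrightarrow>
            asymptotically_E_p_stable \<beta> A \<alpha> \<gamma> \<tau> \<upsilon> \<eta> p0 p h) \<and>
         ((\<exists>C>0. A + C < 0 \<and> (\<forall>x. \<bar>h x\<bar> \<le> C * \<bar>x\<bar>)) \<longrightarrow>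
            (\<forall>f \<theta>. admissible \<gamma> \<tau> f \<theta> \<and> integrable_forcing p f \<theta> \<longrightarrow>
               globally_E_stable \<beta> A \<alpha> \<upsilon> \<eta> p0 h f \<theta>))"
proof -
  interpret fractional_resolvent \<beta> "- A"
    by unfold_locales (use assms in auto)
  have \<tau>: "0 < \<tau>" using assms by linarith
  let ?u = "\<lambda>\<xi> f \<theta> t. \<xi> t + forcing \<alpha> f \<theta> t"
  obtain K where K: "0 < K" and data: "\<And>\<xi> \<xi>1 \<xi>2 \<xi>3 g f \<theta> \<delta>.
    E_decomposition \<beta> \<upsilon> \<eta> p0 \<xi> \<xi>1 \<xi>2 \<xi>3 g \<Longrightarrow> integrable_forcing p f \<theta> \<Longrightarrow> 0 < \<delta> \<Longrightarrow>
    data_bound \<upsilon> p0 p \<delta> \<xi>1 \<xi>2 g f \<theta> \<Longrightarrow>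
    (\<forall>t\<ge>0. \<bar>perturb (?u \<xi> f \<theta>) t\<bar> \<le> K * \<delta>) \<and> (perturb (?u \<xi> f \<theta>) \<longlongrightarrow> 0) at_top"
    using perturb_data[OF assms(4,5,6,11,13,14,15,16,17)] by blast
  have eq: "\<forall>s\<ge>0. X s = ?u \<xi> f \<theta> s + conv (rl_ker \<beta>) (\<lambda>r. - (- A) * X r + h (X r)) s"
    if sol: "is_solution \<beta> A \<alpha> h \<xi> f \<theta> X" and adm: "admissible \<gamma> \<tau> f \<theta>" and F: "integrable_forcing p f \<theta>" for X \<xi> f \<theta>
  proof (intro allI impI)
    fix s :: real assume "0 \<le> s"
    have "is_solution \<beta> (- (- A)) \<alpha> h \<xi> f \<theta> X" using sol by simp
    from solution_eq[OF this adm F assms(4,7) \<tau> \<open>0 \<le> s\<close>]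
    show "X s = ?u \<xi> f \<theta> s + conv (rl_ker \<beta>) (\<lambda>r. - (- A) * X r + h (X r)) s" .
  qed
  have cont: "continuous_on {0..} X" if "is_solution \<beta> A \<alpha> h \<xi> f \<theta> X" for X \<xi> f \<theta>
    using that by (simp add: is_solution_def)
  \<comment> \<open>The level \<open>e\<close> lies below \<open>\<delta>0\<close>, so a solution
    kept under \<open>e\<close> never leaves the region where \<open>h\<close> is controlled;
    smallness and decay are then obtained for the same \<delta>.\<close>
  have local: "\<exists>\<delta>>0. \<forall>\<xi> f \<theta>. admissible \<gamma> \<tau> f \<theta> \<and> small_data \<beta> A \<upsilon> \<eta> p0 p \<delta> \<xi> f \<theta> \<longrightarrow>
      (\<forall>X. is_solution \<beta> A \<alpha> h \<xi> f \<theta> X \<longrightarrow> (\<forall>t\<ge>0. \<bar>X t\<bar> < e) \<and> (X \<longlongrightarrow> 0) at_top)"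
    if e: "0 < e" "e < \<delta>0" and C: "0 < C" "A + C < 0" and h: "\<forall>x. \<bar>x\<bar> < \<delta>0 \<longrightarrow> \<bar>h x\<bar> \<le> C * \<bar>x\<bar>" for e \<delta>0 C
  proof -
    have C': "0 \<le> C" "C < - A" using C by auto
    have q: "0 < 1 - C / (- A)" using C assms by (simp add: field_simps)
    \<comment> \<open>Chosen so that the a priori bound K \<delta> / (1 - C / \<mu>) equals e /
      2.\<close>
    define \<delta> where "\<delta> = e * (1 - C / (- A)) / (2 * K)"
    have \<delta>: "0 < \<delta>" using e q K unfolding \<delta>_def by (intro divide_pos_pos mult_pos_pos) auto
    have ye: "K * \<delta> / (1 - C / (- A)) < e"
    proof -
      have "K * \<delta> = e / 2 * (1 - C / (- A))" using K by (simp add: \<delta>_def)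
      then have "K * \<delta> / (1 - C / (- A)) = e / 2" using q by simp
      then show ?thesis using e by simp
    qed
    have *: "(\<forall>t\<ge>0. \<bar>X t\<bar> < e) \<and> (X \<longlongrightarrow> 0) at_top"
      if adm: "admissible \<gamma> \<tau> f \<theta>" and sd: "small_data \<beta> A \<upsilon> \<eta> p0 p \<delta> \<xi> f \<theta>" and sol: "is_solution \<beta> A \<alpha> h \<xi> f \<theta> X" for \<xi> f \<theta> X
    proof -
      obtain \<xi>1 \<xi>2 \<xi>3 g where E: "E_decomposition \<beta> \<upsilon> \<eta> p0 \<xi> \<xi>1 \<xi>2 \<xi>3 g" and db: "data_bound \<upsilon> p0 p \<delta> \<xi>1 \<xi>2 g f \<theta>"
        and F: "integrable_forcing p f \<theta>"
        using small_data_imp_data_bound[OF sd] by blast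
      note Y = data[OF E F \<delta> db]
      note eq' = eq[OF sol adm F]
      have small: "\<bar>X t\<bar> < e" if "0 \<le> t" for t
        by (rule solution_small[OF cont[OF sol] assms(12) C' eq' _ _ ye that]) (use h e Y in auto)
      \<comment> \<open>Since \<bar>X\<bar> < e < \<open>\<delta>0\<close> throughout, the local
        bound on \<open>h\<close> acts as a global one along this solution.\<close>
      have "(X \<longlongrightarrow> 0) at_top"
        by (rule solution_tendsto_0[OF cont[OF sol] assms(12) C' eq', where y="K * \<delta>"])
           (use h less_trans[OF small e(2)] Y in auto)
      with small show ?thesis by blast
    qed
    show ?thesis
      by (intro exI[of _ \<delta>] conjI[OF \<delta>] allI impI) (elim conjE, rule *)
  qed
  have part_a: "asymptotically_E_p_stable \<beta> A \<alpha> \<gamma> \<tau> \<upsilon> \<eta> p0 p h"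
    if \<delta>0: "0 < \<delta>0" and C: "0 < C" "A + C < 0" and h: "\<forall>x. \<bar>x\<bar> < \<delta>0 \<longrightarrow> \<bar>h x\<bar> \<le> C * \<bar>x\<bar>" for \<delta>0 C
    unfolding asymptotically_E_p_stable_def E_p_stable_def
  proof (intro conjI allI impI)
    fix \<epsilon> :: real assume \<epsilon>: "0 < \<epsilon>"
    \<comment> \<open>Halving leaves room on both sides: the supremum is only known to be at most
      \<open>e\<close>, yet it has to be strictly below \<epsilon>.\<close>
    define e where "e = min \<epsilon> \<delta>0 / 2"
    have e: "0 < e" "e < \<delta>0" "e < \<epsilon>" using \<epsilon> \<delta>0 by (auto simp: e_def)
    obtain \<delta> where \<delta>: "0 < \<delta>" "\<And>\<xi> f \<theta> X t. admissible \<gamma> \<tau> f \<theta> \<Longrightarrow> small_data \<beta> A \<upsilon> \<eta> p0 p \<delta> \<xi> f \<theta> \<Longrightarrow>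
        is_solution \<beta> A \<alpha> h \<xi> f \<theta> X \<Longrightarrow> 0 \<le> t \<Longrightarrow> \<bar>X t\<bar> < e"
      using local[OF e(1,2) C h] by blast
    have sup: "(SUP t\<in>{0..}. ennreal \<bar>X t\<bar>) < ennreal \<epsilon>"
      if "admissible \<gamma> \<tau> f \<theta>" "small_data \<beta> A \<upsilon> \<eta> p0 p \<delta> \<xi> f \<theta>" "is_solution \<beta> A \<alpha> h \<xi> f \<theta> X" for \<xi> f \<theta> X
    proof -
      have "(SUP t\<in>{0..}. ennreal \<bar>X t\<bar>) \<le> ennreal e"
        using \<delta>(2)[OF that] by (intro SUP_least ennreal_leI) (auto intro: less_imp_le)
      also have "\<dots> < ennreal \<epsilon>" using e by (simp add: ennreal_less_iff)
      finally show ?thesis .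
    qed
    show "\<exists>\<delta>>0. \<forall>\<xi> f \<theta>. in_E \<beta> \<upsilon> \<eta> p0 \<xi> \<and> admissible \<gamma> \<tau> f \<theta> \<and> small_data \<beta> A \<upsilon> \<eta> p0 p \<delta> \<xi> f \<theta> \<longrightarrow>
        (\<forall>X. is_solution \<beta> A \<alpha> h \<xi> f \<theta> X \<longrightarrow> (SUP t\<in>{0..}. ennreal \<bar>X t\<bar>) < ennreal \<epsilon>)"
      by (intro exI[of _ \<delta>] conjI allI impI \<delta>(1)) (elim conjE, rule sup)
  next
    obtain \<delta> where \<delta>: "0 < \<delta>" "\<And>\<xi> f \<theta> X. admissible \<gamma> \<tau> f \<theta> \<Longrightarrow> small_data \<beta> A \<upsilon> \<eta> p0 p \<delta> \<xi> f \<theta> \<Longrightarrow>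
        is_solution \<beta> A \<alpha> h \<xi> f \<theta> X \<Longrightarrow> (X \<longlongrightarrow> 0) at_top"
      using local[of "\<delta>0 / 2" \<delta>0 C, OF _ _ C h] \<delta>0 by (simp, blast)
    show "\<exists>\<delta>>0. \<forall>\<xi> f \<theta>. in_E \<beta> \<upsilon> \<eta> p0 \<xi> \<and> admissible \<gamma> \<tau> f \<theta> \<and> small_data \<beta> A \<upsilon> \<eta> p0 p \<delta> \<xi> f \<theta> \<longrightarrow>
        (\<forall>X. is_solution \<beta> A \<alpha> h \<xi> f \<theta> X \<longrightarrow> (X \<longlongrightarrow> 0) at_top)"
      by (intro exI[of _ \<delta>] conjI allI impI \<delta>(1)) (elim conjE, rule \<delta>(2))
  qed
  have part_b: "globally_E_stable \<beta> A \<alpha> \<upsilon> \<eta> p0 h f \<theta>"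
    if C: "0 < C" "A + C < 0" and h: "\<forall>x. \<bar>h x\<bar> \<le> C * \<bar>x\<bar>" and adm: "admissible \<gamma> \<tau> f \<theta>" and F: "integrable_forcing p f \<theta>" for C f \<theta>
    unfolding globally_E_stable_def
  proof (intro allI impI)
    fix \<xi> X assume "in_E \<beta> \<upsilon> \<eta> p0 \<xi>" and sol: "is_solution \<beta> A \<alpha> h \<xi> f \<theta> X"
    then obtain \<xi>1 \<xi>2 \<xi>3 g where E: "E_decomposition \<beta> \<upsilon> \<eta> p0 \<xi> \<xi>1 \<xi>2 \<xi>3 g" by (auto simp: in_E_def)
    \<comment> \<open>Here \<delta> may be large: the global bound on \<open>h\<close> makes the a
      priori estimate available without any continuation argument.\<close>
    obtain \<delta> where \<delta>: "0 < \<delta>" "data_bound \<upsilon> p0 p \<delta> \<xi>1 \<xi>2 g f \<theta>" using data_bound_exists[OF E] by blast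
    note Y = data[OF E F \<delta>]
    have C': "0 \<le> C" "C < - A" using C by auto
    show "(X \<longlongrightarrow> 0) at_top"
      by (rule solution_tendsto_0[OF cont[OF sol] assms(12) C' eq[OF sol adm F], where y="K * \<delta>"]) (use h Y in auto)
  qed
  show ?thesis using part_a part_b by blast
qed

end
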